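(* Let $k$ be a positive integer. If a signed graph $(G,\sigma)$ is $(12k-1)$-edge connected and essentially $(2k+1)$-unbalanced, then $\Phi_c(G,\sigma)\le 2+\frac1k$.
   Context: A signed graph is a pair $(G,\sigma)$ where $G$ is a graph and $\sigma:E(G)\to\{1,-1\}$; edges with $\sigma(e)=1$ are positive, those with $\sigma(e)=-1$ negative. An orientation $\tau$ of $(G,\sigma)$ orients each positive edge $e=xy$ from one end to the other (if from $x$ to $y$, then $e\in E^+_\tau(x)\cap E^-_\tau(y)$), and labels each negative edge $e=xy$ either as a sink edge, with $e\in E^+_\tau(x)\cap E^+_\tau(y)$, or as a source edge, with $e\in E^-_\tau(x)\cap E^-_\tau(y)$. A circulation is an orientation $\tau$ together with a map $f:E(G)\to\mathbb{R}$. Its boundary is $\partial f(v)=\sum_{e\in E^+_\tau(v)}f(e)-\sum_{e\in E^-_\tau(v)}f(e)$. A flow is a circulation with $\partial f\equiv 0$. For a real $r$, a circular $r$-flow is a flow with $1\le |f(e)|\le r-1$ for every edge $e$. The circular flow number $\Phi_c(G,\sigma)$ is the least $r$ such that $(G,\sigma)$ admits a circular $r$-flow, and it is $\infty$ if no such flow exists. Switching at a vertex $v$ negates the sign of every edge incident to $v$. Two signed graphs on the same underlying graph are equivalent if one is obtained from the other by a sequence of switchings. $(G,\sigma)$ is essentially $(2k+1)$-unbalanced if every signed graph equivalent to it has either an even number of negative edges or at least $2k+1$ negative edges. Edge connectivity refers to the underlying graph $G$. *)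

theory Defs
  imports Complex_Main "HOL-Library.Extended_Real"
begin

definition signed_graph :: "'v set \<Rightarrow> 'e set \<Rightarrow> ('e \<Rightarrow> 'v \<times> 'v) \<Rightarrow> ('e \<Rightarrow> int) \<Rightarrow> bool" where
  "signed_graph V E ends \<sigma> \<longleftrightarrow> finite V \<and> finite E \<and>
     (\<forall>e\<in>E. fst (ends e) \<in> V \<and> snd (ends e) \<in> V) \<and>
     (\<forall>e\<in>E. \<sigma> e = 1 \<or> \<sigma> e = -1)"

definition edge_connected :: "'v set \<Rightarrow> 'e set \<Rightarrow> ('e \<Rightarrow> 'v \<times> 'v) \<Rightarrow> nat \<Rightarrow> bool" where
  "edge_connected V E ends m \<longleftrightarrow>
     (\<forall>X. X \<subseteq> V \<and> X \<noteq> {} \<and> X \<noteq> V \<longrightarrow>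
        card {e\<in>E. (fst (ends e) \<in> X) \<noteq> (snd (ends e) \<in> X)} \<ge> m)"

text \<open>Switching at a vertex v negates the sign of every edge incident to v
  (a loop at v is negated twice, so it keeps its sign).\<close>

definition switch_at :: "('e \<Rightarrow> 'v \<times> 'v) \<Rightarrow> 'v \<Rightarrow> ('e \<Rightarrow> int) \<Rightarrow> ('e \<Rightarrow> int)" where
  "switch_at ends v \<sigma> = (\<lambda>e. if (fst (ends e) = v) \<noteq> (snd (ends e) = v) then - \<sigma> e else \<sigma> e)"

definition switch_step :: "'v set \<Rightarrow> ('e \<Rightarrow> 'v \<times> 'v) \<Rightarrow> ('e \<Rightarrow> int) \<Rightarrow> ('e \<Rightarrow> int) \<Rightarrow> bool" where
  "switch_step V ends \<sigma> \<sigma>' \<longleftrightarrow> (\<exists>v\<in>V. \<sigma>' = switch_at ends v \<sigma>)"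

definition equivalent_sig :: "'v set \<Rightarrow> ('e \<Rightarrow> 'v \<times> 'v) \<Rightarrow> ('e \<Rightarrow> int) \<Rightarrow> ('e \<Rightarrow> int) \<Rightarrow> bool" where
  "equivalent_sig V ends \<sigma> \<sigma>' \<longleftrightarrow> (switch_step V ends)\<^sup>*\<^sup>* \<sigma> \<sigma>'"

definition essentially_unbalanced ::
  "'v set \<Rightarrow> 'e set \<Rightarrow> ('e \<Rightarrow> 'v \<times> 'v) \<Rightarrow> ('e \<Rightarrow> int) \<Rightarrow> nat \<Rightarrow> bool" where
  "essentially_unbalanced V E ends \<sigma> t \<longleftrightarrow>
     (\<forall>\<sigma>'. equivalent_sig V ends \<sigma> \<sigma>' \<longrightarrow>
        even (card {e\<in>E. \<sigma>' e = -1}) \<or> card {e\<in>E. \<sigma>' e = -1} \<ge> t)"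

text \<open>An orientation is encoded by half-edge signs: tau1 e at the first end of e and
  tau2 e at the second end, with value 1 meaning e \<in> E+ at that end and -1 meaning
  e \<in> E- there. Positive edge: tau1 e = - tau2 e (oriented from the end with +1);
  negative edge: tau1 e = tau2 e (both 1: sink edge, both -1: source edge).
  I.e. tau1 e * tau2 e = - sigma e.\<close>

definition orientation :: "'e set \<Rightarrow> ('e \<Rightarrow> int) \<Rightarrow> ('e \<Rightarrow> int) \<Rightarrow> ('e \<Rightarrow> int) \<Rightarrow> bool" where
  "orientation E \<sigma> \<tau>1 \<tau>2 \<longleftrightarrow>
     (\<forall>e\<in>E. (\<tau>1 e = 1 \<or> \<tau>1 e = -1) \<and> \<tau>2 e = - \<sigma> e * \<tau>1 e)"

definition boundary :: "'e set \<Rightarrow> ('e \<Rightarrow> 'v \<times> 'v) \<Rightarrow> ('e \<Rightarrow> int) \<Rightarrow> ('e \<Rightarrow> int)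
    \<Rightarrow> ('e \<Rightarrow> real) \<Rightarrow> 'v \<Rightarrow> real" where
  "boundary E ends \<tau>1 \<tau>2 f v =
     (\<Sum>e\<in>E. (if fst (ends e) = v then of_int (\<tau>1 e) * f e else 0)
            + (if snd (ends e) = v then of_int (\<tau>2 e) * f e else 0))"

definition is_flow :: "'v set \<Rightarrow> 'e set \<Rightarrow> ('e \<Rightarrow> 'v \<times> 'v) \<Rightarrow> ('e \<Rightarrow> int)
    \<Rightarrow> ('e \<Rightarrow> int) \<Rightarrow> ('e \<Rightarrow> int) \<Rightarrow> ('e \<Rightarrow> real) \<Rightarrow> bool" where
  "is_flow V E ends \<sigma> \<tau>1 \<tau>2 f \<longleftrightarrow> orientation E \<sigma> \<tau>1 \<tau>2 \<and>
     (\<forall>v\<in>V. boundary E ends \<tau>1 \<tau>2 f v = 0)"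

definition circular_flow :: "'v set \<Rightarrow> 'e set \<Rightarrow> ('e \<Rightarrow> 'v \<times> 'v) \<Rightarrow> ('e \<Rightarrow> int) \<Rightarrow> real \<Rightarrow> bool" where
  "circular_flow V E ends \<sigma> r \<longleftrightarrow>
     (\<exists>\<tau>1 \<tau>2 f. is_flow V E ends \<sigma> \<tau>1 \<tau>2 f \<and> (\<forall>e\<in>E. 1 \<le> \<bar>f e\<bar> \<and> \<bar>f e\<bar> \<le> r - 1))"

text \<open>Circular flow number: infimum (least) r admitting a circular r-flow; \<infinity> if none.\<close>

definition circular_flow_number :: "'v set \<Rightarrow> 'e set \<Rightarrow> ('e \<Rightarrow> 'v \<times> 'v) \<Rightarrow> ('e \<Rightarrow> int) \<Rightarrow> ereal" where
  "circular_flow_number V E ends \<sigma> = Inf (ereal ` {r. circular_flow V E ends \<sigma> r})"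

end

theory Submission
  imports Defs
begin

text \<open>Switch to an equivalent signature with as few negative edges as possible. Then every cut has
  at least as many positive as negative edges, so the positive graph is 6k-edge-connected. By the
  theorem of Lovasz, Thomassen, Wu and Zhang it has orientations with arbitrary prescribed net
  outdegrees modulo 2k+1 (of sum 0), and by a supply-demand argument these yield integer flows with
  values of modulus k or k+1 and exact boundary b, provided |b(X)| is at most 2k more than k times
  the size of the cut of X. It remains to give the negative edges values of modulus k or k+1 with
  sum 0 such that their boundary obeys this bound. By the orientation theorem and Edmonds'
  branching theorem the positive graph has two disjoint connected spanning subgraphs. One of them
  together with a parity correction inside the other is a set J of positive edges such that J
  and the negative edges together have an Euler trail. Along the trail the values k and -k
  alternate at the negative edges. If their number is even, then the flow along J is a witness for
  the bound. If it is odd, hence at least 2k+1, then k values are raised to k+1 in modulus in order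
  to restore sum 0, and this costs the additional 2k.\<close>

section \<open>Distance to the multiples of an integer\<close>

text \<open>Where the constants come from. In a signature with fewest negative edges at least half
  of each cut is positive, and half of \<open>12k - 1\<close>, rounded up, is \<open>6k\<close>. The
  induction for modular orientations wants cuts of size \<open>4k\<close> plus a distance of at most
  \<open>2k + 1\<close>, which would be \<open>6k + 1\<close>; but distance and cut size have equal
  parity, and this saves one. The boundaries of a signed flow add up to twice the sum of its values
  on negative edges, so these values must have sum 0. An odd number of values of modulus
  \<open>k\<close> or \<open>k + 1\<close> can cancel only if there are at least
  \<open>2k + 1\<close> of them, the extreme case being \<open>k\<close> values \<open>k + 1\<close>
  against \<open>k + 1\<close> values \<open>-k\<close>. The obstacle is that negative edges inside
  a vertex set may far outnumber the positive edges leaving it, so that careless values on them ask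
  too much of the cut. The Euler trail ties their boundary to that of a flow of modulus
  \<open>k\<close> on positive edges, and such a flow carries at most \<open>k\<close> times the
  size of a cut across it.\<close>

definition cnorm :: "int \<Rightarrow> int \<Rightarrow> int" where
  "cnorm M x = min (x mod M) (M - x mod M)"

lemma cnorm_le_abs_diff:
  assumes "M > 0" shows "cnorm M x \<le> \<bar>x - M * j\<bar>"
proof (cases "j \<le> x div M")
  case True
  then have "M * j \<le> M * (x div M)" using assms by (simp add: mult_left_mono)
  then show ?thesis unfolding cnorm_def minus_mult_div_eq_mod[symmetric] by linarith
next
  case False
  then have "M * (x div M + 1) \<le> M * j" using assms by (intro mult_left_mono) auto
  then have "M * (x div M) + M \<le> M * j" by (simp add: algebra_simps)
  then show ?thesis unfolding cnorm_def minus_mult_div_eq_mod[symmetric] by linarith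
qed

lemma cnorm_witness:
  assumes "M > 0" obtains j where "cnorm M x = \<bar>x - M * j\<bar>"
proof (cases "x mod M \<le> M - x mod M")
  case True
  then have "cnorm M x = \<bar>x - M * (x div M)\<bar>"
    unfolding cnorm_def using pos_mod_sign[OF assms] by (simp add: minus_mult_div_eq_mod)
  then show ?thesis using that by blast
next
  case False
  have "cnorm M x = \<bar>x - M * (x div M + 1)\<bar>"
    unfolding cnorm_def using False pos_mod_bound[OF assms, of x] minus_mult_div_eq_mod[of x M]
    by (simp add: distrib_left)
  then show ?thesis using that by blast
qed

lemma cnorm_nonneg: "M > 0 \<Longrightarrow> 0 \<le> cnorm M x"
  by (metis cnorm_witness abs_ge_zero)

lemma cnorm_le_abs: "M > 0 \<Longrightarrow> cnorm M x \<le> \<bar>x\<bar>"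
  using cnorm_le_abs_diff[of M x 0] by simp

lemma cnorm_le_half: "2 * cnorm M x \<le> M"
  unfolding cnorm_def by (simp add: min_def)

lemma cnorm_triangle:
  assumes "M > 0" shows "cnorm M (x + y) \<le> cnorm M x + cnorm M y"
proof -
  obtain i where i: "cnorm M x = \<bar>x - M * i\<bar>" using cnorm_witness assms by metis
  obtain j where j: "cnorm M y = \<bar>y - M * j\<bar>" using cnorm_witness assms by metis
  have "cnorm M (x + y) \<le> \<bar>x + y - M * (i + j)\<bar>" by (rule cnorm_le_abs_diff[OF assms])
  then show ?thesis unfolding i j by (simp add: algebra_simps)
qed

lemma cnorm_minus:
  assumes "M > 0" shows "cnorm M (- x) = cnorm M x"
proof -
  have *: "cnorm M (- x) \<le> cnorm M x" for x
  proof -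
    obtain j where "cnorm M x = \<bar>x - M * j\<bar>" using cnorm_witness assms by metis
    then show ?thesis using cnorm_le_abs_diff[OF assms, of "- x" "- j"] by simp
  qed
  show ?thesis using *[of x] *[of "- x"] by simp
qed

lemma cnorm_parity:
  assumes "M > 0" "even M" shows "even (cnorm M x) \<longleftrightarrow> even x"
proof -
  obtain j where "cnorm M x = \<bar>x - M * j\<bar>" using cnorm_witness assms by metis
  then show ?thesis using assms by simp
qed

lemma cnorm_eq_0_iff: "M > 0 \<Longrightarrow> cnorm M x = 0 \<longleftrightarrow> M dvd x"
  unfolding cnorm_def min_def using pos_mod_bound[of M x]
  by (auto simp: dvd_eq_mod_eq_0 simp del: pos_mod_bound)

text \<open>On a circle of length \<open>2 * m\<close> the distances to 0 and to the antipode
  \<open>m\<close> add up to \<open>m\<close>. The exchange of external edges in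
  \<open>not_all_positive\<close> moves a residue to its antipode.\<close>

lemma cnorm_add_half:
  assumes "m > 0" shows "cnorm (2 * m) (x + m) = m - cnorm (2 * m) x"
proof (rule antisym)
  have M: "2 * m > 0" using assms by simp
  obtain j where j: "cnorm (2 * m) x = \<bar>x - 2 * m * j\<bar>" using cnorm_witness M by metis
  define d where "d = x - 2 * m * j"
  have "x + m - 2 * m * j = d + m" "x + m - 2 * m * (j + 1) = d - m"
    unfolding d_def by (simp_all add: algebra_simps)
  moreover have j': "cnorm (2 * m) x = \<bar>d\<bar>" unfolding d_def by (rule j)
  ultimately have "cnorm (2 * m) (x + m) \<le> \<bar>d + m\<bar>" "cnorm (2 * m) (x + m) \<le> \<bar>d - m\<bar>"
    using cnorm_le_abs_diff[OF M, of "x + m"] by metis+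
  moreover have "2 * cnorm (2 * m) x \<le> 2 * m" by (rule cnorm_le_half)
  ultimately show "cnorm (2 * m) (x + m) \<le> m - cnorm (2 * m) x" unfolding j' by linarith
  have "cnorm (2 * m) m = m" unfolding cnorm_def using assms by simp
  moreover have "cnorm (2 * m) (x + m + - x) \<le> cnorm (2 * m) (x + m) + cnorm (2 * m) (- x)"
    by (rule cnorm_triangle[OF M])
  ultimately show "m - cnorm (2 * m) x \<le> cnorm (2 * m) (x + m)"
    using cnorm_minus[OF M, of x] by simp
qed

lemma cnorm_decrease:
  assumes "M > 0" "cnorm M x \<noteq> 0"
  shows "cnorm M (x - 1) < cnorm M x \<or> cnorm M (x + 1) < cnorm M x"
proof -
  obtain j where j: "cnorm M x = \<bar>x - M * j\<bar>" using cnorm_witness assms(1) by metis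
  have "cnorm M (x - 1) \<le> \<bar>x - 1 - M * j\<bar>" "cnorm M (x + 1) \<le> \<bar>x + 1 - M * j\<bar>"
    by (rule cnorm_le_abs_diff[OF assms(1)])+
  then show ?thesis using assms(2) unfolding j by linarith
qed

lemma cnorm_add_diff_1:
  assumes "M > 0" "\<bar>y - x\<bar> \<le> 1" shows "\<bar>cnorm M y - cnorm M x\<bar> \<le> 1"
proof -
  have "cnorm M (y - x) \<le> 1" using cnorm_le_abs[OF assms(1), of "y - x"] assms(2) by linarith
  moreover have "cnorm M (x - y) = cnorm M (y - x)" using cnorm_minus[OF assms(1), of "y - x"] by simp
  ultimately show ?thesis
    using cnorm_triangle[OF assms(1), of x "y - x"] cnorm_triangle[OF assms(1), of y "x - y"] by simp
qed

text \<open>The period \<open>4k + 2\<close> records a residue modulo \<open>2k + 1\<close> together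
  with a parity, see \<open>nrm_eq_0_iff\<close>. Because of the parity, \<open>nrm\<close> changes
  by exactly 1 whenever its argument does, and comparisons with cut degrees move in steps of
  2.\<close>

definition nrm :: "nat \<Rightarrow> int \<Rightarrow> int" where
  "nrm k x = cnorm (2 * (2 * int k + 1)) x"

lemma nrm_nonneg: "0 \<le> nrm k x"
  unfolding nrm_def by (rule cnorm_nonneg) simp

lemma nrm_le: "nrm k x \<le> 2 * int k + 1"
  unfolding nrm_def using cnorm_le_half[of "2 * (2 * int k + 1)" x] by simp

lemma nrm_le_abs: "nrm k x \<le> \<bar>x\<bar>"
  unfolding nrm_def by (rule cnorm_le_abs) simp

lemma nrm_triangle: "nrm k (x + y) \<le> nrm k x + nrm k y"
  unfolding nrm_def by (rule cnorm_triangle) simp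

lemma nrm_minus: "nrm k (- x) = nrm k x"
  unfolding nrm_def by (rule cnorm_minus) simp

lemma nrm_parity: "even (nrm k x) \<longleftrightarrow> even x"
  unfolding nrm_def by (rule cnorm_parity) simp_all

lemma nrm_eq_0_iff: "nrm k x = 0 \<longleftrightarrow> 2 * int k + 1 dvd x \<and> even x"
proof -
  have "coprime 2 (2 * int k + 1)" by simp
  then have "2 * (2 * int k + 1) dvd x \<longleftrightarrow> 2 * int k + 1 dvd x \<and> even x"
    by (metis divides_mult dvd_mult_left dvd_mult_right)
  then show ?thesis unfolding nrm_def by (subst cnorm_eq_0_iff) simp_all
qed

lemma nrm_add_half: "nrm k (x + (2 * int k + 1)) = 2 * int k + 1 - nrm k x"
  unfolding nrm_def by (rule cnorm_add_half) simp

lemma nrm_step: "nrm k (x + 1) = nrm k x + 1 \<or> nrm k (x + 1) = nrm k x - 1"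
proof -
  have "\<bar>nrm k (x + 1) - nrm k x\<bar> \<le> 1" unfolding nrm_def by (rule cnorm_add_diff_1) simp_all
  moreover have "nrm k (x + 1) \<noteq> nrm k x" using nrm_parity[of k x] nrm_parity[of k "x + 1"] by auto
  ultimately show ?thesis by linarith
qed

text \<open>A substitute for the sign of a residue: it says whether \<open>x\<close> approaches 0 by
  being lowered or by being raised. At the antipode of 0 both are true.\<close>

lemma nrm_decrease: "nrm k x \<noteq> 0 \<Longrightarrow> nrm k (x - 1) < nrm k x \<or> nrm k (x + 1) < nrm k x"
  unfolding nrm_def by (rule cnorm_decrease) simp_all

lemma nrm_diff_0: "nrm k (x - y) = 0 \<Longrightarrow> nrm k x = nrm k y"
  using nrm_triangle[of k y "x - y"] nrm_triangle[of k x "y - x"] nrm_minus[of k "x - y"] by simp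

section \<open>Orientations with prescribed net degrees modulo 2k+1\<close>

definition unit_edge :: "'v \<Rightarrow> 'v \<Rightarrow> 'v \<Rightarrow> 'v \<Rightarrow> int" where
  "unit_edge x y u v = of_bool (u = x \<and> v = y) + of_bool (u = y \<and> v = x)"

definition unit_flow :: "'v \<Rightarrow> 'v \<Rightarrow> 'v \<Rightarrow> 'v \<Rightarrow> int" where
  "unit_flow x y u v = of_bool (u = x \<and> v = y) - of_bool (u = y \<and> v = x)"

text \<open>The size of the cut around \<open>A\<close> when \<open>a x\<close> further edges join
  each \<open>x\<close> to one vertex outside \<open>U\<close>.\<close>

definition deg :: "'v set \<Rightarrow> ('v \<Rightarrow> 'v \<Rightarrow> int) \<Rightarrow> ('v \<Rightarrow> int) \<Rightarrow> 'v set \<Rightarrow> int" where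
  "deg U w a A = (\<Sum>x\<in>A. \<Sum>y\<in>U - A. w x y) + sum a A"

lemma sum_of_bool_pair:
  assumes "finite A" "finite B"
  shows "(\<Sum>u\<in>A. \<Sum>v\<in>B. of_bool (u = x \<and> v = y) :: int) = of_bool (x \<in> A \<and> y \<in> B)"
proof -
  have "(\<Sum>v\<in>B. of_bool (u = x \<and> v = y) :: int) = (if u = x then of_bool (y \<in> B) else 0)" for u
    using assms(2) by (auto simp: of_bool_def)
  then show ?thesis using assms(1) by simp
qed

lemma sum_of_bool_eq: "finite A \<Longrightarrow> (\<Sum>u\<in>A. of_bool (u = x) :: int) = of_bool (x \<in> A)"
  by (simp add: of_bool_def)

lemma sum_unit_edge:
  assumes "finite A" "finite B"
  shows "(\<Sum>u\<in>A. \<Sum>v\<in>B. unit_edge x y u v) = of_bool (x \<in> A \<and> y \<in> B) + of_bool (y \<in> A \<and> x \<in> B)"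
  unfolding unit_edge_def by (simp only: sum.distrib sum_of_bool_pair[OF assms])

lemma sum_unit_flow:
  assumes "finite B"
  shows "(\<Sum>v\<in>B. unit_flow x y u v) = of_bool (u = x \<and> y \<in> B) - of_bool (u = y \<and> x \<in> B)"
  using sum_of_bool_pair[of "{u}" B x y] sum_of_bool_pair[of "{u}" B y x] assms
  unfolding unit_flow_def by (auto simp: sum_subtractf)

lemma deg_add_edge:
  assumes "finite U" "A \<subseteq> U" "x \<in> U" "y \<in> U"
  shows "deg U (\<lambda>u v. w u v + c * unit_edge x y u v) a A
    = deg U w a A + c * of_bool ((x \<in> A) \<noteq> (y \<in> A))"
proof -
  have fin: "finite A" "finite (U - A)" using assms finite_subset by auto
  have "(\<Sum>u\<in>A. \<Sum>v\<in>U - A. w u v + c * unit_edge x y u v)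
      = (\<Sum>u\<in>A. \<Sum>v\<in>U - A. w u v) + c * (\<Sum>u\<in>A. \<Sum>v\<in>U - A. unit_edge x y u v)"
    by (simp add: sum.distrib sum_distrib_left)
  then show ?thesis unfolding deg_def sum_unit_edge[OF fin] using assms by auto
qed

lemma sum_add_point:
  "finite A \<Longrightarrow> (\<Sum>u\<in>A. b u + c * of_bool (u = x) :: int) = sum b A + c * of_bool (x \<in> A)"
  by (simp add: sum.distrib sum_of_bool_eq flip: sum_distrib_left)

lemma deg_add_point:
  assumes "finite U" "A \<subseteq> U"
  shows "deg U w (\<lambda>u. a u + c * of_bool (u = x)) A = deg U w a A + c * of_bool (x \<in> A)"
  using assms finite_subset[of A U] unfolding deg_def by (simp add: sum_add_point)

text \<open>The induction hypothesis of Lovasz, Thomassen, Wu and Zhang. Their special vertex, whose edges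
  are already oriented, is not an element of U: it has a x edges to x, and p x is the number of
  those leaving x minus the number of those entering x. The wanted net outdegree b x matters
  modulo 2k+1 only, but its parity is that of the degree, so that b is determined modulo 2(2k+1) and
  nrm k (sum b A) is the quantity called |tau(A)| in their proof. At most one vertex v0 is exempt
  from the degree condition.\<close>

locale admissible =
  fixes k :: nat and U :: "'v set" and w :: "'v \<Rightarrow> 'v \<Rightarrow> int" and a p b :: "'v \<Rightarrow> int" and v0 :: 'v
  assumes finite_U: "finite U"
    and w_sym: "w x y = w y x" and w_nonneg: "0 \<le> w x y" and w_diag: "w x x = 0"
    and p_le: "x \<in> U \<Longrightarrow> \<bar>p x\<bar> \<le> a x" and p_parity: "x \<in> U \<Longrightarrow> even (p x - a x)"
    and b_parity: "x \<in> U \<Longrightarrow> even (b x - deg U w a {x})"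
    and total: "nrm k (sum p U - sum b U) = 0"
    and exempt: "v0 \<in> U \<Longrightarrow> nrm k (b v0) = 0"
    and external_le: "sum a U \<le> 4 * int k + nrm k (sum b U)"
    and cut_ge: "A \<subseteq> U \<Longrightarrow> A \<noteq> {} \<Longrightarrow> A \<noteq> U \<Longrightarrow> A \<noteq> {v0} \<Longrightarrow>
      4 * int k + nrm k (sum b A) \<le> deg U w a A"
begin

lemma a_nonneg: "x \<in> U \<Longrightarrow> 0 \<le> a x"
  using p_le by (metis abs_ge_zero order_trans)

end

definition skew :: "('v \<Rightarrow> 'v \<Rightarrow> int) \<Rightarrow> bool" where
  "skew n \<longleftrightarrow> (\<forall>x y. n y x = - n x y)"

text \<open>\<open>n x y\<close> is the number of edges directed from \<open>x\<close> to
  \<open>y\<close> minus the number directed back. Orienting \<open>w x y\<close> parallel edges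
  realises exactly the values of modulus at most \<open>w x y\<close> and of the same parity, so
  \<open>n\<close> stands for an orientation up to the names of parallel edges.\<close>

definition extendable :: "nat \<Rightarrow> 'v set \<Rightarrow> ('v \<Rightarrow> 'v \<Rightarrow> int) \<Rightarrow> ('v \<Rightarrow> int) \<Rightarrow> ('v \<Rightarrow> int) \<Rightarrow> bool" where
  "extendable k U w p b \<longleftrightarrow> (\<exists>n. skew n \<and>
     (\<forall>x\<in>U. \<forall>y\<in>U. \<bar>n x y\<bar> \<le> w x y \<and> even (n x y - w x y)) \<and>
     (\<forall>x\<in>U. 2 * int k + 1 dvd (\<Sum>y\<in>U. n x y) + p x - b x))"

definition weight :: "'v set \<Rightarrow> ('v \<Rightarrow> 'v \<Rightarrow> int) \<Rightarrow> int" where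
  "weight U w = (\<Sum>x\<in>U. \<Sum>y\<in>U. w x y)"

text \<open>Weight is compared before \<open>sum a\<close> because \<open>not_all_positive\<close>
  deletes an inner edge at the price of many new external ones. The last component pays for the
  deletion of an external edge in \<open>no_removable_external_edge\<close>.\<close>

definition smaller :: "'v set \<Rightarrow> ('v \<Rightarrow> 'v \<Rightarrow> int) \<Rightarrow> ('v \<Rightarrow> int)
    \<Rightarrow> 'v set \<Rightarrow> ('v \<Rightarrow> 'v \<Rightarrow> int) \<Rightarrow> ('v \<Rightarrow> int) \<Rightarrow> bool" where
  "smaller U' w' a' U w a \<longleftrightarrow> card U' < card U \<or>
     U' = U \<and> (weight U w' < weight U w \<or> weight U w' = weight U w \<and> sum a' U < sum a U)"

lemma weight_add_edge:
  assumes "finite U" "x \<in> U" "y \<in> U"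
  shows "weight U (\<lambda>u v. w u v + c * unit_edge x y u v) = weight U w + 2 * c"
proof -
  have "weight U (\<lambda>u v. w u v + c * unit_edge x y u v)
      = weight U w + c * (\<Sum>u\<in>U. \<Sum>v\<in>U. unit_edge x y u v)"
    unfolding weight_def by (simp add: sum.distrib sum_distrib_left)
  then show ?thesis unfolding sum_unit_edge[OF assms(1,1)] using assms by simp
qed

lemma unit_edge_commute: "unit_edge x y = unit_edge y x"
  unfolding unit_edge_def by (intro ext) simp

lemma even_sum_symmetric:
  fixes w :: "'v \<Rightarrow> 'v \<Rightarrow> int"
  assumes "finite A" "\<And>x y. w x y = w y x" "\<And>x. w x x = 0"
  shows "even (\<Sum>x\<in>A. \<Sum>y\<in>A. w x y)"
  using assms(1)
proof (induction A)
  case (insert z A)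
  have "(\<Sum>x\<in>insert z A. \<Sum>y\<in>insert z A. w x y)
      = (\<Sum>y\<in>A. w z y) + (\<Sum>x\<in>A. w x z) + (\<Sum>x\<in>A. \<Sum>y\<in>A. w x y)"
    using insert.hyps assms(3) by (simp add: sum.distrib)
  also have "(\<Sum>x\<in>A. w x z) = (\<Sum>x\<in>A. w z x)" by (rule sum.cong) (simp_all add: assms(2)[of _ z])
  finally show ?case using insert.IH by simp
qed simp

lemma deg_singleton: "finite U \<Longrightarrow> w x x = 0 \<Longrightarrow> deg U w a {x} = (\<Sum>y\<in>U. w x y) + a x"
  unfolding deg_def by (cases "x \<in> U") (simp_all add: sum_diff1)

text \<open>Edges inside \<open>A\<close> are counted twice by the sum of the degrees, all others in
  the cut once.\<close>

lemma even_sum_deg: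
  assumes "finite U" "A \<subseteq> U" "\<And>x y. w x y = w y x" "\<And>x. w x x = 0"
  shows "even ((\<Sum>x\<in>A. deg U w a {x}) - deg U w a A)"
proof -
  have fin: "finite A" using finite_subset[OF assms(2,1)] .
  have "(\<Sum>y\<in>U. w x y) = (\<Sum>y\<in>A. w x y) + (\<Sum>y\<in>U - A. w x y)" for x
    using sum.subset_diff[OF assms(2,1)] by (simp add: add.commute)
  moreover have "deg U w a {x} = (\<Sum>y\<in>U. w x y) + a x" for x
    by (rule deg_singleton[OF assms(1,4)])
  ultimately have "(\<Sum>x\<in>A. deg U w a {x}) = deg U w a A + (\<Sum>x\<in>A. \<Sum>y\<in>A. w x y)"
    by (simp add: deg_def sum.distrib)
  then show ?thesis using even_sum_symmetric[OF fin assms(3,4)] by simp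
qed

lemma (in admissible) cut_parity:
  assumes "A \<subseteq> U" shows "even (sum b A - deg U w a A)"
proof -
  have "even (\<Sum>x\<in>A. b x - deg U w a {x})"
    by (rule dvd_sum) (use b_parity assms in blast)
  then have "even (sum b A - (\<Sum>x\<in>A. deg U w a {x}))" by (simp only: sum_subtractf)
  moreover have "even ((\<Sum>x\<in>A. deg U w a {x}) - deg U w a A)"
    by (rule even_sum_deg[OF finite_U assms w_sym w_diag])
  ultimately have "even ((sum b A - (\<Sum>x\<in>A. deg U w a {x})) + ((\<Sum>x\<in>A. deg U w a {x}) - deg U w a A))"
    by (rule dvd_add)
  then show ?thesis by (simp only: diff_add_cancel add_diff_eq)
qed

lemma skewD: "skew n \<Longrightarrow> n y x = - n x y"
  unfolding skew_def by (drule spec, drule spec)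

lemma skewI: "(\<And>x y. n y x = - n x y) \<Longrightarrow> skew n"
  unfolding skew_def by (intro allI)

lemma extendableE:
  assumes "extendable k U w p b"
  obtains n where "skew n"
    "\<And>x y. x \<in> U \<Longrightarrow> y \<in> U \<Longrightarrow> \<bar>n x y\<bar> \<le> w x y \<and> even (n x y - w x y)"
    "\<And>x. x \<in> U \<Longrightarrow> 2 * int k + 1 dvd (\<Sum>y\<in>U. n x y) + p x - b x"
  using assms unfolding extendable_def by blast

lemma skew_unit_flow: "skew (unit_flow x y)"
  by (rule skewI) (simp only: unit_flow_def minus_diff_eq conj_commute)

lemma skew_add:
  assumes "skew n" "skew n'" shows "skew (\<lambda>u v. n u v + c * n' u v)"
proof (rule skewI)
  fix x y
  show "n y x + c * n' y x = - (n x y + c * n' x y)"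
    unfolding skewD[OF assms(1), of y x] skewD[OF assms(2), of y x] by simp
qed

lemma skew_minus:
  assumes "skew n" shows "skew (\<lambda>u v. - n u v)"
  by (rule skewI, subst skewD[OF assms]) (rule refl)

lemma bounded_parity_add:
  fixes c d e w :: int
  assumes "\<bar>c\<bar> \<le> w + (-1) * e" "even (c - (w + (-1) * e))" "\<bar>d\<bar> = e" "even (d - e)"
  shows "\<bar>c + d\<bar> \<le> w \<and> even (c + d - w)"
proof
  show "\<bar>c + d\<bar> \<le> w" using assms(1,3) by linarith
  have "c + d - w = (c - (w + (-1) * e)) + (d - e)" by simp
  moreover have "even ((c - (w + (-1) * e)) + (d - e))" by (rule dvd_add[OF assms(2,4)])
  ultimately show "even (c + d - w)" by (simp only:)
qed

lemma bounded_parity_pred: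
  fixes c w :: int
  assumes "\<bar>c\<bar> \<le> w - 1" "even (c - (w - 1))" "s = 1 \<or> s = -1"
  shows "\<bar>c + s\<bar> \<le> w \<and> even (c + s - w)"
  by (rule bounded_parity_add[of _ _ 1]) (use assms in \<open>auto simp: add.commute\<close>)

text \<open>One of \<open>w + 1\<close> parallel edges with net flow \<open>c\<close> is taken away.
  If \<open>c > 0\<close>, some edge runs forwards. Otherwise some edge runs backwards: if
  \<open>c = 0\<close>, then \<open>w + 1\<close> is even, so there are edges in both
  directions.\<close>

lemma bounded_parity_step:
  fixes c w :: int
  assumes "0 \<le> w" "\<bar>c\<bar> \<le> w + 1" "even (c - (w + 1))"
  shows "\<bar>c - (if c > 0 then 1 else -1)\<bar> \<le> w \<and> even (c - (if c > 0 then 1 else -1) - w)"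
proof -
  have "c \<noteq> 0 \<or> w \<noteq> 0" using assms(3) by auto
  then show ?thesis using assms by (auto simp: abs_if split: if_splits)
qed

lemma extendable_minus:
  assumes "extendable k U w (\<lambda>x. - p x) (\<lambda>x. - b x)"
  shows "extendable k U w p b"
proof -
  obtain n where n: "skew n" "\<forall>x\<in>U. \<forall>y\<in>U. \<bar>n x y\<bar> \<le> w x y \<and> even (n x y - w x y)"
    "\<forall>x\<in>U. 2 * int k + 1 dvd (\<Sum>y\<in>U. n x y) + - p x - - b x"
    using assms unfolding extendable_def by blast
  have "2 * int k + 1 dvd (\<Sum>y\<in>U. - n x y) + p x - b x" if "x \<in> U" for x
  proof -
    have "(\<Sum>y\<in>U. - n x y) + p x - b x = - ((\<Sum>y\<in>U. n x y) + - p x - - b x)"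
      by (simp add: sum_negf)
    then show ?thesis using n(3) that by (metis dvd_minus_iff)
  qed
  moreover have "even (- n x y - w x y)" if "even (n x y - w x y)" for x y using that by simp
  ultimately show ?thesis unfolding extendable_def
    using n(1,2) by (intro exI[of _ "\<lambda>x y. - n x y"]) (simp add: skew_minus)
qed

lemma admissible_minus:
  assumes "admissible k U w a p b v0"
  shows "admissible k U w a (\<lambda>x. - p x) (\<lambda>x. - b x) v0"
proof -
  interpret admissible k U w a p b v0 by fact
  have minus: "- sum p U - - sum b U = - (sum p U - sum b U)" by simp
  show ?thesis
  proof
    show "even (- p x - a x)" if "x \<in> U" for x using p_parity[OF that] by simp
    show "even (- b x - deg U w a {x})" if "x \<in> U" for x using b_parity[OF that] by simp
    show "nrm k ((\<Sum>x\<in>U. - p x) - (\<Sum>x\<in>U. - b x)) = 0"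
      unfolding sum_negf minus nrm_minus by (rule total)
  qed (use finite_U w_sym w_nonneg w_diag p_le exempt external_le cut_ge in
      \<open>simp_all add: sum_negf nrm_minus\<close>)
qed

text \<open>The edge operations of the reduction argument, read backwards: a solution after the
  operation yields a solution before it.\<close>

lemma extendable_delete_edge:
  assumes "finite U" "x \<in> U" "y \<in> U" "x \<noteq> y"
    and ext: "extendable k U (\<lambda>u v. w u v + (-1) * unit_edge x y u v) p
      (\<lambda>u. b u + (-1) * of_bool (u = x) + 1 * of_bool (u = y))"
  shows "extendable k U w p b"
proof -
  obtain n where n: "skew n"
    "\<And>u v. u \<in> U \<Longrightarrow> v \<in> U \<Longrightarrow> \<bar>n u v\<bar> \<le> w u v + (-1) * unit_edge x y u v
        \<and> even (n u v - (w u v + (-1) * unit_edge x y u v))"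
    "\<And>u. u \<in> U \<Longrightarrow> 2 * int k + 1 dvd (\<Sum>v\<in>U. n u v) + p u
        - (b u + (-1) * of_bool (u = x) + 1 * of_bool (u = y))"
    using ext unfolding extendable_def by blast
  define n' where "n' u v = n u v + unit_flow x y u v" for u v
  have "skew n'" using skew_add[OF n(1) skew_unit_flow, of 1] unfolding n'_def[abs_def] by simp
  moreover have "\<bar>n' u v\<bar> \<le> w u v \<and> even (n' u v - w u v)" if "u \<in> U" "v \<in> U" for u v
  proof -
    have "\<bar>unit_flow x y u v\<bar> = unit_edge x y u v"
      using assms(4) unfolding unit_flow_def unit_edge_def by auto
    moreover have "even (unit_flow x y u v - unit_edge x y u v)"
      unfolding unit_flow_def unit_edge_def by auto
    ultimately show ?thesis using n(2)[OF that] unfolding n'_def by (intro bounded_parity_add) auto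
  qed
  moreover have "2 * int k + 1 dvd (\<Sum>v\<in>U. n' u v) + p u - b u" if "u \<in> U" for u
  proof -
    have "(\<Sum>v\<in>U. n' u v) + p u - b u
        = (\<Sum>v\<in>U. n u v) + p u - (b u + (-1) * of_bool (u = x) + 1 * of_bool (u = y))"
      unfolding n'_def using assms by (simp add: sum.distrib sum_unit_flow)
    then show ?thesis using n(3)[OF that] by (simp only:)
  qed
  ultimately show ?thesis unfolding extendable_def by blast
qed

lemma extendable_shift:
  assumes "\<And>x. x \<in> U \<Longrightarrow> 2 * int k + 1 dvd (p x - b x) - (p' x - b' x)" "extendable k U w p' b'"
  shows "extendable k U w p b"
proof -
  have "2 * int k + 1 dvd s + p x - b x" if "x \<in> U" "2 * int k + 1 dvd s + p' x - b' x" for x s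
  proof -
    have "s + p x - b x = (s + p' x - b' x) + ((p x - b x) - (p' x - b' x))" by simp
    then show ?thesis using assms(1)[OF that(1)] that(2) by (metis dvd_add)
  qed
  then show ?thesis using assms(2) unfolding extendable_def by blast
qed

text \<open>Lifting replaced the path from \<open>y\<close> over \<open>x\<close> to
  \<open>z\<close> by an edge. One edge between \<open>y\<close> and \<open>z\<close>, whose
  direction is read off the sign of \<open>n y z\<close>, is led through \<open>x\<close> again; it
  enters and leaves \<open>x\<close>, so that no net outdegree changes.\<close>

lemma extendable_lift:
  assumes "finite U" "x \<in> U" "y \<in> U" "z \<in> U" "x \<noteq> y" "x \<noteq> z" "y \<noteq> z"
    and sym: "\<And>u v. w u v = w v u" and pos: "0 \<le> w y z"
    and ext: "extendable k U (\<lambda>u v. w u v + (-1) * unit_edge y x u v + (-1) * unit_edge x z u v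
        + 1 * unit_edge y z u v) p b"
  shows "extendable k U w p b"
proof -
  let ?w = "\<lambda>u v. w u v + (-1) * unit_edge y x u v + (-1) * unit_edge x z u v + 1 * unit_edge y z u v"
  obtain n where n: "skew n"
    "\<And>u v. u \<in> U \<Longrightarrow> v \<in> U \<Longrightarrow> \<bar>n u v\<bar> \<le> ?w u v \<and> even (n u v - ?w u v)"
    "\<And>u. u \<in> U \<Longrightarrow> 2 * int k + 1 dvd (\<Sum>v\<in>U. n u v) + p u - b u"
    using ext unfolding extendable_def by blast
  define s :: int where "s = (if n y z > 0 then 1 else -1)"
  define n' where "n' u v = n u v + s * unit_flow y x u v + s * unit_flow x z u v - s * unit_flow y z u v"
    for u v
  have s: "s = 1 \<or> s = -1" unfolding s_def by simp
  have skew: "skew n'"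
    using skew_add[OF skew_add[OF skew_add[OF n(1) skew_unit_flow] skew_unit_flow] skew_unit_flow,
      of s y x s x z "- s" y z] unfolding n'_def[abs_def] by simp
  have yz: "\<bar>n' y z\<bar> \<le> w y z \<and> even (n' y z - w y z)"
  proof -
    have "n' y z = n y z - s" "?w y z = w y z + 1"
      unfolding n'_def unit_flow_def unit_edge_def using assms(5-7) by auto
    moreover have "\<bar>n y z\<bar> \<le> ?w y z" "even (n y z - ?w y z)" using n(2)[of y z] assms(2-4) by blast+
    ultimately show ?thesis unfolding s_def using bounded_parity_step[OF pos, of "n y z"] by metis
  qed
  have yx: "\<bar>n' y x\<bar> \<le> w y x \<and> even (n' y x - w y x)"
  proof -
    have "n' y x = n y x + s" "?w y x = w y x - 1"
      unfolding n'_def unit_flow_def unit_edge_def using assms(5-7) by auto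
    moreover have "\<bar>n y x\<bar> \<le> ?w y x" "even (n y x - ?w y x)" using n(2)[of y x] assms(2-4) by blast+
    ultimately show ?thesis using bounded_parity_pred s by metis
  qed
  have xz: "\<bar>n' x z\<bar> \<le> w x z \<and> even (n' x z - w x z)"
  proof -
    have "n' x z = n x z + s" "?w x z = w x z - 1"
      unfolding n'_def unit_flow_def unit_edge_def using assms(5-7) by auto
    moreover have "\<bar>n x z\<bar> \<le> ?w x z" "even (n x z - ?w x z)" using n(2)[of x z] assms(2-4) by blast+
    ultimately show ?thesis using bounded_parity_pred s by metis
  qed
  have other: "n' u v = n u v \<and> ?w u v = w u v" if "\<not> (u = y \<and> v = z)" "\<not> (u = z \<and> v = y)"
    "\<not> (u = y \<and> v = x)" "\<not> (u = x \<and> v = y)" "\<not> (u = x \<and> v = z)" "\<not> (u = z \<and> v = x)" for u v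
    unfolding n'_def unit_flow_def unit_edge_def by (simp only: that of_bool_eq) simp
  have flip: "\<bar>n' v u\<bar> \<le> w v u \<and> even (n' v u - w v u)"
    if "\<bar>n' u v\<bar> \<le> w u v \<and> even (n' u v - w u v)" for u v
    unfolding skewD[OF skew, of v u] sym[of v u] using that by auto
  have "\<bar>n' u v\<bar> \<le> w u v \<and> even (n' u v - w u v)" if "u \<in> U" "v \<in> U" for u v
  proof -
    consider "u = y \<and> v = z" | "u = z \<and> v = y" | "u = y \<and> v = x" | "u = x \<and> v = y"
      | "u = x \<and> v = z" | "u = z \<and> v = x" | "n' u v = n u v \<and> ?w u v = w u v"
      using other[of u v] by blast
    then show ?thesis
    proof cases
      case 7 then show ?thesis using n(2)[OF that] by (simp only:)
    qed (use yz yx xz flip[OF yz] flip[OF yx] flip[OF xz] in \<open>simp_all only:\<close>)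
  qed
  moreover have "2 * int k + 1 dvd (\<Sum>v\<in>U. n' u v) + p u - b u" if "u \<in> U" for u
  proof -
    have "(\<Sum>v\<in>U. n' u v) = (\<Sum>v\<in>U. n u v) + s * (\<Sum>v\<in>U. unit_flow y x u v)
        + s * (\<Sum>v\<in>U. unit_flow x z u v) - s * (\<Sum>v\<in>U. unit_flow y z u v)"
      unfolding n'_def by (simp add: sum.distrib sum_subtractf sum_distrib_left)
    also have "\<dots> = (\<Sum>v\<in>U. n u v)"
      unfolding sum_unit_flow[OF assms(1)] using assms(2-4) by (simp add: algebra_simps)
    finally show ?thesis using n(3)[OF that] by (simp only:)
  qed
  ultimately show ?thesis unfolding extendable_def using skew by blast
qed

text \<open>Two deleted parallel edges are put back in opposite directions, so the same
  \<open>n\<close> serves.\<close>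

lemma extendable_parallel:
  assumes "finite U" "x \<in> U" "y \<in> U" "x \<noteq> y"
    and ext: "extendable k U (\<lambda>u v. w u v + (-2) * unit_edge x y u v) p b"
  shows "extendable k U w p b"
proof -
  have "\<bar>c\<bar> \<le> w u v" "even (c - w u v)" if "\<bar>c\<bar> \<le> w u v + (-2) * unit_edge x y u v"
    "even (c - (w u v + (-2) * unit_edge x y u v))" for c u v
  proof -
    have "0 \<le> unit_edge x y u v" unfolding unit_edge_def by simp
    then show "\<bar>c\<bar> \<le> w u v" using that(1) by linarith
    show "even (c - w u v)" using that(2) by simp
  qed
  then show ?thesis using ext unfolding extendable_def by meson
qed

text \<open>The external edge at x that is lifted leaves x if s is 1 and enters x if s is -1.\<close>

lemma extendable_lift_external:
  assumes "finite U" "x \<in> U" "y \<in> U" "x \<noteq> y" "s = 1 \<or> s = -1"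
    and ext: "extendable k U (\<lambda>u v. w u v + (-1) * unit_edge x y u v)
      (\<lambda>u. p u + (- s) * of_bool (u = x) + s * of_bool (u = y)) b"
  shows "extendable k U w p b"
proof (cases "s = 1")
  case True
  have "extendable k U (\<lambda>u v. w u v + (-1) * unit_edge y x u v) p
      (\<lambda>u. b u + (-1) * of_bool (u = y) + 1 * of_bool (u = x))"
    unfolding unit_edge_commute[of y x] by (rule extendable_shift[OF _ ext]) (simp add: True)
  then show ?thesis using extendable_delete_edge[of U y x k w p b] assms by simp
next
  case False
  then have s: "s = -1" using assms by simp
  have "extendable k U (\<lambda>u v. w u v + (-1) * unit_edge x y u v) p
      (\<lambda>u. b u + (-1) * of_bool (u = x) + 1 * of_bool (u = y))"
    by (rule extendable_shift[OF _ ext]) (simp add: s)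
  then show ?thesis using extendable_delete_edge[of U x y k w p b] assms by simp
qed

text \<open>Undoes a contraction of \<open>A\<close>: \<open>s\<close> is the net flow on the bundle
  between the contracted vertex and another vertex, and it is distributed over the bundles at the
  members of \<open>A\<close>. The bundle at hand takes as little as the capacity \<open>W\<close>
  of the others permits.\<close>

lemma split_parity:
  fixes w :: "'v \<Rightarrow> int"
  assumes "finite A" "\<And>u. u \<in> A \<Longrightarrow> 0 \<le> w u" "\<bar>s\<bar> \<le> sum w A" "even (s - sum w A)"
  shows "\<exists>c. (\<forall>u\<in>A. \<bar>c u\<bar> \<le> w u \<and> even (c u - w u)) \<and> sum c A = s"
  using assms
proof (induction A arbitrary: s)
  case (insert z A)
  define W where "W = sum w A"
  define d where "d = max (- w z) (s - W)"
  have W: "0 \<le> W" unfolding W_def using insert.prems(1) by (simp add: sum_nonneg)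
  have wz: "0 \<le> w z" and s: "\<bar>s\<bar> \<le> w z + W" "even (s - (w z + W))"
    using insert.prems insert.hyps unfolding W_def by simp_all
  have "d = - w z \<or> d = s - W" unfolding d_def by (simp add: max_def)
  then have d: "\<bar>d\<bar> \<le> w z" "even (d - w z)" "even (s - d - W)"
    using wz W s unfolding d_def by auto
  have "\<bar>s - d\<bar> \<le> W" using wz W s unfolding d_def by linarith
  then obtain c where c: "\<forall>u\<in>A. \<bar>c u\<bar> \<le> w u \<and> even (c u - w u)" "sum c A = s - d"
    using insert.IH[of "s - d"] insert.prems(1) d(3) unfolding W_def by auto
  let ?c = "c(z := d)"
  have "sum ?c A = sum c A" by (rule sum.cong) (use insert.hyps in auto)
  then have "sum ?c (insert z A) = s" using insert.hyps c(2) by simp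
  moreover have "\<forall>u\<in>insert z A. \<bar>?c u\<bar> \<le> w u \<and> even (?c u - w u)" using c(1) d by simp
  ultimately show ?case by blast
qed simp

section \<open>Contraction and tight cuts\<close>

definition quotient_weight :: "'v set \<Rightarrow> ('v \<Rightarrow> 'v) \<Rightarrow> ('v \<Rightarrow> 'v \<Rightarrow> int) \<Rightarrow> 'v \<Rightarrow> 'v \<Rightarrow> int" where
  "quotient_weight U q w x y = (if x = y then 0 else \<Sum>u\<in>{u\<in>U. q u = x}. \<Sum>v\<in>{v\<in>U. q v = y}. w u v)"

definition quotient_sum :: "'v set \<Rightarrow> ('v \<Rightarrow> 'v) \<Rightarrow> ('v \<Rightarrow> int) \<Rightarrow> 'v \<Rightarrow> int" where
  "quotient_sum U q a x = sum a {u\<in>U. q u = x}"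

lemma sum_fibres:
  fixes g :: "'v \<Rightarrow> int"
  assumes "finite U" "finite B"
  shows "(\<Sum>x\<in>B. \<Sum>u\<in>{u\<in>U. q u = x}. g u) = sum g {u\<in>U. q u \<in> B}"
proof -
  have "(\<Sum>x\<in>B. sum g {u \<in> {u\<in>U. q u \<in> B}. q u = x}) = sum g {u\<in>U. q u \<in> B}"
    by (rule sum.group) (use assms in auto)
  moreover have "{u \<in> {u\<in>U. q u \<in> B}. q u = x} = {u\<in>U. q u = x}" if "x \<in> B" for x
    using that by blast
  ultimately show ?thesis by simp
qed

lemma deg_quotient:
  assumes "finite U" "B \<subseteq> q ` U"
  shows "deg (q ` U) (quotient_weight U q w) (quotient_sum U q a) B = deg U w a {u\<in>U. q u \<in> B}"
proof -
  have fin: "finite B" using assms finite_subset by blast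
  have compl: "{u\<in>U. q u \<in> q ` U - B} = U - {u\<in>U. q u \<in> B}" by auto
  have "(\<Sum>x\<in>B. \<Sum>y\<in>q ` U - B. quotient_weight U q w x y)
      = (\<Sum>x\<in>B. \<Sum>y\<in>q ` U - B. \<Sum>u\<in>{u\<in>U. q u = x}. \<Sum>v\<in>{v\<in>U. q v = y}. w u v)"
    unfolding quotient_weight_def by (intro sum.cong) auto
  also have "\<dots> = (\<Sum>x\<in>B. \<Sum>u\<in>{u\<in>U. q u = x}. \<Sum>y\<in>q ` U - B. \<Sum>v\<in>{v\<in>U. q v = y}. w u v)"
    by (intro sum.cong refl sum.swap)
  also have "\<dots> = (\<Sum>u\<in>{u\<in>U. q u \<in> B}. \<Sum>v\<in>{u\<in>U. q u \<in> q ` U - B}. w u v)"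
    using assms(1) fin by (simp only: sum_fibres finite_imageI finite_Diff)
  finally show ?thesis unfolding deg_def compl quotient_sum_def
    using assms(1) fin by (simp only: sum_fibres)
qed

locale minimal_counterexample = admissible +
  assumes k_pos: "k > 0"
    and IH: "smaller U' w' a' U w a \<Longrightarrow> admissible k U' w' a' p' b' v0' \<Longrightarrow> extendable k U' w' p' b'"
    and not_extendable: "\<not> extendable k U w p b"
    and card_U: "3 \<le> card U"
begin

lemma not_smaller:
  "admissible k U' w' a' p' b' v0' \<Longrightarrow> smaller U' w' a' U w a \<Longrightarrow>
    (extendable k U' w' p' b' \<Longrightarrow> extendable k U w p b) \<Longrightarrow> False"
  using IH not_extendable by blast

text \<open>Otherwise contract A, solve, and then contract the complement of A, whose edges into A are
  by then oriented and become external.\<close>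

lemma slack:
  assumes "A \<subseteq> U" "2 \<le> card A" "A \<noteq> U"
  shows "4 * int k + 2 + nrm k (sum b A) \<le> deg U w a A"
proof (rule ccontr)
  assume less: "\<not> ?thesis"
  have fin: "finite A" using assms(1) finite_U finite_subset by blast
  have "A \<noteq> {v0}" "A \<noteq> {}" using assms(2) by auto
  then have ge: "4 * int k + nrm k (sum b A) \<le> deg U w a A" using cut_ge assms by blast
  \<comment> \<open>By parity a violation of the claim leaves only equality in
    \<open>cut_ge\<close>: \<open>A\<close> is tight.\<close>
  moreover have "even (nrm k (sum b A) - deg U w a A)"
    using cut_parity[OF assms(1)] nrm_parity[of k "sum b A"] by auto
  then have "4 * int k + 1 + nrm k (sum b A) \<noteq> deg U w a A" by presburger
  ultimately have degA: "deg U w a A = 4 * int k + nrm k (sum b A)" using less by linarith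
  \<comment> \<open>The contracted vertex must satisfy the cut condition, so it must not bear the
    name \<open>v0\<close>. If \<open>v0\<close> lies in \<open>A\<close>, then the contraction has
    no exempt vertex.\<close>
  obtain r where r: "r \<in> A" "r \<noteq> v0"
    using assms(2) fin by (metis \<open>A \<noteq> {v0}\<close> \<open>A \<noteq> {}\<close> is_singletonI' is_singleton_the_elem singleton_iff)
  define q where "q x = (if x \<in> A then r else x)" for x
  let ?U = "q ` U" and ?w = "quotient_weight U q w" and ?a = "quotient_sum U q a"
    and ?p = "quotient_sum U q p" and ?b = "quotient_sum U q b"
  have rU: "r \<in> U" using r assms(1) by blast
  have U': "?U = insert r (U - A)" unfolding q_def using r assms(1) by auto
  have fibre_r: "{u\<in>U. q u = r} = A" unfolding q_def using r assms(1) by auto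
  have fibre: "{u\<in>U. q u = x} = {x}" if "x \<in> U - A" for x
    unfolding q_def using r assms(1) that by auto
  have wr: "?w r y = (\<Sum>u\<in>A. w u y)" if "y \<in> U - A" for y
    unfolding quotient_weight_def fibre_r fibre[OF that] using that r by auto
  have wxy: "?w x y = w x y" if "x \<in> U - A" "y \<in> U - A" for x y
    unfolding quotient_weight_def fibre[OF that(1)] fibre[OF that(2)] by (simp add: w_diag)
  have sum_q: "sum (quotient_sum U q g) B = sum g {u\<in>U. q u \<in> B}" if "B \<subseteq> ?U" for B g
    unfolding quotient_sum_def by (rule sum_fibres) (use finite_U that finite_subset in blast)+
  have all: "{u\<in>U. q u \<in> ?U} = U" by auto
  have adm1: "admissible k ?U ?w ?a ?p ?b v0"
  proof
    show "?w x y = ?w y x" for x y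
      unfolding quotient_weight_def
      by (cases "x = y", simp, subst sum.swap, subst w_sym) simp
    show "0 \<le> ?w x y" for x y
      unfolding quotient_weight_def by (simp add: sum_nonneg w_nonneg)
    show "\<bar>?p x\<bar> \<le> ?a x" if "x \<in> ?U" for x
      unfolding quotient_sum_def
      by (rule order_trans[OF sum_abs]) (rule sum_mono, use p_le in blast)
    show "even (?p x - ?a x)" if "x \<in> ?U" for x
      unfolding quotient_sum_def sum_subtractf[symmetric]
      by (rule dvd_sum) (use p_parity in blast)
    show "even (?b x - deg ?U ?w ?a {x})" if "x \<in> ?U" for x
    proof -
      have "{u\<in>U. q u \<in> {x}} = {u\<in>U. q u = x}" by simp
      then show ?thesis
        using deg_quotient[OF finite_U, of "{x}" q w a] that cut_parity[of "{u\<in>U. q u = x}"]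
        unfolding quotient_sum_def by simp
    qed
    show "nrm k (sum ?p ?U - sum ?b ?U) = 0"
      unfolding sum_q[OF subset_refl] all by (rule total)
    show "nrm k (?b v0) = 0" if "v0 \<in> ?U"
    proof -
      have "v0 \<in> U - A" using that[unfolded U'] r(2) by simp
      then show ?thesis using exempt fibre unfolding quotient_sum_def by simp
    qed
    show "sum ?a ?U \<le> 4 * int k + nrm k (sum ?b ?U)"
      unfolding sum_q[OF subset_refl] all by (rule external_le)
    show "4 * int k + nrm k (sum ?b B) \<le> deg ?U ?w ?a B"
      if B: "B \<subseteq> ?U" "B \<noteq> {}" "B \<noteq> ?U" "B \<noteq> {v0}" for B
    proof -
      let ?B = "{u\<in>U. q u \<in> B}"
      have image: "q ` ?B = B" using B(1) by auto
      have "?B \<noteq> {v0}"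
      proof
        assume *: "?B = {v0}"
        then have "B = {q v0}" using image by force
        moreover have "v0 \<notin> A"
        proof
          assume "v0 \<in> A"
          then have "r \<in> ?B" using \<open>B = {q v0}\<close> rU r unfolding q_def by auto
          then show False using * r by simp
        qed
        ultimately show False using B(4) unfolding q_def by simp
      qed
      moreover have "?B \<noteq> {}" using image B(2) by force
      moreover have "?B \<noteq> U" using image B(3) by force
      ultimately show ?thesis
        unfolding deg_quotient[OF finite_U B(1)] sum_q[OF B(1)] by (intro cut_ge) auto
    qed
  qed (simp_all add: finite_U quotient_weight_def)
  have card_lt: "card A < card U" by (rule psubset_card_mono) (use finite_U assms in auto)
  have "card ?U = card U - card A + 1"
    unfolding U' using finite_U fin r assms(1) by (simp add: card_Diff_subset)
  then have "smaller ?U ?w ?a U w a" unfolding smaller_def using assms(2) card_lt by linarith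
  from IH[OF this adm1] obtain n where n: "skew n"
    "\<And>x y. x \<in> ?U \<Longrightarrow> y \<in> ?U \<Longrightarrow> \<bar>n x y\<bar> \<le> ?w x y \<and> even (n x y - ?w x y)"
    "\<And>x. x \<in> ?U \<Longrightarrow> 2 * int k + 1 dvd (\<Sum>y\<in>?U. n x y) + ?p x - ?b x"
    by (rule extendableE) (erule that; meson)
  have "\<exists>c. (\<forall>u\<in>A. \<bar>c u\<bar> \<le> w u y \<and> even (c u - w u y)) \<and> sum c A = n r y" if "y \<in> U - A" for y
  proof (rule split_parity[OF fin])
    show "\<bar>n r y\<bar> \<le> (\<Sum>u\<in>A. w u y)" "even (n r y - (\<Sum>u\<in>A. w u y))"
      using n(2)[of r y] that unfolding U' wr[OF that] by auto
  qed (rule w_nonneg)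
  then obtain c where c: "\<And>y u. y \<in> U - A \<Longrightarrow> u \<in> A \<Longrightarrow> \<bar>c y u\<bar> \<le> w u y \<and> even (c y u - w u y)"
    "\<And>y. y \<in> U - A \<Longrightarrow> sum (c y) A = n r y" by metis
  define a2 where "a2 x = a x + (\<Sum>y\<in>U - A. w x y)" for x
  define p2 where "p2 x = p x + (\<Sum>y\<in>U - A. c y x)" for x
  have nrr: "n x x = 0" for x using skewD[OF n(1), of x x] by simp
  have sum_U': "(\<Sum>y\<in>?U. g y) = g r + (\<Sum>y\<in>U - A. g y)" for g :: "'a \<Rightarrow> int"
    unfolding U' using finite_U r by simp
  have degA2: "deg A w a2 B = deg U w a B" if "B \<subseteq> A" for B
  proof -
    have "(\<Sum>y\<in>U - B. w x y) = (\<Sum>y\<in>A - B. w x y) + (\<Sum>y\<in>U - A. w x y)" for x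
    proof -
      have "U - B = (A - B) \<union> (U - A)" using that assms(1) by auto
      moreover have "(A - B) \<inter> (U - A) = {}" by blast
      ultimately show ?thesis using finite_U fin by (simp add: sum.union_disjoint)
    qed
    then show ?thesis unfolding deg_def a2_def by (simp add: sum.distrib)
  qed
  have sum_a2: "sum a2 A = deg U w a A"
    unfolding a2_def deg_def by (simp add: sum.distrib)
  have p2_parity: "even (p2 x - a2 x)" if "x \<in> A" for x
  proof -
    have "p2 x - a2 x = (p x - a x) + (\<Sum>y\<in>U - A. c y x - w x y)"
      unfolding p2_def a2_def by (simp add: sum_subtractf)
    moreover have "even (\<Sum>y\<in>U - A. c y x - w x y)"
      by (rule dvd_sum) (use c(1) that in blast)
    ultimately show ?thesis using p_parity[of x] that assms(1) by auto
  qed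
  \<comment> \<open>Tightness of \<open>A\<close> enters here: the complement of \<open>A\<close>
    joins the outside, whose degree becomes \<open>deg U w a A\<close> and meets
    \<open>external_le\<close> with equality.\<close>
  have adm2: "admissible k A w a2 p2 b v0"
  proof
    show "\<bar>p2 x\<bar> \<le> a2 x" if "x \<in> A" for x
    proof -
      have "\<bar>\<Sum>y\<in>U - A. c y x\<bar> \<le> (\<Sum>y\<in>U - A. w x y)"
        by (rule order_trans[OF sum_abs]) (rule sum_mono, use c(1) that in blast)
      then show ?thesis unfolding p2_def a2_def using p_le[of x] that assms(1) by auto
    qed
    show "even (p2 x - a2 x)" if "x \<in> A" for x using p2_parity that .
    show "even (b x - deg A w a2 {x})" if "x \<in> A" for x
      using degA2[of "{x}"] b_parity[of x] that assms(1) by auto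
    \<comment> \<open>The congruence solved at the contracted vertex \<open>r\<close> is the
      congruence on totals required of the second instance.\<close>
    have "sum p2 A - sum b A = (\<Sum>y\<in>?U. n r y) + ?p r - ?b r"
    proof -
      have "(\<Sum>x\<in>A. \<Sum>y\<in>U - A. c y x) = (\<Sum>y\<in>U - A. sum (c y) A)" by (rule sum.swap)
      also have "\<dots> = (\<Sum>y\<in>U - A. n r y)" by (rule sum.cong) (use c(2) in auto)
      finally show ?thesis unfolding p2_def sum_U' nrr quotient_sum_def fibre_r
        by (simp add: sum.distrib)
    qed
    moreover have "even (sum p2 A - sum b A)"
    proof -
      have "even (sum p2 A - sum a2 A)"
        unfolding sum_subtractf[symmetric] by (rule dvd_sum) (rule p2_parity)
      then show ?thesis using cut_parity[OF assms(1)] sum_a2 by auto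
    qed
    ultimately show "nrm k (sum p2 A - sum b A) = 0"
      unfolding nrm_eq_0_iff using n(3)[of r] U' by auto
    show "sum a2 A \<le> 4 * int k + nrm k (sum b A)" unfolding sum_a2 degA by simp
    show "4 * int k + nrm k (sum b B) \<le> deg A w a2 B"
      if B: "B \<subseteq> A" "B \<noteq> {}" "B \<noteq> A" "B \<noteq> {v0}" for B
      unfolding degA2[OF B(1)] by (rule cut_ge) (use B assms in auto)
  qed (use fin w_nonneg w_diag exempt assms(1) w_sym in auto)
  have "smaller A w a2 U w a" unfolding smaller_def using card_lt by blast
  from IH[OF this adm2] obtain n2 where n2: "skew n2"
    "\<And>x y. x \<in> A \<Longrightarrow> y \<in> A \<Longrightarrow> \<bar>n2 x y\<bar> \<le> w x y \<and> even (n2 x y - w x y)"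
    "\<And>x. x \<in> A \<Longrightarrow> 2 * int k + 1 dvd (\<Sum>y\<in>A. n2 x y) + p2 x - b x"
    by (rule extendableE) (erule that; meson)
  define f where "f x y = (if x \<in> A then if y \<in> A then n2 x y else c y x
    else if y \<in> A then - c x y else n x y)" for x y
  have sum_split: "(\<Sum>y\<in>U. g y) = (\<Sum>y\<in>A. g y) + (\<Sum>y\<in>U - A. g y)" for g :: "'a \<Rightarrow> int"
    using sum.subset_diff[OF assms(1) finite_U, of g] by simp
  have "skew f"
  proof (rule skewI)
    show "f y x = - f x y" for x y
      using skewD[OF n(1), of y x] skewD[OF n2(1), of y x] unfolding f_def by simp
  qed
  moreover have "\<bar>f x y\<bar> \<le> w x y \<and> even (f x y - w x y)" if "x \<in> U" "y \<in> U" for x y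
  proof (cases "x \<in> A"; cases "y \<in> A")
    assume "x \<notin> A" "y \<in> A"
    then show ?thesis using c(1)[of x y] that w_sym[of x y] unfolding f_def by auto
  next
    assume "x \<notin> A" "y \<notin> A"
    then show ?thesis using n(2)[of x y] wxy[of x y] U' that unfolding f_def by auto
  qed (use c(1)[of y x] n2(2)[of x y] that in \<open>auto simp: f_def\<close>)
  moreover have "2 * int k + 1 dvd (\<Sum>y\<in>U. f x y) + p x - b x" if "x \<in> U" for x
  proof (cases "x \<in> A")
    case True
    then have "(\<Sum>y\<in>U. f x y) + p x - b x = (\<Sum>y\<in>A. n2 x y) + p2 x - b x"
      unfolding sum_split p2_def f_def by simp
    then show ?thesis using n2(3)[OF True] by (simp only:)
  next
    case False
    then have x: "x \<in> U - A" using that by blast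
    have "(\<Sum>y\<in>A. - c x y) = n x r"
      using c(2)[OF x] skewD[OF n(1), of x r] by (simp add: sum_negf)
    then have "(\<Sum>y\<in>U. f x y) = (\<Sum>y\<in>?U. n x y)"
      unfolding sum_split sum_U' f_def using False by simp
    moreover have "?p x = p x" "?b x = b x" unfolding quotient_sum_def fibre[OF x] by simp_all
    ultimately show ?thesis using n(3)[of x] x U' by auto
  qed
  ultimately have "extendable k U w p b" unfolding extendable_def by blast
  then show False using not_extendable by blast
qed

end

section \<open>Excluding vertices of residue zero\<close>

lemma nrm_add_0: "nrm k y = 0 \<Longrightarrow> nrm k (x + y) = nrm k x"
  using nrm_diff_0[of k "x + y" x] by simp

lemma unit_edge_le:
  assumes "x \<noteq> y" "c \<le> w x y" "c \<le> w y x" "0 \<le> w u v" "0 \<le> c"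
  shows "c * unit_edge x y u v \<le> w u v"
  using assms unfolding unit_edge_def by auto

context minimal_counterexample
begin

text \<open>The room for 2 given by \<open>slack\<close> absorbs what each reduction below does to a
  set with at least two vertices, so that only single vertices call for an argument.\<close>

lemma cut_cases:
  assumes "A \<subseteq> U" "A \<noteq> {}" "A \<noteq> U"
  obtains (slack) "4 * int k + 2 + nrm k (sum b A) \<le> deg U w a A"
    | (single) v where "A = {v}" "v \<in> U"
proof (cases "2 \<le> card A")
  case False
  have "finite A" using assms(1) finite_U finite_subset by blast
  then have "card A = 1" using False assms(2) by (metis One_nat_def Suc_leI card_gt_0_iff le_antisym
      not_less_eq_eq numeral_2_eq_2)
  then show ?thesis using single assms(1) by (metis card_1_singletonE insert_subset)
qed (use slack assms minimal_counterexample.slack[OF minimal_counterexample_axioms] in blast)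

lemma deg_pair:
  assumes "x \<in> U" "y \<in> U" "x \<noteq> y"
  shows "deg U w a {x, y} = deg U w a {x} + deg U w a {y} - 2 * w x y"
proof -
  have split: "(\<Sum>v\<in>U - {u}. w u v) = w u u' + (\<Sum>v\<in>U - {u, u'}. w u v)"
    if "u \<noteq> u'" "u' \<in> U" for u u'
  proof -
    have "U - {u, u'} = U - {u} - {u'}" by blast
    then show ?thesis using sum.remove[of "U - {u}" u' "w u"] finite_U that by auto
  qed
  have "{y, x} = {x, y}" by blast
  then show ?thesis
    using split[of x y] split[of y x] w_sym[of y x] assms unfolding deg_def by simp
qed

lemma single_neq_U: "{x} \<noteq> U" "{x, y} \<noteq> U"
  using card_U card_2_iff[of "{x, y}"] by (auto simp: card_insert_if)

text \<open>This and the next four lemmas treat a vertex of residue zero by its neighbourhood: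
  empty, only the outside, two neighbours, a neighbour and the outside, a single neighbour. The
  hypothesis on \<open>v0\<close> ensures that no other vertex is exempt, so the exemption can be
  handed to \<open>x\<close>, whose degree may then fall freely.\<close>

lemma no_isolated_zero:
  assumes "x \<in> U" "nrm k (b x) = 0" "v0 \<in> U \<Longrightarrow> v0 = x" "\<And>y. y \<in> U \<Longrightarrow> w x y = 0" "a x = 0"
  shows False
proof (rule not_smaller)
  let ?U = "U - {x}"
  have px: "p x = 0" using p_le[OF assms(1)] assms(5) by simp
  have sum_U: "sum g U = g x + sum g ?U" for g :: "'a \<Rightarrow> int"
    using sum.remove[OF finite_U assms(1)] .
  have sum_b: "nrm k (sum b U) = nrm k (sum b ?U)"
    unfolding sum_U[of b] add.commute[of "b x"] by (rule nrm_add_0[OF assms(2)])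
  have wx: "w y x = 0" if "y \<in> U" for y using assms(4)[OF that] w_sym[of x y] by simp
  have deg: "deg ?U w a A = deg U w a A" if "A \<subseteq> ?U" for A
  proof -
    have "U - A = insert x (?U - A)" using that assms(1) by auto
    then have "(\<Sum>y\<in>U - A. w u y) = (\<Sum>y\<in>?U - A. w u y)" if "u \<in> A" for u
      using finite_U wx[of u] that \<open>A \<subseteq> ?U\<close> by auto
    then show ?thesis unfolding deg_def by simp
  qed
  show "admissible k ?U w a p b x"
  proof
    show "even (b u - deg ?U w a {u})" if "u \<in> ?U" for u
      using deg[of "{u}"] b_parity[of u] that by simp
    show "nrm k (sum p ?U - sum b ?U) = 0"
      using nrm_add_0[OF assms(2), of "sum p U - sum b U"] total px
      unfolding sum_U[of p] sum_U[of b] by simp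
    show "sum a ?U \<le> 4 * int k + nrm k (sum b ?U)"
      using external_le assms(5) sum_U[of a] unfolding sum_b by simp
    show "4 * int k + nrm k (sum b A) \<le> deg ?U w a A"
      if A: "A \<subseteq> ?U" "A \<noteq> {}" "A \<noteq> ?U" "A \<noteq> {x}" for A
      unfolding deg[OF A(1)] by (rule cut_ge) (use A assms(1,3) in auto)
  qed (use finite_U w_nonneg w_diag p_le p_parity w_sym in auto)
  show "smaller ?U w a U w a"
    unfolding smaller_def using card_Diff1_less[OF finite_U assms(1)] by blast
  show "extendable k U w p b" if ext: "extendable k ?U w p b"
  proof -
    obtain n where n: "skew n"
      "\<And>u v. u \<in> ?U \<Longrightarrow> v \<in> ?U \<Longrightarrow> \<bar>n u v\<bar> \<le> w u v \<and> even (n u v - w u v)"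
      "\<And>u. u \<in> ?U \<Longrightarrow> 2 * int k + 1 dvd (\<Sum>v\<in>?U. n u v) + p u - b u"
      using ext by (rule extendableE) (erule that; meson)
    define f where "f u v = (if u = x \<or> v = x then 0 else n u v)" for u v
    have "skew f"
    proof (rule skewI)
      show "f v u = - f u v" for u v using skewD[OF n(1), of v u] by (simp add: f_def)
    qed
    moreover have "\<bar>f u v\<bar> \<le> w u v \<and> even (f u v - w u v)" if "u \<in> U" "v \<in> U" for u v
      using n(2)[of u v] that assms(4) wx unfolding f_def by auto
    moreover have "2 * int k + 1 dvd (\<Sum>v\<in>U. f u v) + p u - b u" if "u \<in> U" for u
    proof (cases "u = x")
      case True
      have "2 * int k + 1 dvd b x" using assms(2) unfolding nrm_eq_0_iff by blast
      then show ?thesis using True px by (simp add: f_def)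
    next
      case False
      have "(\<Sum>v\<in>U. f u v) = (\<Sum>v\<in>?U. n u v)"
        unfolding sum_U f_def using False by simp
      then show ?thesis using n(3)[of u] False that by simp
    qed
    ultimately show ?thesis unfolding extendable_def by blast
  qed
qed

text \<open>A contradiction without any reduction: the cut around \<open>U - {x}\<close> consists of
  the external edges not at \<open>x\<close>, which by \<open>external_le\<close> are too few for
  \<open>cut_ge\<close>, while the residue of the set is that of \<open>U\<close>.\<close>

lemma no_external_zero:
  assumes "x \<in> U" "nrm k (b x) = 0" "v0 \<in> U \<Longrightarrow> v0 = x" "\<And>y. y \<in> U \<Longrightarrow> w x y = 0" "a x > 0"
  shows False
proof -
  let ?A = "U - {x}"
  have "U - ?A = {x}" using assms(1) by auto
  then have "deg U w a ?A = (\<Sum>u\<in>?A. w u x) + sum a ?A" unfolding deg_def by simp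
  also have "(\<Sum>u\<in>?A. w u x) = 0" using assms(4) w_sym by (intro sum.neutral) auto
  also have "sum a ?A = sum a U - a x" using sum.remove[OF finite_U assms(1), of a] by simp
  finally have "deg U w a ?A = sum a U - a x" by simp
  moreover have "nrm k (sum b ?A) = nrm k (sum b U)"
    using sum.remove[OF finite_U assms(1), of b] nrm_add_0[OF assms(2), of "sum b ?A"]
    by (simp add: add.commute)
  moreover have "?A \<noteq> {}" using single_neq_U(1)[of x] assms(1) by auto
  then have "4 * int k + nrm k (sum b ?A) \<le> deg U w a ?A"
    by (intro cut_ge) (use assms(1,3) in auto)
  ultimately show False using external_le assms(5) by linarith
qed

text \<open>Lifting two edges at \<open>x\<close> keeps the degree of every other vertex and costs a
  larger set at most 2.\<close>

lemma no_liftable_zero: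
  assumes "x \<in> U" "nrm k (b x) = 0" "v0 \<in> U \<Longrightarrow> v0 = x"
    and "y \<in> U" "z \<in> U" "y \<noteq> z" "w x y > 0" "w x z > 0"
  shows False
proof (rule not_smaller)
  let ?w = "\<lambda>u v. w u v + (-1) * unit_edge y x u v + (-1) * unit_edge x z u v + 1 * unit_edge y z u v"
  have ne: "x \<noteq> y" "x \<noteq> z" using assms(7,8) w_diag[of x] by auto
  have w: "w y x > 0" "w z x > 0" using assms(7,8) w_sym[of x] by simp_all
  have deg: "deg U ?w a A = deg U w a A - of_bool ((y \<in> A) \<noteq> (x \<in> A)) - of_bool ((x \<in> A) \<noteq> (z \<in> A))
      + of_bool ((y \<in> A) \<noteq> (z \<in> A))" if "A \<subseteq> U" for A
    by (subst deg_add_edge[OF finite_U that assms(4,5)], subst deg_add_edge[OF finite_U that assms(1,5)],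
      subst deg_add_edge[OF finite_U that assms(4,1)]) simp
  show "admissible k U ?w a p b x"
  proof
    show "?w u v = ?w v u" for u v
      using w_sym[of u v] by (simp only: unit_edge_def conj_commute add.commute)
    show "0 \<le> ?w u v" for u v
      using w_nonneg[of u v] w assms(6-8) ne unfolding unit_edge_def by auto
    show "?w u u = 0" for u unfolding unit_edge_def using w_diag ne assms(6) by auto
    show "even (b u - deg U ?w a {u})" if "u \<in> U" for u
      using b_parity[OF that] ne assms(6) by (subst deg) (use that in auto)
    show "4 * int k + nrm k (sum b A) \<le> deg U ?w a A"
      if A: "A \<subseteq> U" "A \<noteq> {}" "A \<noteq> U" "A \<noteq> {x}" for A
      using A(1-3)
    proof (cases rule: cut_cases)
      case slack
      then show ?thesis unfolding deg[OF A(1)] by (auto simp: of_bool_def)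
    next
      case (single v)
      then have "v \<noteq> x" using A(4) by blast
      moreover have "4 * int k + nrm k (sum b A) \<le> deg U w a A"
        using cut_ge[OF A(1-3)] A(4) assms(3) single by auto
      ultimately show ?thesis using assms(6) unfolding deg[OF A(1)] unfolding single by (auto simp: of_bool_def)
    qed
  qed (use finite_U p_le p_parity total assms(2) external_le in auto)
  have "weight U ?w < weight U w"
    by (subst weight_add_edge[OF finite_U assms(4,5)], subst weight_add_edge[OF finite_U assms(1,5)],
      subst weight_add_edge[OF finite_U assms(4,1)]) simp
  then show "smaller U ?w a U w a" unfolding smaller_def by blast
  show "extendable k U ?w p b \<Longrightarrow> extendable k U w p b"
    by (rule extendable_lift[OF finite_U assms(1,4,5) ne assms(6) w_sym w_nonneg])
qed

lemma no_externally_liftable_zero: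
  assumes "x \<in> U" "nrm k (b x) = 0" "v0 \<in> U \<Longrightarrow> v0 = x" "y \<in> U" "w x y > 0" "a x > 0"
  shows False
proof (rule not_smaller)
  \<comment> \<open>The direction of an external edge that exists at \<open>x\<close>: if
    \<open>p x\<close> is not positive, then some external edge enters \<open>x\<close>, because
    \<open>p x = 0\<close> with \<open>a x = 1\<close> is excluded by parity.\<close>
  define s :: int where "s = (if p x > 0 then 1 else -1)"
  let ?w = "\<lambda>u v. w u v + (-1) * unit_edge x y u v"
  let ?a = "\<lambda>u. a u + (-1) * of_bool (u = x) + 1 * of_bool (u = y)"
  let ?p = "\<lambda>u. p u + (- s) * of_bool (u = x) + s * of_bool (u = y)"
  have ne: "x \<noteq> y" using assms(5) w_diag[of x] by auto
  have w: "w y x > 0" using assms(5) w_sym[of x] by simp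
  have s: "s = 1 \<or> s = -1" unfolding s_def by simp
  have deg: "deg U ?w ?a A = deg U w a A - of_bool ((x \<in> A) \<noteq> (y \<in> A)) - of_bool (x \<in> A)
      + of_bool (y \<in> A)" if "A \<subseteq> U" for A
    by (subst deg_add_edge[OF finite_U that assms(1,4)], subst deg_add_point[OF finite_U that],
      subst deg_add_point[OF finite_U that]) simp
  have sum_a: "sum ?a U = sum a U" "sum ?p U = sum p U"
    using assms(1,4) by (subst sum_add_point[OF finite_U], subst sum_add_point[OF finite_U], simp)+
  show "admissible k U ?w ?a ?p b x"
  proof
    show "?w u v = ?w v u" for u v
      using w_sym[of u v] by (simp only: unit_edge_def conj_commute add.commute)
    show "0 \<le> ?w u v" for u v
      using w_nonneg[of u v] w assms(5) unit_edge_le[OF ne, of 1 w u v] by auto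
    show "?w u u = 0" for u unfolding unit_edge_def using w_diag ne by auto
    show "\<bar>?p u\<bar> \<le> ?a u" if "u \<in> U" for u
    proof -
      have "p x \<noteq> 0 \<or> a x \<noteq> 1" using p_parity[OF assms(1)] by auto
      then have "\<bar>p x - s\<bar> \<le> a x - 1" using p_le[OF assms(1)] assms(6) unfolding s_def by auto
      then show ?thesis using p_le[OF that] s by auto
    qed
    show "even (?p u - ?a u)" if "u \<in> U" for u using p_parity[OF that] s by auto
    show "even (b u - deg U ?w ?a {u})" if "u \<in> U" for u
      using b_parity[OF that] ne by (subst deg) (use that in auto)
    show "nrm k (sum ?p U - sum b U) = 0" unfolding sum_a by (rule total)
    show "sum ?a U \<le> 4 * int k + nrm k (sum b U)" unfolding sum_a by (rule external_le)
    show "4 * int k + nrm k (sum b A) \<le> deg U ?w ?a A"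
      if A: "A \<subseteq> U" "A \<noteq> {}" "A \<noteq> U" "A \<noteq> {x}" for A
      using A(1-3)
    proof (cases rule: cut_cases)
      case slack
      then show ?thesis unfolding deg[OF A(1)] by (auto simp: of_bool_def)
    next
      case (single v)
      then have "v \<noteq> x" using A(4) by blast
      moreover have "4 * int k + nrm k (sum b A) \<le> deg U w a A"
        using cut_ge[OF A(1-3)] A(4) assms(3) single by auto
      ultimately show ?thesis unfolding deg[OF A(1)] unfolding single by (auto simp: of_bool_def)
    qed
  qed (use finite_U assms(2) in auto)
  have "weight U ?w < weight U w"
    by (subst weight_add_edge[OF finite_U assms(1,4)]) simp
  then show "smaller U ?w ?a U w a" unfolding smaller_def by blast
  show "extendable k U ?w ?p b \<Longrightarrow> extendable k U w p b"
    by (rule extendable_lift_external[OF finite_U assms(1,4) ne s])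
qed

lemma no_parallel_zero:
  assumes "x \<in> U" "nrm k (b x) = 0" "v0 \<in> U \<Longrightarrow> v0 = x" "y \<in> U" "w x y > 0" "a x = 0"
    and only: "\<And>z. z \<in> U \<Longrightarrow> z \<noteq> y \<Longrightarrow> w x z = 0"
  shows False
proof (rule not_smaller)
  let ?w = "\<lambda>u v. w u v + (-2) * unit_edge x y u v"
  have ne: "x \<noteq> y" using assms(5) w_diag[of x] by auto
  have deg: "deg U ?w a A = deg U w a A - 2 * of_bool ((x \<in> A) \<noteq> (y \<in> A))" if "A \<subseteq> U" for A
    by (subst deg_add_edge[OF finite_U that assms(1,4)]) simp
  have "(\<Sum>v\<in>U. w x v) = w x y"
    using sum.remove[OF finite_U assms(4), of "w x"] only by simp
  then have degx: "deg U w a {x} = w x y" using deg_singleton[of U w x a] finite_U w_diag assms(6) by simp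
  then have "even (w x y)" using b_parity[OF assms(1)] assms(2) unfolding nrm_eq_0_iff by auto
  then have w: "w x y \<ge> 2" "w y x \<ge> 2" using assms(5) w_sym[of x y] by auto
  show "admissible k U ?w a p b x"
  proof
    show "?w u v = ?w v u" for u v
      using w_sym[of u v] by (simp only: unit_edge_def conj_commute add.commute)
    show "0 \<le> ?w u v" for u v
      using w_nonneg[of u v] w unit_edge_le[OF ne, of 2 w u v] by auto
    show "?w u u = 0" for u unfolding unit_edge_def using w_diag ne by auto
    show "even (b u - deg U ?w a {u})" if "u \<in> U" for u
      using b_parity[OF that] by (subst deg) (use that in auto)
    show "4 * int k + nrm k (sum b A) \<le> deg U ?w a A"
      if A: "A \<subseteq> U" "A \<noteq> {}" "A \<noteq> U" "A \<noteq> {x}" for A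
      using A(1-3)
    proof (cases rule: cut_cases)
      case slack
      then show ?thesis unfolding deg[OF A(1)] by (auto simp: of_bool_def)
    next
      case (single v)
      then have v: "v \<noteq> x" using A(4) by blast
      have ge: "4 * int k + nrm k (sum b A) \<le> deg U w a A"
        using cut_ge[OF A(1-3)] A(4) assms(3) single by auto
      show ?thesis
      proof (cases "v = y")
        case False
        then show ?thesis using ge v unfolding deg[OF A(1)] unfolding single by simp
      next
        case True
        \<comment> \<open>All edges at \<open>x\<close> go to \<open>y\<close>, so the degree of
          \<open>y\<close> exceeds the cut around \<open>{x, y}\<close> by \<open>w x y\<close>.
          Together with the slack of that cut this pays for the two deleted edges.\<close>
        have "4 * int k + 2 + nrm k (sum b {x, y}) \<le> deg U w a {x, y}"
          using slack[of "{x, y}"] assms(1,4) ne single_neq_U by auto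
        moreover have "deg U w a {x, y} = deg U w a {y} - w x y"
          using deg_pair[OF assms(1,4) ne] degx by simp
        moreover have "nrm k (sum b {x, y}) = nrm k (b y)"
          using nrm_add_0[OF assms(2), of "b y"] ne by (simp add: add.commute)
        ultimately show ?thesis using w ne unfolding deg[OF A(1)] unfolding single True by simp
      qed
    qed
  qed (use finite_U p_le p_parity total assms(2) external_le in auto)
  have "weight U ?w < weight U w"
    by (subst weight_add_edge[OF finite_U assms(1,4)]) simp
  then show "smaller U ?w a U w a" unfolding smaller_def by blast
  show "extendable k U ?w p b \<Longrightarrow> extendable k U w p b"
    by (rule extendable_parallel[OF finite_U assms(1,4) ne])
qed

text \<open>If an exempt vertex is present, it has residue zero itself and is the one to be refuted;
  otherwise the exemption is free for the given vertex. Afterwards no exempt vertex is left, which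
  gives \<open>cut_ge_all\<close>.\<close>

lemma nonzero:
  assumes "x \<in> U" shows "nrm k (b x) \<noteq> 0"
proof
  assume "nrm k (b x) = 0"
  obtain x where x: "x \<in> U" "nrm k (b x) = 0" "v0 \<in> U \<Longrightarrow> v0 = x"
  proof (cases "v0 \<in> U")
    case True
    show ?thesis by (rule that[of v0]) (use True exempt in blast)+
  next
    case False
    show ?thesis by (rule that[OF assms \<open>nrm k (b x) = 0\<close>]) (use False in blast)
  qed
  have "\<exists>y\<in>U. w x y > 0"
  proof (rule ccontr)
    assume "\<not> ?thesis"
    then have w: "w x y = 0" if "y \<in> U" for y using that w_nonneg[of x y] by force
    have "a x = 0 \<or> a x > 0" using a_nonneg[OF x(1)] by linarith
    then show False using no_isolated_zero[OF x w] no_external_zero[OF x w] by blast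
  qed
  then obtain y where y: "y \<in> U" "w x y > 0" by blast
  have "\<not> a x > 0" using no_externally_liftable_zero[OF x y] by blast
  then have "a x = 0" using a_nonneg[OF x(1)] by linarith
  moreover have "w x z = 0" if "z \<in> U" "z \<noteq> y" for z
  proof -
    have "\<not> w x z > 0" using no_liftable_zero[OF x y(1) that(1) that(2)[symmetric] y(2)] by blast
    then show ?thesis using w_nonneg[of x z] by linarith
  qed
  ultimately show False using no_parallel_zero[OF x y] by blast
qed

section \<open>Vertices of nonzero residue\<close>

lemma cut_ge_all:
  assumes "A \<subseteq> U" "A \<noteq> {}" "A \<noteq> U"
  shows "4 * int k + nrm k (sum b A) \<le> deg U w a A"
  using cut_ge[OF assms] exempt nonzero assms(1) by blast

text \<open>An edge directed from \<open>x\<close> to \<open>y\<close> would bring both residues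
  closer to 0. After its deletion degree and \<open>nrm\<close> have both fallen by 1 at either end;
  on larger sets the degree falls and \<open>nrm\<close> rises by at most 1 each, within the
  slack.\<close>

lemma no_deletable_edge:
  assumes "x \<in> U" "y \<in> U" "w x y > 0" "nrm k (b x - 1) < nrm k (b x)" "nrm k (b y + 1) < nrm k (b y)"
  shows False
proof (rule not_smaller)
  let ?w = "\<lambda>u v. w u v + (-1) * unit_edge x y u v"
  let ?b = "\<lambda>u. b u + (-1) * of_bool (u = x) + 1 * of_bool (u = y)"
  have ne: "x \<noteq> y" using assms(3) w_diag[of x] by auto
  have w: "w y x > 0" using assms(3) w_sym[of x] by simp
  have deg: "deg U ?w a A = deg U w a A - of_bool ((x \<in> A) \<noteq> (y \<in> A))" if "A \<subseteq> U" for A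
    by (subst deg_add_edge[OF finite_U that assms(1,2)]) simp
  have sum_b: "sum ?b A = sum b A - of_bool (x \<in> A) + of_bool (y \<in> A)" if "A \<subseteq> U" for A
    using finite_subset[OF that finite_U]
    by (subst sum_add_point, assumption, subst sum_add_point) simp_all
  have sum_bU: "sum ?b U = sum b U" using sum_b[OF subset_refl] assms(1,2) by simp
  show "admissible k U ?w a p ?b v0"
  proof
    show "?w u v = ?w v u" for u v
      using w_sym[of u v] by (simp only: unit_edge_def conj_commute add.commute)
    show "0 \<le> ?w u v" for u v
      using w_nonneg[of u v] w assms(3) unit_edge_le[OF ne, of 1 w u v] by auto
    show "?w u u = 0" for u unfolding unit_edge_def using w_diag ne by auto
    show "even (?b u - deg U ?w a {u})" if "u \<in> U" for u
      using b_parity[OF that] ne by (subst deg) (use that in auto)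
    show "nrm k (sum p U - sum ?b U) = 0" unfolding sum_bU by (rule total)
    show "nrm k (?b v0) = 0" if "v0 \<in> U" using nonzero exempt that by blast
    show "sum a U \<le> 4 * int k + nrm k (sum ?b U)" unfolding sum_bU by (rule external_le)
    show "4 * int k + nrm k (sum ?b A) \<le> deg U ?w a A"
      if A: "A \<subseteq> U" "A \<noteq> {}" "A \<noteq> U" "A \<noteq> {v0}" for A
      using A(1-3)
    proof (cases rule: cut_cases)
      case slack
      then show ?thesis unfolding deg[OF A(1)] sum_b[OF A(1)]
        using nrm_step[of k "sum b A"] nrm_step[of k "sum b A - 1"] by (auto simp: of_bool_def)
    next
      case (single v)
      then show ?thesis using cut_ge_all[OF A(1-3)] assms(4,5) ne
        unfolding deg[OF A(1)] sum_b[OF A(1)] unfolding single by (auto simp: of_bool_def)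
    qed
  qed (use finite_U p_le p_parity in auto)
  have "weight U ?w < weight U w"
    by (subst weight_add_edge[OF finite_U assms(1,2)]) simp
  then show "smaller U ?w a U w a" unfolding smaller_def by blast
  show "extendable k U ?w p ?b \<Longrightarrow> extendable k U w p b"
    by (rule extendable_delete_edge[OF finite_U assms(1,2) ne])
qed

text \<open>The inner edges connect \<open>U\<close>: two parts without an edge between them would
  each send at least \<open>4k + nrm\<close> edges to the outside, more than
  \<open>external_le\<close> permits in view of the triangle inequality.\<close>

lemma crossing_edge:
  assumes "A \<subseteq> U" "A \<noteq> {}" "A \<noteq> U"
  obtains x y where "x \<in> A" "y \<in> U - A" "w x y > 0"
proof (rule ccontr)
  assume *: "\<not> thesis"
  have 0: "w x y = 0" if "x \<in> A" "y \<in> U - A" for x y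
    using * that assms \<open>\<not> thesis\<close> \<open>\<And>x y. x \<in> A \<Longrightarrow> y \<in> U - A \<Longrightarrow> 0 < w x y \<Longrightarrow> thesis\<close> w_nonneg
    by (metis order_le_less)
  have zero': "w y x = 0" if "x \<in> A" "y \<in> U - A" for x y using 0[OF that] w_sym[of x y] by simp
  have "U - (U - A) = A" using assms(1) by auto
  then have "deg U w a A = sum a A" "deg U w a (U - A) = sum a (U - A)"
    unfolding deg_def using 0 zero' by (simp_all add: sum.neutral)
  moreover have "4 * int k + nrm k (sum b A) \<le> deg U w a A" by (rule cut_ge_all[OF assms])
  moreover have "4 * int k + nrm k (sum b (U - A)) \<le> deg U w a (U - A)"
    by (rule cut_ge_all) (use assms in auto)
  moreover have "sum a U = sum a A + sum a (U - A)" "sum b U = sum b A + sum b (U - A)"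
    using sum.subset_diff[OF assms(1) finite_U, of a] sum.subset_diff[OF assms(1) finite_U, of b]
    by simp_all
  ultimately show False
    using external_le nrm_triangle[of k "sum b A" "sum b (U - A)"] k_pos by simp
qed

text \<open>An external edge leaving \<open>x\<close> could be deleted together with its share in
  \<open>p x\<close> and \<open>b x\<close>, as the residue at \<open>x\<close> shrinks along with
  the degree. Hence all external edges at \<open>x\<close> enter it.\<close>

lemma no_removable_external_edge:
  assumes "x \<in> U" "nrm k (b x - 1) < nrm k (b x)"
  shows "p x = - a x"
proof (rule ccontr)
  assume "p x \<noteq> - a x"
  then have px: "p x - 1 \<ge> - (a x - 1)"
    using p_le[OF assms(1)] p_parity[OF assms(1)] by presburger
  let ?a = "\<lambda>u. a u + (-1) * of_bool (u = x)" and ?p = "\<lambda>u. p u + (-1) * of_bool (u = x)"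
    and ?b = "\<lambda>u. b u + (-1) * of_bool (u = x)"
  have deg: "deg U w ?a A = deg U w a A - of_bool (x \<in> A)" if "A \<subseteq> U" for A
    by (subst deg_add_point[OF finite_U that]) simp
  have sum_pt: "(\<Sum>u\<in>A. g u + (-1) * of_bool (u = x)) = sum g A - of_bool (x \<in> A)" if "A \<subseteq> U"
    for A and g :: "'a \<Rightarrow> int"
    by (subst sum_add_point[OF finite_subset[OF that finite_U]]) simp
  show False
  proof (rule not_smaller)
    show "admissible k U w ?a ?p ?b v0"
    proof
      show "\<bar>?p u\<bar> \<le> ?a u" if "u \<in> U" for u using p_le[OF that] px by auto
      show "even (?p u - ?a u)" if "u \<in> U" for u using p_parity[OF that] by simp
      show "even (?b u - deg U w ?a {u})" if "u \<in> U" for u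
        using b_parity[OF that] by (subst deg) (use that in auto)
      show "nrm k (sum ?p U - sum ?b U) = 0" unfolding sum_pt[OF subset_refl] using total by simp
      show "nrm k (?b v0) = 0" if "v0 \<in> U" using nonzero exempt that by blast
      show "sum ?a U \<le> 4 * int k + nrm k (sum ?b U)"
        unfolding sum_pt[OF subset_refl]
        using external_le nrm_step[of k "sum b U - 1"] assms(1) by auto
      show "4 * int k + nrm k (sum ?b A) \<le> deg U w ?a A"
        if A: "A \<subseteq> U" "A \<noteq> {}" "A \<noteq> U" "A \<noteq> {v0}" for A
        using A(1-3)
      proof (cases rule: cut_cases)
        case slack
        then show ?thesis unfolding deg[OF A(1)] sum_pt[OF A(1)]
          using nrm_step[of k "sum b A - 1"] by (auto simp: of_bool_def)
      next
        case (single v)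
        then show ?thesis using cut_ge_all[OF A(1-3)] assms(2)
          unfolding deg[OF A(1)] sum_pt[OF A(1)] unfolding single by (auto simp: of_bool_def)
      qed
    qed (use finite_U w_sym w_nonneg w_diag in auto)
    show "smaller U w ?a U w a"
      unfolding smaller_def sum_pt[OF subset_refl] using assms(1) by simp
    show "extendable k U w ?p ?b \<Longrightarrow> extendable k U w p b"
      by (rule extendable_shift) simp_all
  qed
qed

text \<open>Modulo 2k+1, one edge into x from the outside is the same as 2k edges in the opposite
  direction, and no edge is the same as 2k+1 edges. After such an exchange the residue wanted at x
  has the opposite sign, so that an edge at x can be deleted.\<close>

lemma not_all_positive:
  assumes out: "\<And>u. u \<in> U \<Longrightarrow> nrm k (b u - 1) < nrm k (b u)"
    and not_in: "\<And>u. u \<in> U \<Longrightarrow> \<not> nrm k (b u + 1) < nrm k (b u)"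
  shows False
proof -
  let ?m = "2 * int k + 1"
  have p: "p u = - a u" if "u \<in> U" for u
    using no_removable_external_edge[OF that out[OF that]] .
  \<comment> \<open>\<open>c\<close> is the growth of the external degree of \<open>x\<close>:
    \<open>2k\<close> leaving edges replace one entering edge, or \<open>2k + 1\<close> leaving
    edges are added where no external edges exist. Either way \<open>p x\<close> grows by
    \<open>2k + 1\<close>, and \<open>b x\<close> is raised by the same amount.\<close>
  obtain x c where x: "x \<in> U" and c: "a x \<ge> 1 \<and> c = ?m - 2 \<or> (\<forall>u\<in>U. a u = 0) \<and> c = ?m"
  proof (cases "\<forall>u\<in>U. a u = 0")
    case True
    have "U \<noteq> {}" using card_U by auto
    then show ?thesis using that True by blast
  next
    case False
    then show ?thesis using that a_nonneg by (metis One_nat_def int_one_le_iff_zero_less order_le_less)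
  qed
  obtain y where y: "y \<in> U" "w x y > 0"
    using crossing_edge[of "{x}"] x single_neq_U by (metis DiffD1 empty_not_insert empty_subsetI insert_subset
      singletonD)
  have ne: "x \<noteq> y" using y w_diag[of x] by auto
  have w: "w y x > 0" using y w_sym[of x] by simp
  let ?w = "\<lambda>u v. w u v + (-1) * unit_edge y x u v"
  let ?a = "\<lambda>u. a u + c * of_bool (u = x)" and ?p = "\<lambda>u. p u + ?m * of_bool (u = x)"
  let ?b1 = "\<lambda>u. b u + ?m * of_bool (u = x)"
  let ?b = "\<lambda>u. ?b1 u + (-1) * of_bool (u = y) + 1 * of_bool (u = x)"
  have c_ge: "c \<ge> ?m - 2" using c by auto
  have deg: "deg U ?w ?a A = deg U w a A - of_bool ((y \<in> A) \<noteq> (x \<in> A)) + c * of_bool (x \<in> A)"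
    if "A \<subseteq> U" for A
    by (subst deg_add_edge[OF finite_U that y(1) x], subst deg_add_point[OF finite_U that]) simp
  have sum_pt: "(\<Sum>u\<in>A. g u + d * of_bool (u = z)) = sum g A + d * of_bool (z \<in> A)" if "A \<subseteq> U"
    for A d z and g :: "'a \<Rightarrow> int"
    by (rule sum_add_point[OF finite_subset[OF that finite_U]])
  have sum_bU: "sum ?b U = sum b U + ?m" unfolding sum_pt[OF subset_refl] using x y by simp
  show False
  proof (rule not_smaller)
    show "admissible k U ?w ?a ?p ?b v0"
    proof
      show "?w u v = ?w v u" for u v
        using w_sym[of u v] by (simp only: unit_edge_def conj_commute add.commute)
      show "0 \<le> ?w u v" for u v
        using w_nonneg[of u v] w y(2) unit_edge_le[OF ne[symmetric], of 1 w u v] by auto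
      show "?w u u = 0" for u unfolding unit_edge_def using w_diag ne by auto
      show "\<bar>?p u\<bar> \<le> ?a u" if "u \<in> U" for u
        using p_le[OF that] p[OF x] c x by (cases "u = x") auto
      show "even (?p u - ?a u)" if "u \<in> U" for u using p_parity[OF that] c by auto
      show "even (?b u - deg U ?w ?a {u})" if "u \<in> U" for u
        using b_parity[OF that] ne c by (subst deg) (use that in auto)
      show "nrm k (sum ?p U - sum ?b U) = 0"
        unfolding sum_bU unfolding sum_pt[OF subset_refl] using total x by simp
      show "nrm k (?b v0) = 0" if "v0 \<in> U" using nonzero exempt that by blast
      show "sum ?a U \<le> 4 * int k + nrm k (sum ?b U)"
      proof -
        \<comment> \<open>All external edges enter \<open>U\<close>, so
          \<open>nrm k (sum b U)\<close> equals \<open>nrm k D\<close>. After an exchange the claim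
          amounts to \<open>D + nrm k D\<close> being at most \<open>4k + 2\<close>. It follows from
          the bound of \<open>nrm k D\<close> by the distance from \<open>D\<close> to
          \<open>4k + 2\<close>, since \<open>D\<close> above \<open>4k + 2\<close> would violate
          \<open>external_le\<close>.\<close>
        define D where "D = sum a U"
        have "sum p U = - D" unfolding D_def sum_negf[symmetric] by (rule sum.cong) (use p in auto)
        then have D: "nrm k (sum b U) = nrm k D"
          using nrm_diff_0[OF total] nrm_minus[of k D] by simp
        have D0: "0 \<le> D" unfolding D_def using a_nonneg by (rule sum_nonneg)
        have "D \<le> 4 * int k + nrm k D" using external_le unfolding D D_def .
        have "nrm k (D - 2 * ?m) = nrm k D"
        proof (rule nrm_diff_0)
          have "D - 2 * ?m - D = ?m * (-2)" by simp
          then show "nrm k (D - 2 * ?m - D) = 0" unfolding nrm_eq_0_iff by (metis dvd_triv_left dvd_mult even_minus even_numeral)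
        qed
        then have "nrm k D \<le> \<bar>D - 2 * ?m\<bar>" using nrm_le_abs[of k "D - 2 * ?m"] by simp
        moreover have "nrm k D \<le> D" using nrm_le_abs[of k D] D0 by simp
        moreover have "D = 0" if "\<forall>u\<in>U. a u = 0" unfolding D_def using that by simp
        moreover have "sum ?a U = D + c" unfolding sum_pt[OF subset_refl] D_def using x by simp
        ultimately show ?thesis
          unfolding sum_bU nrm_add_half D using \<open>D \<le> 4 * int k + nrm k D\<close> c by auto
      qed
      show "4 * int k + nrm k (sum ?b A) \<le> deg U ?w ?a A"
        if A: "A \<subseteq> U" "A \<noteq> {}" "A \<noteq> U" "A \<noteq> {v0}" for A
      proof (cases "x \<in> A")
        case True
        have half: "nrm k (sum b A + 1 + ?m) = ?m - nrm k (sum b A + 1)" by (rule nrm_add_half)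
        have sum_b: "sum ?b A = (if y \<in> A then sum b A + ?m else sum b A + 1 + ?m)"
          unfolding sum_pt[OF A(1)] using True by simp
        have deg_A: "deg U ?w ?a A = deg U w a A + c - (if y \<in> A then 0 else 1)"
          unfolding deg[OF A(1)] using True by simp
        show ?thesis using A(1-3)
        proof (cases rule: cut_cases)
          case slack
          then show ?thesis unfolding sum_b deg_A
            using nrm_add_half[of k "sum b A"] half nrm_step[of k "sum b A"] nrm_nonneg[of k "sum b A"]
              nrm_nonneg[of k "sum b A + 1"] c_ge by (auto split: if_splits)
        next
          case (single v)
          then have A': "A = {x}" "y \<notin> A" using True ne by auto
          \<comment> \<open>At \<open>x\<close> the distance changes from some \<open>n\<close> to
            \<open>2k - n\<close>, while the degree grows by \<open>c - 1\<close>, which is at least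
            \<open>2k - 2\<close>. This suffices precisely because \<open>n\<close> is at least
            1.\<close>
          then have "nrm k (sum b A + 1) = nrm k (sum b A) + 1" "nrm k (sum b A) \<noteq> 0"
            using nrm_step[of k "b x"] not_in[OF x] nonzero[OF x] by auto
          then show ?thesis unfolding sum_b deg_A using A'(2)
            using cut_ge_all[OF A(1-3)] half nrm_nonneg[of k "sum b A"] c_ge by auto
        qed
      next
        case False
        then have sum_b: "sum ?b A = sum b A - of_bool (y \<in> A)" unfolding sum_pt[OF A(1)] by simp
        have deg_A: "deg U ?w ?a A = deg U w a A - of_bool (y \<in> A)"
          unfolding deg[OF A(1)] using False by simp
        show ?thesis using A(1-3)
        proof (cases rule: cut_cases)
          case slack
          then show ?thesis unfolding sum_b deg_A
            using nrm_step[of k "sum b A - 1"] by (auto simp: of_bool_def)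
        next
          case (single v)
          then show ?thesis using cut_ge_all[OF A(1-3)] out[OF y(1)]
            unfolding sum_b deg_A unfolding single by (auto simp: of_bool_def)
        qed
      qed
    qed (use finite_U in auto)
    have "weight U ?w < weight U w"
      by (subst weight_add_edge[OF finite_U y(1) x]) simp
    then show "smaller U ?w ?a U w a" unfolding smaller_def by blast
    assume "extendable k U ?w ?p ?b"
    then have "extendable k U w ?p ?b1"
      by (rule extendable_delete_edge[OF finite_U y(1) x ne[symmetric]])
    then show "extendable k U w p b" by (rule extendable_shift[rotated]) simp
  qed
qed

text \<open>\<open>P\<close> consists of the vertices whose residue wants to be lowered. An edge
  between \<open>P\<close> and its complement would be deletable, so by connectivity all residues
  have the same sign; reversing all directions turns the negative case into the positive
  one.\<close>

lemma impossible: False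
proof -
  define P where "P = {u\<in>U. nrm k (b u - 1) < nrm k (b u)}"
  have adj: "(x \<in> P \<longleftrightarrow> y \<in> P) \<and> (x \<in> P \<longrightarrow> \<not> nrm k (b x + 1) < nrm k (b x))"
    if "x \<in> U" "y \<in> U" "w x y > 0" for x y
    using no_deletable_edge[OF that] no_deletable_edge[OF that(2,1)] that w_sym[of x y]
      nrm_decrease[OF nonzero[OF that(1)]] nrm_decrease[OF nonzero[OF that(2)]]
    unfolding P_def by auto
  have "P = {} \<or> P = U"
  proof (rule ccontr)
    assume "\<not> ?thesis"
    then obtain x y where "x \<in> P" "y \<in> U - P" "w x y > 0"
      using crossing_edge[of P] unfolding P_def by blast
    then show False using adj[of x y] unfolding P_def by blast
  qed
  moreover have nbr: "\<exists>y\<in>U. w x y > 0" if "x \<in> U" for x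
    using crossing_edge[of "{x}"] that single_neq_U by (metis DiffD1 empty_not_insert empty_subsetI
      insert_subset singletonD)
  moreover have False if "P = U"
    by (rule not_all_positive) (use that nbr adj P_def in blast)+
  moreover have False if "P = {}"
  proof -
    interpret neg: minimal_counterexample k U w a "\<lambda>x. - p x" "\<lambda>x. - b x" v0
      using admissible_minus[OF admissible_axioms] IH k_pos not_extendable extendable_minus card_U
      unfolding minimal_counterexample_def minimal_counterexample_axioms_def by blast
    have eq: "nrm k (- b u - 1) = nrm k (b u + 1)" "nrm k (- b u + 1) = nrm k (b u - 1)" for u
      using nrm_minus[of k "b u + 1"] nrm_minus[of k "b u - 1"] by simp_all
    show False
    proof (rule neg.not_all_positive)
      show "nrm k (- b u - 1) < nrm k (- b u)" if "u \<in> U" for u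
        unfolding eq nrm_minus using \<open>P = {}\<close> that nrm_decrease[OF nonzero[OF that]]
        unfolding P_def by blast
      show "\<not> nrm k (- b u + 1) < nrm k (- b u)" if "u \<in> U" for u
        unfolding eq nrm_minus using \<open>P = {}\<close> that unfolding P_def by blast
    qed
  qed
  ultimately show False by blast
qed

end

text \<open>If one vertex is exempt, the edges between the two can pass on its external net flow, as
  they are at least as many as its external edges. If none is, adding up the cut conditions gives at
  least \<open>2k\<close> edges, enough for the net flow to take every residue modulo
  \<open>2k + 1\<close>.\<close>

lemma extendable_pair:
  assumes "k > 0" and adm: "admissible k U w a p b v0" and U: "U = {x, y}" "x \<noteq> y"
  shows "extendable k U w p b"
proof -
  interpret admissible k U w a p b v0 by fact
  let ?m = "2 * int k + 1"
  have deg: "deg U w a {x} = w x y + a x" "deg U w a {y} = w x y + a y"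
    using deg_singleton[of U w x a] deg_singleton[of U w y a] finite_U U w_diag w_sym[of y x] by simp_all
  have tot: "?m dvd p x + p y - (b x + b y)" using total U unfolding nrm_eq_0_iff by simp
  have ext: "a x + a y \<le> 4 * int k + nrm k (b x + b y)" using external_le U by simp
  have cut: "u = v0 \<or> 4 * int k + nrm k (b u) \<le> deg U w a {u}" if "u \<in> U" for u
    using cut_ge[of "{u}"] that U by auto
  have "\<exists>c. \<bar>c\<bar> \<le> w x y \<and> even (c - w x y) \<and> ?m dvd c + p x - b x"
  proof -
    consider "v0 = x" | "v0 = y" | "v0 \<noteq> x" "v0 \<noteq> y" by blast
    then show ?thesis
    proof cases
      case 1
      then have 0: "nrm k (b x) = 0" using exempt U by simp
      have "a x \<le> w x y"
        using cut[of y] ext deg U 1 nrm_add_0[OF 0, of "b y"] by (simp add: add.commute)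
      moreover have "even (b x)" "?m dvd - b x" using 0 unfolding nrm_eq_0_iff by simp_all
      moreover have "even (- p x - w x y)"
        using p_parity[of x] b_parity[of x] deg U \<open>even (b x)\<close> by auto
      ultimately show ?thesis using p_le[of x] U by (intro exI[of _ "- p x"]) auto
    next
      case 2
      then have 0: "nrm k (b y) = 0" using exempt U by simp
      have "a y \<le> w x y"
        using cut[of x] ext deg U 2 nrm_add_0[OF 0, of "b x"] by simp
      moreover have "even (b y)" "?m dvd b y" using 0 unfolding nrm_eq_0_iff by simp_all
      moreover have "even (p y - w x y)"
        using p_parity[of y] b_parity[of y] deg U \<open>even (b y)\<close> by auto
      moreover have "?m dvd p y + p x - b x"
      proof -
        have "p y + p x - b x = (p x + p y - (b x + b y)) + b y" by simp
        then show ?thesis using dvd_add[OF tot \<open>?m dvd b y\<close>] by (simp only:)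
      qed
      ultimately show ?thesis using p_le[of y] U by (intro exI[of _ "p y"]) auto
    next
      case 3
      then have "4 * int k + nrm k (b x) \<le> w x y + a x" "4 * int k + nrm k (b y) \<le> w x y + a y"
        using cut[of x] cut[of y] deg U by auto
      then have w: "2 * int k \<le> w x y" using ext nrm_triangle[of k "b x" "b y"] by linarith
      define t where "t = b x - p x + w x y"
      \<comment> \<open>\<open>k + 1\<close> is the inverse of 2 modulo \<open>2k + 1\<close>;
        \<open>j\<close> is the number of edges directed from \<open>x\<close> to
        \<open>y\<close>.\<close>
      define j where "j = ((int k + 1) * t) mod ?m"
      have j: "0 \<le> j" "j < ?m"
        unfolding j_def by (rule pos_mod_sign, simp) (rule pos_mod_bound, simp)
      have "?m dvd 2 * j - t"
      proof -
        have "?m dvd (int k + 1) * t - j" unfolding j_def by (rule dvd_minus_mod)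
        then have "?m dvd ?m * t - 2 * ((int k + 1) * t - j)"
          by (rule dvd_diff[OF dvd_triv_left dvd_mult])
        moreover have "?m * t - 2 * ((int k + 1) * t - j) = 2 * j - t" by (simp add: algebra_simps)
        ultimately show ?thesis by (simp only:)
      qed
      moreover have "2 * j - w x y + p x - b x = 2 * j - t" unfolding t_def by simp
      moreover have "\<bar>2 * j - w x y\<bar> \<le> w x y" using w j by linarith
      moreover have "even (2 * j - w x y - w x y)" by simp
      ultimately show ?thesis by (intro exI[of _ "2 * j - w x y"]) (simp only: simp_thms)
    qed
  qed
  then obtain c where c: "\<bar>c\<bar> \<le> w x y" "even (c - w x y)" "?m dvd c + p x - b x" by blast
  define n where "n u v = c * unit_flow x y u v" for u v
  have n_eq: "n x y = c" "n y x = - c" "n x x = 0" "n y y = 0"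
    unfolding n_def unit_flow_def using U by auto
  have "skew n"
  proof (rule skewI)
    show "n v u = - n u v" for u v using skewD[OF skew_unit_flow, of x y v u] unfolding n_def by simp
  qed
  moreover have "\<bar>n u v\<bar> \<le> w u v \<and> even (n u v - w u v)" if "u \<in> U" "v \<in> U" for u v
    using that U c n_eq w_diag w_sym[of y x] by auto
  moreover have "?m dvd (\<Sum>v\<in>U. n u v) + p u - b u" if "u \<in> U" for u
  proof (cases "u = x")
    case True
    then show ?thesis using c(3) U n_eq by simp
  next
    case False
    have "- c + p y - b y = (p x + p y - (b x + b y)) - (c + p x - b x)" by simp
    then have "?m dvd - c + p y - b y" using dvd_diff[OF tot c(3)] by (simp only:)
    then show ?thesis using False that U n_eq by simp
  qed
  ultimately show ?thesis unfolding extendable_def by blast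
qed

theorem admissible_imp_extendable:
  fixes U :: "'v set"
  assumes "k > 0" "admissible k U w a p b v0"
  shows "extendable k U w p b"
proof -
  define R where "R = inv_image (less_than <*lex*> less_than <*lex*> less_than)
    (\<lambda>(U :: 'v set, w :: 'v \<Rightarrow> 'v \<Rightarrow> int, a :: 'v \<Rightarrow> int). (card U, nat (weight U w), nat (sum a U)))"
  have "wf R" unfolding R_def by (intro wf_inv_image wf_lex_prod) simp_all
  \<comment> \<open>\<open>nat\<close> keeps the decrease strict because admissibility makes the
    measures of the smaller instance nonnegative.\<close>
  have smaller_R: "((U', w', a'), (U, w, a)) \<in> R"
    if sm: "smaller U' w' a' U w a" and adm: "admissible k U' w' a' p' b' v0'" for U w a U' w' a' p' b' v0'
  proof -
    interpret admissible k U' w' a' p' b' v0' by fact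
    have "0 \<le> weight U' w'" unfolding weight_def by (intro sum_nonneg w_nonneg)
    moreover have "0 \<le> sum a' U'" by (intro sum_nonneg a_nonneg)
    ultimately show ?thesis using sm unfolding smaller_def R_def by auto
  qed
  have "\<forall>p b v0. admissible k (fst s) (fst (snd s)) (snd (snd s)) p b v0 \<longrightarrow>
    extendable k (fst s) (fst (snd s)) p b" for s :: "'v set \<times> ('v \<Rightarrow> 'v \<Rightarrow> int) \<times> ('v \<Rightarrow> int)"
    using \<open>wf R\<close>
  proof (induction s rule: wf_induct_rule)
    case (less s)
    obtain U w a where s: "s = (U, w, a)" by (cases s) auto
    show ?case unfolding s fst_conv snd_conv
    proof (intro allI impI)
      fix p b v0 assume adm: "admissible k U w a p b v0"
      interpret admissible k U w a p b v0 by fact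
      have IH: "extendable k U' w' p' b'"
        if "smaller U' w' a' U w a" "admissible k U' w' a' p' b' v0'" for U' w' a' p' b' v0'
        using less[of "(U', w', a')"] smaller_R[OF that] that(2) unfolding s by auto
      consider "U = {}" | x where "U = {x}" | x y where "U = {x, y}" "x \<noteq> y" | "3 \<le> card U"
      proof -
        have "card U = 0 \<or> card U = 1 \<or> card U = 2 \<or> 3 \<le> card U" by linarith
        then show ?thesis using that finite_U by (auto simp: card_1_singleton_iff card_2_iff)
      qed
      then show "extendable k U w p b"
      proof cases
        case 1
        then show ?thesis unfolding extendable_def skew_def by (intro exI[of _ "\<lambda>x y. 0"]) simp
      next
        case 2
        then show ?thesis using total w_diag unfolding extendable_def skew_def nrm_eq_0_iff
          by (intro exI[of _ "\<lambda>x y. 0"]) simp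
      next
        case 3
        then show ?thesis using extendable_pair[OF assms(1) adm] by blast
      next
        case 4
        show ?thesis
        proof (rule ccontr)
          assume "\<not> ?thesis"
          then interpret minimal_counterexample k U w a p b v0
            by unfold_locales (use assms(1) IH 4 in blast)+
          show False by (rule impossible)
        qed
      qed
    qed
  qed
  from this[of "(U, w, a)"] show ?thesis using assms(2) unfolding fst_conv snd_conv by blast
qed

section \<open>From weight matrices back to named edges\<close>

definition multiplicity :: "'e set \<Rightarrow> ('e \<Rightarrow> 'v \<times> 'v) \<Rightarrow> 'v \<Rightarrow> 'v \<Rightarrow> int" where
  "multiplicity E ends u v = (\<Sum>e\<in>E. if fst (ends e) = snd (ends e) then 0
     else unit_edge (fst (ends e)) (snd (ends e)) u v)"

definition crossing :: "'e set \<Rightarrow> ('e \<Rightarrow> 'v \<times> 'v) \<Rightarrow> 'v set \<Rightarrow> 'e set" where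
  "crossing E ends X = {e\<in>E. (fst (ends e) \<in> X) \<noteq> (snd (ends e) \<in> X)}"

definition netflow :: "'e set \<Rightarrow> ('e \<Rightarrow> 'v \<times> 'v) \<Rightarrow> ('e \<Rightarrow> int) \<Rightarrow> 'v \<Rightarrow> int" where
  "netflow E ends f v = (\<Sum>e\<in>E. f e * (of_bool (fst (ends e) = v) - of_bool (snd (ends e) = v)))"

lemma deg_multiplicity:
  assumes "finite V" "finite E" "A \<subseteq> V" "\<And>e. e \<in> E \<Longrightarrow> fst (ends e) \<in> V \<and> snd (ends e) \<in> V"
  shows "deg V (multiplicity E ends) (\<lambda>x. 0) A = int (card (crossing E ends A))"
proof -
  have fin: "finite A" "finite (V - A)" using assms(1,3) finite_subset by auto
  have "deg V (multiplicity E ends) (\<lambda>x. 0) A = (\<Sum>u\<in>A. \<Sum>e\<in>E. \<Sum>v\<in>V - A.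
      if fst (ends e) = snd (ends e) then 0 else unit_edge (fst (ends e)) (snd (ends e)) u v)"
    unfolding deg_def multiplicity_def sum.swap[of _ E] by simp
  also have "\<dots> = (\<Sum>e\<in>E. \<Sum>u\<in>A. \<Sum>v\<in>V - A.
      if fst (ends e) = snd (ends e) then 0 else unit_edge (fst (ends e)) (snd (ends e)) u v)"
    by (rule sum.swap)
  also have "\<dots> = (\<Sum>e\<in>E. of_bool ((fst (ends e) \<in> A) \<noteq> (snd (ends e) \<in> A)))"
  proof (rule sum.cong[OF refl])
    fix e assume "e \<in> E"
    then show "(\<Sum>u\<in>A. \<Sum>v\<in>V - A.
      if fst (ends e) = snd (ends e) then 0 else unit_edge (fst (ends e)) (snd (ends e)) u v)
        = of_bool ((fst (ends e) \<in> A) \<noteq> (snd (ends e) \<in> A))"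
      using assms(4)[of e] sum_unit_edge[OF fin, of "fst (ends e)" "snd (ends e)"]
      by (cases "fst (ends e) = snd (ends e)") auto
  qed
  also have "\<dots> = int (card (crossing E ends A))"
    unfolding crossing_def using assms(2) by (simp add: of_bool_def sum.If_cases Int_def)
  finally show ?thesis .
qed

lemma unit_eq_0:
  assumes "\<not> (u = x \<and> v = y)" "\<not> (u = y \<and> v = x)"
  shows "unit_edge x y u v = 0" "unit_flow x y u v = 0"
  unfolding unit_edge_def unit_flow_def by (simp_all only: assms of_bool_eq)

text \<open>Edges are peeled off one by one, each directed along the net flow of its bundle, which
  keeps the remainder within bounds and parity. A loop counts in neither \<open>multiplicity\<close>
  nor \<open>netflow\<close>, so its direction is arbitrary.\<close>

lemma realize_orientation:
  assumes "finite E" "finite V" "\<And>e. e \<in> E \<Longrightarrow> fst (ends e) \<in> V \<and> snd (ends e) \<in> V"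
    and "skew n" "\<And>u v. u \<in> V \<Longrightarrow> v \<in> V \<Longrightarrow>
      \<bar>n u v\<bar> \<le> multiplicity E ends u v \<and> even (n u v - multiplicity E ends u v)"
  shows "\<exists>s. (\<forall>e\<in>E. s e = 1 \<or> s e = -1) \<and> (\<forall>v\<in>V. netflow E ends s v = (\<Sum>u\<in>V. n v u))"
  using assms(1,3-5)
proof (induction E arbitrary: n)
  case empty
  then have "n u v = 0" if "u \<in> V" "v \<in> V" for u v using that unfolding multiplicity_def by force
  then show ?case unfolding netflow_def by (intro exI[of _ "\<lambda>_. 1"]) simp
next
  case (insert e E)
  define x y where xy: "x = fst (ends e)" "y = snd (ends e)"
  have xyV: "x \<in> V" "y \<in> V" unfolding xy using insert.prems(1) by auto
  define s :: int where "s = (if n x y > 0 then 1 else -1)"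
  have s: "s = 1 \<or> s = -1" unfolding s_def by simp
  define n' where "n' u v = n u v + (- s) * unit_flow x y u v" for u v
  have skew': "skew n'" unfolding n'_def[abs_def] by (intro skew_add insert.prems(2) skew_unit_flow)
  have mult: "multiplicity (insert e E) ends u v
      = (if x = y then 0 else unit_edge x y u v) + multiplicity E ends u v" for u v
    unfolding multiplicity_def xy using insert.hyps by simp
  have mult_nonneg: "0 \<le> multiplicity E ends u v" for u v
    unfolding multiplicity_def unit_edge_def by (intro sum_nonneg) simp
  have bound: "\<bar>n' u v\<bar> \<le> multiplicity E ends u v \<and> even (n' u v - multiplicity E ends u v)"
    if "u \<in> V" "v \<in> V" for u v
  proof (cases "x = y")
    case True
    then have "n' u v = n u v" unfolding n'_def unit_flow_def by simp
    then show ?thesis using insert.prems(3)[OF that] mult True by simp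
  next
    case False
    have main: "\<bar>n' x y\<bar> \<le> multiplicity E ends x y \<and> even (n' x y - multiplicity E ends x y)"
    proof -
      have "n' x y = n x y - s" unfolding n'_def unit_flow_def using False by simp
      moreover have "multiplicity (insert e E) ends x y = multiplicity E ends x y + 1"
        unfolding mult unit_edge_def using False by simp
      ultimately show ?thesis
        using bounded_parity_step[OF mult_nonneg, of "n x y" x y] insert.prems(3)[OF xyV]
        unfolding s_def by simp
    qed
    have mult_sym: "multiplicity E ends y x = multiplicity E ends x y"
      unfolding multiplicity_def unit_edge_def by (intro sum.cong) (auto simp: add.commute)
    consider "u = x \<and> v = y" | "u = y \<and> v = x" | "\<not> (u = x \<and> v = y)" "\<not> (u = y \<and> v = x)" by blast
    then show ?thesis
    proof cases
      case 2
      then show ?thesis using main mult_sym skewD[OF skew', of y x] by auto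
    next
      case 3
      then have "n' u v = n u v" "unit_edge x y u v = 0"
        unfolding n'_def using unit_eq_0[OF 3] by simp_all
      then show ?thesis using insert.prems(3)[OF that] mult False by simp
    qed (use main in simp)
  qed
  obtain t where t: "\<forall>e\<in>E. t e = 1 \<or> t e = -1"
    "\<forall>v\<in>V. netflow E ends t v = (\<Sum>u\<in>V. n' v u)"
    using insert.IH[OF _ skew' bound] insert.prems(1) by blast
  have "netflow (insert e E) ends (t(e := s)) v = (\<Sum>u\<in>V. n v u)" if "v \<in> V" for v
  proof -
    have "netflow (insert e E) ends (t(e := s)) v
        = s * (of_bool (x = v) - of_bool (y = v)) + netflow E ends (t(e := s)) v"
      unfolding netflow_def xy using insert.hyps by simp
    also have "netflow E ends (t(e := s)) v = netflow E ends t v"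
      unfolding netflow_def by (rule sum.cong) (use insert.hyps in auto)
    also have "\<dots> = (\<Sum>u\<in>V. n v u) + (- s) * (\<Sum>u\<in>V. unit_flow x y v u)"
      using t(2) that unfolding n'_def by (simp add: sum.distrib sum_distrib_left sum_subtractf sum_negf)
    finally show ?thesis
      unfolding sum_unit_flow[OF assms(2)] using xyV by (simp add: eq_commute[of v] algebra_simps fun_upd_def)
  qed
  moreover have "\<forall>e'\<in>insert e E. (t(e := s)) e' = 1 \<or> (t(e := s)) e' = -1" using t(1) s by auto
  ultimately show ?case by blast
qed

lemma modular_orientation_aux:
  assumes "k > 0" "finite V" "finite E" "\<And>e. e \<in> E \<Longrightarrow> fst (ends e) \<in> V \<and> snd (ends e) \<in> V"
    and cuts: "\<And>X. X \<subseteq> V \<Longrightarrow> X \<noteq> {} \<Longrightarrow> X \<noteq> V \<Longrightarrow> 6 * k \<le> card (crossing E ends X)"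
    and total: "2 * int k + 1 dvd sum b V" and "v0 \<notin> V"
  shows "\<exists>s. (\<forall>e\<in>E. s e = 1 \<or> s e = -1) \<and> (\<forall>v\<in>V. 2 * int k + 1 dvd netflow E ends s v - b v)"
proof -
  let ?w = "multiplicity E ends" and ?m = "2 * int k + 1"
  have w_sym: "?w u v = ?w v u" for u v
    unfolding multiplicity_def unit_edge_def by (intro sum.cong) (auto simp: add.commute)
  have w_nonneg: "0 \<le> ?w u v" for u v
    unfolding multiplicity_def unit_edge_def by (intro sum_nonneg) simp
  have w_diag: "?w u u = 0" for u
    unfolding multiplicity_def unit_edge_def by (intro sum.neutral) auto
  note deg = deg_multiplicity[OF assms(2,3) _ assms(4)]
  \<comment> \<open>As \<open>2k + 1\<close> is odd, this keeps the residue and gives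
    \<open>b' v\<close> the parity of the degree of \<open>v\<close>.\<close>
  define b' where "b' v = b v + ?m * (b v - deg V ?w (\<lambda>x. 0) {v})" for v
  have b'_parity: "even (b' v - deg V ?w (\<lambda>x. 0) {v})" for v unfolding b'_def by auto
  have parity: "even (sum b' A - deg V ?w (\<lambda>x. 0) A)" if "A \<subseteq> V" for A
  proof -
    have "even (\<Sum>x\<in>A. b' x - deg V ?w (\<lambda>x. 0) {x})" by (rule dvd_sum) (rule b'_parity)
    then have "even (sum b' A - (\<Sum>x\<in>A. deg V ?w (\<lambda>x. 0) {x}))" by (simp only: sum_subtractf)
    from dvd_add[OF this even_sum_deg[of V A ?w "\<lambda>x. 0", OF assms(2) that w_sym w_diag]]
    show ?thesis by (simp only: diff_add_cancel add_diff_eq)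
  qed
  have b'_dvd: "?m dvd b' v - b v" for v unfolding b'_def by simp
  have "admissible k V ?w (\<lambda>x. 0) (\<lambda>x. 0) b' v0"
  proof
    show "nrm k ((\<Sum>x\<in>V. 0) - sum b' V) = 0"
    proof -
      have "?m dvd sum b V + (\<Sum>v\<in>V. b' v - b v)"
        by (rule dvd_add[OF total dvd_sum]) (rule b'_dvd)
      then have "?m dvd sum b' V" by (simp add: sum_subtractf)
      moreover have "even (sum b' V)" using parity[OF subset_refl] unfolding deg_def by simp
      ultimately show ?thesis unfolding nrm_eq_0_iff by simp
    qed
    show "4 * int k + nrm k (sum b' A) \<le> deg V ?w (\<lambda>x. 0) A"
      if A: "A \<subseteq> V" "A \<noteq> {}" "A \<noteq> V" for A
    proof -
      \<comment> \<open>The hypothesis \<open>6k\<close> is one less than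
        \<open>4k + (2k + 1)\<close>. Parity closes the gap: \<open>nrm\<close> is
        \<open>2k + 1\<close> only for odd degree, hence for degree above \<open>6k\<close>.\<close>
      have "even (nrm k (sum b' A) - deg V ?w (\<lambda>x. 0) A)"
        using parity[OF A(1)] nrm_parity[of k "sum b' A"] by auto
      moreover have "6 * int k \<le> deg V ?w (\<lambda>x. 0) A" using cuts[OF A] deg[OF A(1)] by simp
      ultimately show ?thesis using nrm_le[of k "sum b' A"] by presburger
    qed
  qed (use assms(2,7) w_sym w_nonneg w_diag b'_parity nrm_nonneg[of k "sum b' V"] in auto)
  from admissible_imp_extendable[OF assms(1) this]
  obtain n where n: "skew n" "\<And>u v. u \<in> V \<Longrightarrow> v \<in> V \<Longrightarrow> \<bar>n u v\<bar> \<le> ?w u v \<and> even (n u v - ?w u v)"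
    "\<And>u. u \<in> V \<Longrightarrow> ?m dvd (\<Sum>v\<in>V. n u v) + 0 - b' u"
    by (rule extendableE) (erule that; meson)
  obtain s where s: "\<forall>e\<in>E. s e = 1 \<or> s e = -1" "\<forall>v\<in>V. netflow E ends s v = (\<Sum>u\<in>V. n v u)"
    using realize_orientation[OF assms(3,2,4) n(1,2)] by blast
  have "?m dvd netflow E ends s v - b v" if "v \<in> V" for v
  proof -
    have "netflow E ends s v - b v = ((\<Sum>u\<in>V. n v u) + 0 - b' v) + (b' v - b v)"
      using s(2) that by simp
    then show ?thesis using dvd_add[OF n(3)[OF that] b'_dvd] by (simp only:)
  qed
  then show ?thesis using s(1) by blast
qed

text \<open>The locale of the reduction needs a name for a possibly missing exempt vertex; passing to
  the option type provides one.\<close>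

theorem modular_orientation:
  assumes "k > 0" "finite V" "finite E" "\<And>e. e \<in> E \<Longrightarrow> fst (ends e) \<in> V \<and> snd (ends e) \<in> V"
    and cuts: "\<And>X. X \<subseteq> V \<Longrightarrow> X \<noteq> {} \<Longrightarrow> X \<noteq> V \<Longrightarrow> 6 * k \<le> card (crossing E ends X)"
    and total: "2 * int k + 1 dvd sum b V"
  shows "\<exists>s. (\<forall>e\<in>E. s e = 1 \<or> s e = -1) \<and> (\<forall>v\<in>V. 2 * int k + 1 dvd netflow E ends s v - b v)"
proof -
  let ?ends = "\<lambda>e. (Some (fst (ends e)), Some (snd (ends e)))"
  have "6 * k \<le> card (crossing E ?ends X)"
    if X: "X \<subseteq> Some ` V" "X \<noteq> {}" "X \<noteq> Some ` V" for X
  proof -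
    obtain Y where Y: "X = Some ` Y" "Y \<subseteq> V" using X(1) by (meson subset_imageE)
    have "crossing E ?ends X = crossing E ends Y" unfolding crossing_def Y(1) by auto
    then show ?thesis using cuts[of Y] X Y by auto
  qed
  moreover have "2 * int k + 1 dvd sum (b \<circ> the) (Some ` V)"
    using total by (simp add: sum.reindex)
  ultimately have "\<exists>s. (\<forall>e\<in>E. s e = 1 \<or> s e = -1) \<and>
      (\<forall>v\<in>Some ` V. 2 * int k + 1 dvd netflow E ?ends s v - (b \<circ> the) v)"
    using assms(1-4) by (intro modular_orientation_aux[where ?v0.0 = None]) auto
  moreover have "netflow E ?ends s (Some v) = netflow E ends s v" for s v
    unfolding netflow_def by simp
  ultimately show ?thesis by auto
qed

section \<open>Flows with exact boundary\<close>

definition dout :: "'e set \<Rightarrow> ('e \<Rightarrow> 'v \<times> 'v) \<Rightarrow> 'v set \<Rightarrow> int" where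
  "dout E ends X = (\<Sum>e\<in>E. of_bool (fst (ends e) \<in> X \<and> snd (ends e) \<notin> X))"

definition din :: "'e set \<Rightarrow> ('e \<Rightarrow> 'v \<times> 'v) \<Rightarrow> 'v set \<Rightarrow> int" where
  "din E ends X = (\<Sum>e\<in>E. of_bool (snd (ends e) \<in> X \<and> fst (ends e) \<notin> X))"

lemma dout_submodular: "dout E ends (X \<inter> Y) + dout E ends (X \<union> Y) \<le> dout E ends X + dout E ends Y"
  unfolding dout_def sum.distrib[symmetric] by (rule sum_mono) auto

lemma din_submodular: "din E ends (X \<inter> Y) + din E ends (X \<union> Y) \<le> din E ends X + din E ends Y"
  unfolding din_def sum.distrib[symmetric] by (rule sum_mono) auto

lemma dout_insert: "finite E \<Longrightarrow> e \<notin> E \<Longrightarrow>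
    dout (insert e E) ends X = of_bool (fst (ends e) \<in> X \<and> snd (ends e) \<notin> X) + dout E ends X"
  unfolding dout_def by simp

lemma card_crossing:
  assumes "finite E" shows "int (card (crossing E ends X)) = dout E ends X + din E ends X"
proof -
  have "int (card (crossing E ends X)) = (\<Sum>e\<in>E. of_bool ((fst (ends e) \<in> X) \<noteq> (snd (ends e) \<in> X)))"
    unfolding crossing_def using assms by (simp add: of_bool_def sum.If_cases Int_def)
  also have "\<dots> = dout E ends X + din E ends X"
    unfolding dout_def din_def sum.distrib[symmetric] by (rule sum.cong) auto
  finally show ?thesis .
qed

lemma sum_netflow:
  assumes "finite X"
  shows "(\<Sum>v\<in>X. netflow E ends f v) =
    (\<Sum>e\<in>E. f e * (of_bool (fst (ends e) \<in> X) - of_bool (snd (ends e) \<in> X)))"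
proof -
  have "(\<Sum>v\<in>X. netflow E ends f v)
      = (\<Sum>e\<in>E. \<Sum>v\<in>X. f e * (of_bool (fst (ends e) = v) - of_bool (snd (ends e) = v)))"
    unfolding netflow_def by (rule sum.swap)
  also have "\<dots> = (\<Sum>e\<in>E. f e * (of_bool (fst (ends e) \<in> X) - of_bool (snd (ends e) \<in> X)))"
    using assms by (simp only: sum_distrib_left[symmetric] sum_subtractf eq_commute[of "fst _"]
        eq_commute[of "snd _"] sum_of_bool_eq)
  finally show ?thesis .
qed

text \<open>Gale's theorem for unit capacities, by induction on the edges: if an edge can be neither
  discarded nor used, then tight sets on its two sides uncross.\<close>

lemma supply_demand:
  assumes "finite E" "finite V" "\<And>e. e \<in> E \<Longrightarrow> fst (ends e) \<in> V \<and> snd (ends e) \<in> V"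
    and "sum c V = 0" "\<And>X. X \<subseteq> V \<Longrightarrow> sum c X \<le> dout E ends X"
  shows "\<exists>A\<subseteq>E. \<forall>v\<in>V. netflow A ends (\<lambda>_. 1) v = c v"
  using assms(1,3-5)
proof (induction E arbitrary: c)
  case empty
  have "c v \<le> 0" if "v \<in> V" for v
    using empty(3)[of "{v}"] that unfolding dout_def by simp
  then have "(\<Sum>v\<in>V. - c v) = 0 \<longleftrightarrow> (\<forall>v\<in>V. - c v = 0)"
    by (intro sum_nonneg_eq_0_iff) (use assms(2) in auto)
  then show ?case using empty(2) unfolding netflow_def by (simp add: sum_negf)
next
  case (insert e E)
  define x y where xy: "x = fst (ends e)" "y = snd (ends e)"
  have xyV: "x \<in> V" "y \<in> V" unfolding xy using insert.prems(1) by auto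
  have dout: "dout (insert e E) ends X = of_bool (x \<in> X \<and> y \<notin> X) + dout E ends X" for X
    unfolding xy by (rule dout_insert[OF insert.hyps])
  let ?c = "\<lambda>u. c u + (-1) * of_bool (u = x) + 1 * of_bool (u = y)"
  have sum_c: "sum ?c X = sum c X - of_bool (x \<in> X) + of_bool (y \<in> X)" if "X \<subseteq> V" for X
    using finite_subset[OF that assms(2)]
    by (subst sum_add_point, assumption, subst sum_add_point) simp_all
  have sum_c0: "sum ?c V = 0" using sum_c[OF subset_refl] xyV insert.prems(2) by simp
  have dir: "\<And>e. e \<in> E \<Longrightarrow> fst (ends e) \<in> V \<and> snd (ends e) \<in> V" using insert.prems(1) by blast
  consider (discard) "\<And>X. X \<subseteq> V \<Longrightarrow> sum c X \<le> dout E ends X"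
    | (use) "\<And>X. X \<subseteq> V \<Longrightarrow> sum ?c X \<le> dout E ends X"
    | (blocked) X Y where "X \<subseteq> V" "Y \<subseteq> V" "dout E ends X < sum c X" "dout E ends Y < sum ?c Y"
    by (meson not_le)
  then show ?case
  proof cases
    case discard
    then show ?thesis using insert.IH[OF dir insert.prems(2)] by blast
  next
    case use
    then obtain A where A: "A \<subseteq> E" "\<forall>v\<in>V. netflow A ends (\<lambda>_. 1) v = ?c v"
      using insert.IH[OF dir sum_c0] by blast
    have "finite A" "e \<notin> A" using A(1) insert.hyps finite_subset by blast+
    then have "netflow (insert e A) ends (\<lambda>_. 1) v = c v" if "v \<in> V" for v
    proof -
      have "netflow (insert e A) ends (\<lambda>_. 1) v
          = of_bool (x = v) - of_bool (y = v) + netflow A ends (\<lambda>_. 1) v"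
        unfolding netflow_def xy using \<open>finite A\<close> \<open>e \<notin> A\<close> by simp
      then show ?thesis using A(2) that by (simp add: eq_commute[of v])
    qed
    moreover have "insert e A \<subseteq> insert e E" using A(1) by blast
    ultimately show ?thesis by blast
  next
    case blocked
    have XY: "X \<inter> Y \<subseteq> V" "X \<union> Y \<subseteq> V" using blocked by auto
    have 1: "x \<in> X" "y \<notin> X"
      using insert.prems(3)[OF blocked(1)] blocked(3) unfolding dout by (auto simp: of_bool_def split: if_splits)
    have 2: "y \<in> Y" "x \<notin> Y"
      using insert.prems(3)[OF blocked(2)] blocked(4) unfolding dout sum_c[OF blocked(2)]
      by (auto simp: of_bool_def split: if_splits)
    have fin: "finite X" "finite Y" using blocked(1,2) assms(2) finite_subset by blast+
    \<comment> \<open>\<open>X \<union> Y\<close> contains both ends of \<open>e\<close> and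
      \<open>X \<inter> Y\<close> neither, so \<open>e\<close> leaves neither set, and submodularity
      over the remaining edges contradicts the two violations.\<close>
    have "sum c (X \<union> Y) + sum c (X \<inter> Y) = sum c X + sum c Y" by (rule sum.union_inter[OF fin])
    moreover have "sum c (X \<union> Y) \<le> dout E ends (X \<union> Y)" "sum c (X \<inter> Y) \<le> dout E ends (X \<inter> Y)"
      using insert.prems(3)[OF XY(2)] insert.prems(3)[OF XY(1)] 1 2 unfolding dout by simp_all
    moreover have "sum ?c Y = sum c Y + 1" using 2 unfolding sum_c[OF blocked(2)] by simp
    ultimately show ?thesis using dout_submodular[of E ends X Y] blocked(3,4) by linarith
  qed
qed

text \<open>Only a bound with the error term 2k is needed, because the slack in the supply-demand
  condition is a multiple of 2k+1.\<close>

theorem exact_flow: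
  assumes "k > 0" "finite V" "finite E" "\<And>e. e \<in> E \<Longrightarrow> fst (ends e) \<in> V \<and> snd (ends e) \<in> V"
    and cuts: "\<And>X. X \<subseteq> V \<Longrightarrow> X \<noteq> {} \<Longrightarrow> X \<noteq> V \<Longrightarrow> 6 * k \<le> card (crossing E ends X)"
    and total: "sum b V = 0"
    and demand: "\<And>X. X \<subseteq> V \<Longrightarrow> \<bar>sum b X\<bar> \<le> int k * int (card (crossing E ends X)) + 2 * int k"
  shows "\<exists>f. (\<forall>e\<in>E. \<bar>f e\<bar> = int k \<or> \<bar>f e\<bar> = int k + 1) \<and> (\<forall>v\<in>V. netflow E ends f v = b v)"
proof -
  let ?m = "2 * int k + 1"
  \<comment> \<open>The factor -2 is chosen because \<open>-2k\<close> is 1 modulo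
    \<open>2k + 1\<close>: the flow with all values \<open>k\<close> along \<open>s\<close> then has
    boundary congruent to \<open>b\<close>, and the quotient \<open>c\<close> of the error is
    integral.\<close>
  have "?m dvd (\<Sum>v\<in>V. - 2 * b v)" unfolding sum_distrib_left[symmetric] total by simp
  then obtain s where s: "\<forall>e\<in>E. s e = 1 \<or> s e = -1"
    "\<forall>v\<in>V. ?m dvd netflow E ends s v - (- 2 * b v)"
    using modular_orientation[OF assms(1-5), of "\<lambda>v. - 2 * b v"] by blast
  define c where "c v = (int k * netflow E ends s v - b v) div ?m" for v
  have c: "?m * c v = int k * netflow E ends s v - b v" if "v \<in> V" for v
  proof -
    have "int k * netflow E ends s v - b v = int k * (netflow E ends s v - (- 2 * b v)) - ?m * b v"
      by (simp add: algebra_simps)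
    moreover have "?m dvd \<dots>"
      by (rule dvd_diff[OF dvd_mult dvd_triv_left]) (use s(2) that in blast)
    ultimately show ?thesis unfolding c_def by (metis dvd_mult_div_cancel)
  qed
  have sum_c: "?m * sum c X = int k * sum (netflow E ends s) X - sum b X" if "X \<subseteq> V" for X
  proof -
    have "?m * sum c X = (\<Sum>v\<in>X. ?m * c v)" by (rule sum_distrib_left)
    also have "\<dots> = (\<Sum>v\<in>X. int k * netflow E ends s v - b v)"
      by (rule sum.cong) (use c that in auto)
    finally show ?thesis by (simp add: sum_subtractf sum_distrib_left)
  qed
  let ?ends = "\<lambda>e. if s e = 1 then ends e else (snd (ends e), fst (ends e))"
  have netflow_s: "netflow A ends s v = netflow A ?ends (\<lambda>_. 1) v" if "A \<subseteq> E" for A v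
    unfolding netflow_def by (rule sum.cong) (use s(1) that in auto)
  have crossing: "crossing E ?ends X = crossing E ends X" for X
    unfolding crossing_def by (intro Collect_cong) auto
  have sum_netflow_s: "sum (netflow E ends s) X = dout E ?ends X - din E ?ends X" if "X \<subseteq> V" for X
    unfolding netflow_s[OF subset_refl] sum_netflow[OF finite_subset[OF that assms(2)]]
      dout_def din_def sum_subtractf[symmetric] by (rule sum.cong) (use s(1) in auto)
  have "\<exists>A\<subseteq>E. \<forall>v\<in>V. netflow A ?ends (\<lambda>_. 1) v = c v"
  proof (rule supply_demand[OF assms(3,2)])
    have "sum (netflow E ends s) V = 0"
      unfolding sum_netflow[OF assms(2)] using assms(4) by (intro sum.neutral) auto
    then show "sum c V = 0" using sum_c[OF subset_refl] total by simp
    show "sum c X \<le> dout E ?ends X" if X: "X \<subseteq> V" for X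
    proof -
      define d i where di: "d = dout E ?ends X" "i = din E ?ends X"
      have card: "int (card (crossing E ends X)) = d + i"
        using card_crossing[OF assms(3), of ?ends X] unfolding crossing di .
      have "0 \<le> d" unfolding di dout_def by (simp add: sum_nonneg)
      have "?m * sum c X = int k * (d - i) - sum b X"
        using sum_c[OF X] unfolding sum_netflow_s[OF X] di .
      then have "?m * (d - sum c X) = ?m * d - (int k * (d - i) - sum b X)"
        by (simp only: right_diff_distrib)
      also have "\<dots> = int k * (d + i) + d + sum b X" by (simp add: algebra_simps)
      also have "- 2 * int k \<le> \<dots>" using demand[OF X] \<open>0 \<le> d\<close> unfolding card by linarith
      finally have ge: "- 2 * int k \<le> ?m * (d - sum c X)" .
      have "sum c X \<le> d"
      proof (rule ccontr)
        assume "\<not> ?thesis"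
        then have "?m * (d - sum c X) \<le> ?m * (- 1)" by (intro mult_left_mono) simp_all
        from order_trans[OF ge this] show False by simp
      qed
      then show ?thesis unfolding di .
    qed
  qed (use assms(4) in auto)
  then obtain A where A: "A \<subseteq> E" "\<forall>v\<in>V. netflow A ?ends (\<lambda>_. 1) v = c v" by blast
  \<comment> \<open>On \<open>A\<close> the value \<open>k * s e\<close> becomes
    \<open>- (k + 1) * s e\<close>: reversing an edge and raising its modulus by 1 changes its value
    by exactly \<open>2k + 1\<close>.\<close>
  define f where "f e = int k * s e - ?m * (of_bool (e \<in> A) * s e)" for e
  have "netflow E ends f v = b v" if "v \<in> V" for v
  proof -
    have "netflow E ends (\<lambda>e. of_bool (e \<in> A) * s e) v = netflow A ends s v"
      unfolding netflow_def
      by (rule sum.mono_neutral_cong_right) (use A(1) assms(3) in auto)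
    also have "\<dots> = c v" using A that unfolding netflow_s[OF A(1)] by simp
    finally have "netflow E ends (\<lambda>e. of_bool (e \<in> A) * s e) v = c v" .
    moreover have "netflow E ends f v
        = int k * netflow E ends s v - ?m * netflow E ends (\<lambda>e. of_bool (e \<in> A) * s e) v"
      unfolding netflow_def f_def sum_distrib_left sum_subtractf[symmetric]
      by (rule sum.cong) (auto simp only: left_diff_distrib mult.assoc)
    ultimately show ?thesis using c[OF that] by simp
  qed
  moreover have "\<bar>f e\<bar> = int k \<or> \<bar>f e\<bar> = int k + 1" if "e \<in> E" for e
    using s(1) that unfolding f_def by (auto simp: of_bool_def)
  ultimately show ?thesis by blast
qed

section \<open>Two disjoint branchings\<close>

lemma din_insert: "finite E \<Longrightarrow> e \<notin> E \<Longrightarrow>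
    din (insert e E) ends X = of_bool (snd (ends e) \<in> X \<and> fst (ends e) \<notin> X) + din E ends X"
  unfolding din_def by simp

lemma din_Diff: "finite E \<Longrightarrow> T \<subseteq> E \<Longrightarrow> din E ends X = din (E - T) ends X + din T ends X"
  unfolding din_def by (rule sum.subset_diff)

lemma din_pos_iff:
  assumes "finite E"
  shows "0 < din E ends X \<longleftrightarrow> (\<exists>e\<in>E. snd (ends e) \<in> X \<and> fst (ends e) \<notin> X)"
proof -
  have "din E ends X = 0 \<longleftrightarrow> (\<forall>e\<in>E. of_bool (snd (ends e) \<in> X \<and> fst (ends e) \<notin> X) = (0 :: int))"
    unfolding din_def by (rule sum_nonneg_eq_0_iff) (use assms in auto)
  moreover have "0 \<le> din E ends X" unfolding din_def by (simp add: sum_nonneg)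
  ultimately show ?thesis by auto
qed

text \<open>Lovasz's proof of Edmonds' branching theorem, for two branchings.\<close>

lemma two_branchings:
  assumes "finite V" "finite E" "r \<in> V" "\<And>e. e \<in> E \<Longrightarrow> fst (ends e) \<in> V \<and> snd (ends e) \<in> V"
    and two: "\<And>X. X \<subseteq> V - {r} \<Longrightarrow> X \<noteq> {} \<Longrightarrow> 2 \<le> din E ends X"
  shows "\<exists>T\<subseteq>E. \<forall>X. X \<subseteq> V - {r} \<and> X \<noteq> {} \<longrightarrow> 0 < din T ends X \<and> 0 < din (E - T) ends X"
proof -
  \<comment> \<open>\<open>T\<close> is a first branching that has reached the vertices of
    \<open>R\<close>, while the edges outside \<open>T\<close> still enter every set avoiding the
    root, as a second branching demands.\<close>
  define grown where "grown R T \<longleftrightarrow> r \<in> R \<and> R \<subseteq> V \<and> T \<subseteq> E \<and>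
    (\<forall>e\<in>T. fst (ends e) \<in> R \<and> snd (ends e) \<in> R) \<and>
    (\<forall>X. X \<subseteq> R - {r} \<and> X \<noteq> {} \<longrightarrow> 0 < din T ends X) \<and>
    (\<forall>X. X \<subseteq> V - {r} \<and> X \<noteq> {} \<longrightarrow> 0 < din (E - T) ends X)" for R T
  have "grown {r} {}"
    unfolding grown_def
  proof (intro conjI allI impI)
    fix X assume "X \<subseteq> V - {r} \<and> X \<noteq> {}"
    then have "2 \<le> din E ends X" using two by blast
    then show "0 < din (E - {}) ends X" by simp
  qed (use assms(3) in auto)
  then have "\<exists>T. grown {r} T" by blast
  moreover have "\<forall>R. (\<exists>T. grown R T) \<longrightarrow> card R < Suc (card V)"
    unfolding grown_def using card_mono[OF assms(1)] by (auto simp: less_Suc_eq_le)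
  ultimately obtain R where R: "\<exists>T. grown R T" "\<And>R'. \<exists>T. grown R' T \<Longrightarrow> card R' \<le> card R"
    using ex_has_greatest_nat[of "\<lambda>R. \<exists>T. grown R T" "{r}" card] by blast
  then obtain T where grown: "grown R T" by blast
  have T: "r \<in> R" "R \<subseteq> V" "T \<subseteq> E" "\<forall>e\<in>T. fst (ends e) \<in> R \<and> snd (ends e) \<in> R"
    using grown unfolding grown_def by blast+
  have T_in: "0 < din T ends X" if "X \<subseteq> R - {r}" "X \<noteq> {}" for X
    using grown that unfolding grown_def by blast
  have T_out: "0 < din (E - T) ends X" if "X \<subseteq> V - {r}" "X \<noteq> {}" for X
    using grown that unfolding grown_def by blast
  define D where "D = E - T"
  have finD: "finite D" "finite T" unfolding D_def using assms(2) T(3) finite_subset by blast+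
  have din_outside: "2 \<le> din D ends X" if "X \<subseteq> V - R" "X \<noteq> {}" for X
  proof -
    have "\<not> 0 < din T ends X" unfolding din_pos_iff[OF finD(2)] using T(4) that(1) by auto
    then show ?thesis
      using din_Diff[OF assms(2) T(3), of ends X] two[of X] that T(1) unfolding D_def by force
  qed
  have "R = V"
  proof (rule ccontr)
    assume "R \<noteq> V"
    \<comment> \<open>The next edge must not be the last one of \<open>D\<close> to enter a set. Its
      head will lie outside \<open>R\<close>, so only sets with a vertex outside \<open>R\<close>
      can be endangered.\<close>
    define tight where "tight X \<longleftrightarrow> X \<subseteq> V - {r} \<and> din D ends X = 1 \<and> X - R \<noteq> {}" for X
    have meets: "X \<inter> R \<noteq> {}" if "tight X" for X
      using din_outside[of X] that unfolding tight_def by auto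
    have "\<exists>e\<in>D. fst (ends e) \<in> R \<and> snd (ends e) \<in> V - R \<and>
      (\<forall>Y. tight Y \<longrightarrow> \<not> (snd (ends e) \<in> Y \<and> fst (ends e) \<notin> Y))"
    proof (cases "\<exists>X. tight X")
      case False
      have "0 < din D ends (V - R)"
        unfolding D_def by (rule T_out) (use T(1,2) \<open>R \<noteq> V\<close> in auto)
      then obtain e where "e \<in> D" "snd (ends e) \<in> V - R" "fst (ends e) \<notin> V - R"
        unfolding din_pos_iff[OF finD(1)] by blast
      then show ?thesis using False assms(4)[of e] unfolding D_def by blast
    next
      case True
      then obtain X where X: "tight X" "\<And>Y. tight Y \<Longrightarrow> card X \<le> card Y"
        using ex_has_least_nat[of tight _ card] by blast
      have finX: "finite X" using X(1) assms(1) finite_subset unfolding tight_def by blast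
      \<comment> \<open>\<open>X - R\<close> is entered at least twice but \<open>X\<close> only
        once, so some edge leads from \<open>X \<inter> R\<close> to \<open>X - R\<close>.\<close>
      have "2 \<le> din D ends (X - R)"
        by (rule din_outside) (use X(1) in \<open>auto simp: tight_def\<close>)
      moreover have "din D ends (X - R) \<le> din D ends X
          + (\<Sum>e\<in>D. of_bool (fst (ends e) \<in> X \<inter> R \<and> snd (ends e) \<in> X - R))"
        unfolding din_def sum.distrib[symmetric] by (rule sum_mono) auto
      moreover have "din D ends X = 1" using X(1) unfolding tight_def by blast
      ultimately have "(\<Sum>e\<in>D. of_bool (fst (ends e) \<in> X \<inter> R \<and> snd (ends e) \<in> X - R)) \<noteq> (0 :: int)"
        by linarith
      then obtain e where "e \<in> D"
        "of_bool (fst (ends e) \<in> X \<inter> R \<and> snd (ends e) \<in> X - R) \<noteq> (0 :: int)"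
        by (rule sum.not_neutral_contains_not_neutral)
      then have e: "e \<in> D" "fst (ends e) \<in> X \<inter> R" "snd (ends e) \<in> X - R"
        by (auto split: if_splits)
      have "\<not> (snd (ends e) \<in> Y \<and> fst (ends e) \<notin> Y)" if Y: "tight Y" for Y
      proof
        assume eY: "snd (ends e) \<in> Y \<and> fst (ends e) \<notin> Y"
        \<comment> \<open>Uncrossing: intersection and union are each entered at least once, and by
          submodularity at most twice together. Thus \<open>X \<inter> Y\<close> is tight, and it is
          smaller than \<open>X\<close> since it misses the tail of \<open>e\<close>.\<close>
        have sub: "X \<inter> Y \<subseteq> V - {r}" "X \<union> Y \<subseteq> V - {r}" using X(1) Y unfolding tight_def by auto
        have "0 < din D ends (X \<inter> Y)" "0 < din D ends (X \<union> Y)"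
          unfolding D_def using T_out[OF sub(1)] T_out[OF sub(2)] e eY by blast+
        moreover have "din D ends X = 1" "din D ends Y = 1" using X(1) Y unfolding tight_def by auto
        ultimately have "din D ends (X \<inter> Y) = 1" using din_submodular[of D ends X Y] by linarith
        then have "tight (X \<inter> Y)" unfolding tight_def using sub(1) e(3) eY by blast
        moreover have "card (X \<inter> Y) < card X"
          by (rule psubset_card_mono[OF finX]) (use e(2) eY in blast)
        ultimately show False using X(2) by fastforce
      qed
      then show ?thesis using e X(1) unfolding tight_def by blast
    qed
    then obtain e where e: "e \<in> D" "fst (ends e) \<in> R" "snd (ends e) \<in> V - R"
      "\<And>Y. tight Y \<Longrightarrow> \<not> (snd (ends e) \<in> Y \<and> fst (ends e) \<notin> Y)" by blast
    have eT: "e \<notin> T" "e \<in> E" using e(1) unfolding D_def by auto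
    have "grown (insert (snd (ends e)) R) (insert e T)"
      unfolding grown_def
    proof (intro conjI allI impI)
      fix X assume X: "X \<subseteq> insert (snd (ends e)) R - {r} \<and> X \<noteq> {}"
      show "0 < din (insert e T) ends X"
      proof (cases "X \<subseteq> {snd (ends e)}")
        case True
        then have "X = {snd (ends e)}" using X by blast
        then show ?thesis using e(2,3) finD(2) unfolding din_pos_iff[OF finite.insertI[OF finD(2)]] by auto
      next
        case False
        then have "0 < din T ends (X - {snd (ends e)})" by (intro T_in) (use X in auto)
        then obtain t where "t \<in> T" "snd (ends t) \<in> X" "fst (ends t) \<notin> X - {snd (ends e)}"
          unfolding din_pos_iff[OF finD(2)] by blast
        moreover from this have "fst (ends t) \<noteq> snd (ends e)" using T(4) e(3) by auto
        ultimately show ?thesis unfolding din_pos_iff[OF finite.insertI[OF finD(2)]] by auto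
      qed
    next
      fix X assume X: "X \<subseteq> V - {r} \<and> X \<noteq> {}"
      have D': "D = insert e (E - insert e T)" unfolding D_def using eT by blast
      have din_e: "din D ends X = of_bool (snd (ends e) \<in> X \<and> fst (ends e) \<notin> X)
          + din (E - insert e T) ends X"
        by (subst D', rule din_insert) (use assms(2) in auto)
      have "0 < din D ends X" unfolding D_def using T_out X by blast
      show "0 < din (E - insert e T) ends X"
      proof (rule ccontr)
        assume "\<not> ?thesis"
        then have "din D ends X = 1" "snd (ends e) \<in> X \<and> fst (ends e) \<notin> X"
          using din_e \<open>0 < din D ends X\<close> by (auto simp: of_bool_def split: if_splits)
        moreover from this have "tight X" unfolding tight_def using X e(3) by blast
        ultimately show False using e(4) by blast
      qed
    qed (use T e eT in auto)
    moreover have "card (insert (snd (ends e)) R) = Suc (card R)"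
      using e(3) T(2) assms(1) finite_subset by fastforce
    ultimately show False using R(2) by fastforce
  qed
  show ?thesis
  proof (intro exI[of _ T] conjI allI impI)
    fix X assume X: "X \<subseteq> V - {r} \<and> X \<noteq> {}"
    show "0 < din T ends X" by (rule T_in) (use X \<open>R = V\<close> in auto)
    show "0 < din (E - T) ends X" by (rule T_out) (use X in auto)
  qed (rule T(3))
qed

section \<open>Parity subgraphs and Euler trails\<close>

definition vdeg :: "'e set \<Rightarrow> ('e \<Rightarrow> 'v \<times> 'v) \<Rightarrow> 'v \<Rightarrow> int" where
  "vdeg E ends v = (\<Sum>e\<in>E. of_bool (fst (ends e) = v) + of_bool (snd (ends e) = v))"

lemma vdeg_Un: "finite A \<Longrightarrow> finite B \<Longrightarrow> A \<inter> B = {} \<Longrightarrow>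
    vdeg (A \<union> B) ends v = vdeg A ends v + vdeg B ends v"
  unfolding vdeg_def by (rule sum.union_disjoint)

lemma vdeg_empty: "vdeg {} ends v = 0"
  unfolding vdeg_def by simp

lemma vdeg_insert: "finite A \<Longrightarrow> e \<notin> A \<Longrightarrow>
    vdeg (insert e A) ends v = of_bool (fst (ends e) = v) + of_bool (snd (ends e) = v) + vdeg A ends v"
  unfolding vdeg_def by simp

lemma vdeg_sym_diff:
  assumes "finite A" "finite B"
  shows "even (vdeg (sym_diff A B) ends v - (vdeg A ends v + vdeg B ends v))"
proof -
  have "vdeg (sym_diff A B) ends v = vdeg (A - B) ends v + vdeg (B - A) ends v"
    by (rule vdeg_Un) (use assms in auto)
  moreover have "vdeg ((A - B) \<union> (A \<inter> B)) ends v = vdeg (A - B) ends v + vdeg (A \<inter> B) ends v"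
    by (rule vdeg_Un) (use assms in auto)
  moreover have "(A - B) \<union> (A \<inter> B) = A" by blast
  moreover have "vdeg ((B - A) \<union> (A \<inter> B)) ends v = vdeg (B - A) ends v + vdeg (A \<inter> B) ends v"
    by (rule vdeg_Un) (use assms in auto)
  moreover have "(B - A) \<union> (A \<inter> B) = B" by blast
  ultimately have "vdeg (sym_diff A B) ends v - (vdeg A ends v + vdeg B ends v) = - 2 * vdeg (A \<inter> B) ends v"
    by simp
  then show ?thesis by simp
qed

lemma even_sum_vdeg:
  assumes "finite V" "\<And>e. e \<in> E \<Longrightarrow> fst (ends e) \<in> V \<and> snd (ends e) \<in> V"
  shows "even (sum (vdeg E ends) V)"
proof -
  have "sum (vdeg E ends) V
      = (\<Sum>e\<in>E. \<Sum>v\<in>V. of_bool (fst (ends e) = v) + of_bool (snd (ends e) = v))"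
    unfolding vdeg_def by (rule sum.swap)
  also have "\<dots> = (\<Sum>e\<in>E. 2)"
  proof (rule sum.cong[OF refl])
    fix e assume "e \<in> E"
    have "(\<Sum>v\<in>V. of_bool (fst (ends e) = v) + of_bool (snd (ends e) = v) :: int)
        = of_bool (fst (ends e) \<in> V) + of_bool (snd (ends e) \<in> V)"
      unfolding sum.distrib eq_commute[of "fst _"] eq_commute[of "snd _"] sum_of_bool_eq[OF assms(1)] ..
    then show "(\<Sum>v\<in>V. of_bool (fst (ends e) = v) + of_bool (snd (ends e) = v) :: int) = 2"
      using assms(2)[OF \<open>e \<in> E\<close>] by simp
  qed
  finally show ?thesis by simp
qed

text \<open>Existence of a T-join in a connected graph, T being the set of vertices with odd
  \<open>q\<close>. Take \<open>J\<close> with the fewest wrong parities. Their number is even, so a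
  wrong vertex has a companion, and the symmetric difference of \<open>J\<close> with a path between
  the two would repair both.\<close>

lemma parity_join:
  fixes q :: "'v \<Rightarrow> int"
  assumes "finite V" "finite E" and ends: "\<And>e. e \<in> E \<Longrightarrow> fst (ends e) \<in> V \<and> snd (ends e) \<in> V"
    and conn: "\<And>X. X \<subseteq> V \<Longrightarrow> X \<noteq> {} \<Longrightarrow> X \<noteq> V \<Longrightarrow> crossing E ends X \<noteq> {}"
    and "even (sum q V)"
  shows "\<exists>J\<subseteq>E. \<forall>v\<in>V. even (vdeg J ends v - q v)"
proof -
  define bad where "bad J = {v\<in>V. odd (vdeg J ends v - q v)}" for J
  obtain J where J: "J \<subseteq> E" "\<And>J'. J' \<subseteq> E \<Longrightarrow> card (bad J) \<le> card (bad J')"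
    using ex_has_least_nat[of "\<lambda>J. J \<subseteq> E" "{}" "\<lambda>J. card (bad J)"] by auto
  have finJ: "finite J" using J(1) assms(2) finite_subset by blast
  have "bad J = {}"
  proof (rule ccontr)
    assume "bad J \<noteq> {}"
    then obtain u where u: "u \<in> V" "odd (vdeg J ends u - q u)" unfolding bad_def by blast
    \<comment> \<open>In place of a path from \<open>u\<close> to \<open>v\<close>: an edge set with
      odd degrees only at \<open>u\<close> and \<open>v\<close>, and with none if they coincide.
      Such sets stay of this kind under symmetric difference with an edge at \<open>v\<close>, even
      if the edge has occurred before.\<close>
    define linked where
      "linked v P \<longleftrightarrow> P \<subseteq> E \<and> (\<forall>x. even (vdeg P ends x - (of_bool (x = u) + of_bool (x = v))))" for v P
    define R where "R = {v\<in>V. \<exists>P. linked v P}"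
    have "linked u {}" unfolding linked_def vdeg_empty by simp
    then have "u \<in> R" unfolding R_def using u(1) by blast
    have step: "w \<in> R" if "e \<in> E" "v \<in> R" "ends e = (v, w) \<or> ends e = (w, v)" for e v w
    proof -
      obtain P where P: "linked v P" using \<open>v \<in> R\<close> unfolding R_def by blast
      have "finite P" using P assms(2) finite_subset unfolding linked_def by blast
      have "even (vdeg (sym_diff P {e}) ends x - (of_bool (x = u) + of_bool (x = w)))" for x
      proof -
        have "vdeg {e} ends x = of_bool (x = v) + of_bool (x = w)"
          using that(3) by (auto simp: vdeg_def eq_commute[of x])
        then have "vdeg (sym_diff P {e}) ends x - (of_bool (x = u) + of_bool (x = w))
          = (vdeg (sym_diff P {e}) ends x - (vdeg P ends x + vdeg {e} ends x))
            + (vdeg P ends x - (of_bool (x = u) + of_bool (x = v))) + 2 * of_bool (x = v)" by simp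
        moreover have "even (vdeg P ends x - (of_bool (x = u) + of_bool (x = v)))"
          using P unfolding linked_def by blast
        moreover have "even (vdeg (sym_diff P {e}) ends x - (vdeg P ends x + vdeg {e} ends x))"
          by (rule vdeg_sym_diff) (use \<open>finite P\<close> in auto)
        ultimately show ?thesis by (simp only:) (intro dvd_add dvd_triv_left)
      qed
      then have "linked w (sym_diff P {e})" using P that(1) unfolding linked_def by blast
      moreover have "w \<in> V" using ends[OF that(1)] that(3) by auto
      ultimately show ?thesis unfolding R_def by blast
    qed
    have "R = V"
    proof (rule ccontr)
      assume "R \<noteq> V"
      then have "crossing E ends R \<noteq> {}" using conn[of R] \<open>u \<in> R\<close> unfolding R_def by blast
      then obtain e where "e \<in> E" "(fst (ends e) \<in> R) \<noteq> (snd (ends e) \<in> R)"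
        unfolding crossing_def by blast
      then show False using step[of e "fst (ends e)" "snd (ends e)"] step[of e "snd (ends e)" "fst (ends e)"]
        by auto
    qed
    have "\<exists>w\<in>bad J. w \<noteq> u"
    proof (rule ccontr)
      assume "\<not> ?thesis"
      then have "even (\<Sum>v\<in>V - {u}. vdeg J ends v - q v)"
        unfolding bad_def by (intro dvd_sum) auto
      moreover have "(\<Sum>v\<in>V. vdeg J ends v - q v)
          = (vdeg J ends u - q u) + (\<Sum>v\<in>V - {u}. vdeg J ends v - q v)"
        by (rule sum.remove[OF assms(1) u(1)])
      moreover have "even (\<Sum>v\<in>V. vdeg J ends v - q v)"
        unfolding sum_subtractf using assms(5) even_sum_vdeg[OF assms(1), of J ends] ends J(1)
        by (auto simp: subset_iff)
      ultimately show False using u(2) by (metis dvd_add_left_iff)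
    qed
    then obtain w where w: "w \<in> V" "odd (vdeg J ends w - q w)" "w \<noteq> u" unfolding bad_def by blast
    then obtain P where P: "linked w P" using \<open>R = V\<close> unfolding R_def by blast
    have finP: "finite P" using P assms(2) finite_subset unfolding linked_def by blast
    have "bad (sym_diff J P) \<subseteq> bad J - {u}"
    proof
      fix x assume "x \<in> bad (sym_diff J P)"
      then have x: "x \<in> V" "odd (vdeg (sym_diff J P) ends x - q x)" unfolding bad_def by auto
      have even1: "even (vdeg (sym_diff J P) ends x - (vdeg J ends x + vdeg P ends x))"
        by (rule vdeg_sym_diff[OF finJ finP])
      have even2: "even (vdeg P ends x - (of_bool (x = u) + of_bool (x = w)))"
        using P unfolding linked_def by blast
      have "vdeg (sym_diff J P) ends x - q x
          = (vdeg (sym_diff J P) ends x - (vdeg J ends x + vdeg P ends x))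
            + ((vdeg P ends x - (of_bool (x = u) + of_bool (x = w)))
            + (vdeg J ends x - q x + (of_bool (x = u) + of_bool (x = w))))" by simp
      then have *: "odd (vdeg J ends x - q x + (of_bool (x = u) + of_bool (x = w)))"
        using x(2) by (simp only: dvd_add_right_iff[OF even1] dvd_add_right_iff[OF even2] not_False_eq_True)
      have "x \<noteq> u" using * u(2) w(3) by auto
      moreover have "x \<noteq> w" using * w(2,3) by auto
      ultimately show "x \<in> bad J - {u}" using * x(1) unfolding bad_def by simp
    qed
    moreover have "finite (bad J)" "u \<in> bad J" unfolding bad_def using assms(1) u by auto
    ultimately have "card (bad (sym_diff J P)) < card (bad J)"
      by (intro psubset_card_mono) auto
    moreover have "sym_diff J P \<subseteq> E" using J(1) P unfolding linked_def by blast
    from J(2)[OF this] have "card (bad J) \<le> card (bad (sym_diff J P))" .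
    ultimately show False by linarith
  qed
  then show ?thesis using J(1) unfolding bad_def by blast
qed

section \<open>Walks as lists of directed edges, and Euler trails\<close>

definition dart_tail :: "('e \<Rightarrow> 'v \<times> 'v) \<Rightarrow> 'e \<times> bool \<Rightarrow> 'v" where
  "dart_tail ends d = (if snd d then fst (ends (fst d)) else snd (ends (fst d)))"

definition dart_head :: "('e \<Rightarrow> 'v \<times> 'v) \<Rightarrow> 'e \<times> bool \<Rightarrow> 'v" where
  "dart_head ends d = (if snd d then snd (ends (fst d)) else fst (ends (fst d)))"

fun walk :: "('e \<Rightarrow> 'v \<times> 'v) \<Rightarrow> 'v \<Rightarrow> ('e \<times> bool) list \<Rightarrow> 'v \<Rightarrow> bool" where
  "walk ends u [] v \<longleftrightarrow> u = v"
| "walk ends u (d # ds) v \<longleftrightarrow> dart_tail ends d = u \<and> walk ends (dart_head ends d) ds v"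

definition trail :: "'e set \<Rightarrow> ('e \<Rightarrow> 'v \<times> 'v) \<Rightarrow> 'v \<Rightarrow> ('e \<times> bool) list \<Rightarrow> 'v \<Rightarrow> bool" where
  "trail F ends u ds v \<longleftrightarrow> walk ends u ds v \<and> distinct (map fst ds) \<and> fst ` set ds \<subseteq> F"

lemma walk_append: "walk ends u (xs @ ys) w \<longleftrightarrow> (\<exists>v. walk ends u xs v \<and> walk ends v ys w)"
  by (induction xs arbitrary: u) auto

lemma walk_vdeg:
  "walk ends u ds v \<Longrightarrow> distinct (map fst ds) \<Longrightarrow>
    even (vdeg (fst ` set ds) ends x - (of_bool (x = u) + of_bool (x = v)))"
proof (induction ds arbitrary: u)
  case (Cons d ds)
  let ?h = "dart_head ends d"
  have IH: "even (vdeg (fst ` set ds) ends x - (of_bool (x = ?h) + of_bool (x = v)))"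
    using Cons by simp
  have tail: "dart_tail ends d = u" using Cons.prems(1) by simp
  have "vdeg (fst ` set (d # ds)) ends x
      = of_bool (fst (ends (fst d)) = x) + of_bool (snd (ends (fst d)) = x) + vdeg (fst ` set ds) ends x"
    unfolding list.set image_insert by (rule vdeg_insert) (use Cons.prems(2) in auto)
  also have "of_bool (fst (ends (fst d)) = x) + of_bool (snd (ends (fst d)) = x)
      = (of_bool (x = u) + of_bool (x = ?h) :: int)"
    using tail unfolding dart_tail_def dart_head_def
    by (cases "snd d") (simp_all add: eq_commute[of x])
  finally have "vdeg (fst ` set (d # ds)) ends x - (of_bool (x = u) + of_bool (x = v))
      = (vdeg (fst ` set ds) ends x - (of_bool (x = ?h) + of_bool (x = v))) + 2 * of_bool (x = ?h)"
    by simp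
  then show ?case using dvd_add[OF IH dvd_triv_left] by (simp only:)
qed (simp add: vdeg_empty)

lemma walk_split:
  assumes "walk ends u ds v" "d \<in> set ds" "x = fst (ends (fst d)) \<or> x = snd (ends (fst d))"
  shows "\<exists>xs ys. ds = xs @ ys \<and> walk ends u xs x \<and> walk ends x ys v"
proof -
  obtain xs ys where ds: "ds = xs @ d # ys" using split_list[OF assms(2)] by blast
  then have "walk ends u xs (dart_tail ends d)" "walk ends (dart_head ends d) ys v"
    using assms(1) by (auto simp: walk_append)
  moreover have "x = dart_tail ends d \<or> x = dart_head ends d"
    using assms(3) unfolding dart_tail_def dart_head_def by auto
  ultimately show ?thesis
  proof (elim disjE)
    assume "x = dart_tail ends d" "walk ends u xs (dart_tail ends d)" "walk ends (dart_head ends d) ys v"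
    then show ?thesis using ds by (intro exI[of _ xs] exI[of _ "d # ys"]) simp
  next
    assume "x = dart_head ends d" "walk ends u xs (dart_tail ends d)" "walk ends (dart_head ends d) ys v"
    then show ?thesis using ds by (intro exI[of _ "xs @ [d]"] exI[of _ ys]) (simp add: walk_append)
  qed
qed

lemma trail_extend:
  assumes "trail F ends u ds v" "e \<in> F" "e \<notin> fst ` set ds" "fst (ends e) = v \<or> snd (ends e) = v"
  shows "\<exists>d w. trail F ends u (ds @ [d]) w"
proof -
  define d where "d = (e, fst (ends e) = v)"
  have "dart_tail ends d = v" unfolding d_def dart_tail_def using assms(4) by auto
  then have "trail F ends u (ds @ [d]) (dart_head ends d)"
    using assms(1-3) unfolding trail_def walk_append by (auto simp: d_def)
  then show ?thesis by blast
qed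

theorem euler_trail:
  assumes "finite V" "finite F" "V \<noteq> {}"
    and ends: "\<And>e. e \<in> F \<Longrightarrow> fst (ends e) \<in> V \<and> snd (ends e) \<in> V"
    and conn: "\<And>X. X \<subseteq> V \<Longrightarrow> X \<noteq> {} \<Longrightarrow> X \<noteq> V \<Longrightarrow> crossing F ends X \<noteq> {}"
    and even_deg: "\<And>v. v \<in> V \<Longrightarrow> even (vdeg F ends v)"
  shows "\<exists>u\<in>V. \<exists>ds. walk ends u ds u \<and> distinct (map fst ds) \<and> fst ` set ds = F"
proof -
  let ?P = "\<lambda>(u, ds, v). u \<in> V \<and> trail F ends u ds v"
  obtain u0 where "u0 \<in> V" using assms(3) by blast
  then have "?P (u0, [], u0)" by (simp add: trail_def)
  moreover have "\<forall>t. ?P t \<longrightarrow> length (fst (snd t)) < Suc (card F)"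
  proof (intro allI impI)
    fix t assume "?P t"
    then obtain u ds v where t: "t = (u, ds, v)" "trail F ends u ds v" by (cases t) auto
    have "length ds = card (fst ` set ds)"
      using t(2) distinct_card[of "map fst ds"] unfolding trail_def by simp
    also have "\<dots> \<le> card F" using t(2) card_mono[OF assms(2)] unfolding trail_def by blast
    finally show "length (fst (snd t)) < Suc (card F)" using t(1) by simp
  qed
  ultimately obtain t where t: "?P t" "\<And>t'. ?P t' \<Longrightarrow> length (fst (snd t')) \<le> length (fst (snd t))"
    using ex_has_greatest_nat[of ?P _ "\<lambda>t. length (fst (snd t))"] by blast
  obtain u ds v where t_eq: "t = (u, ds, v)" by (cases t) auto
  have uV: "u \<in> V" and tr: "trail F ends u ds v" using t(1) unfolding t_eq by auto
  have longest: "length ds' \<le> length ds" if "u' \<in> V" "trail F ends u' ds' v'" for u' ds' v'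
    using t(2)[of "(u', ds', v')"] that unfolding t_eq by simp
  let ?S = "fst ` set ds"
  have S: "?S \<subseteq> F" "finite ?S" and walk: "walk ends u ds v" and dist: "distinct (map fst ds)"
    using tr unfolding trail_def by auto
  have vV: "v \<in> V"
  proof (cases ds rule: rev_cases)
    case Nil
    then show ?thesis using walk uV by simp
  next
    case (snoc xs d)
    then have "v = dart_head ends d" "fst d \<in> F" using walk S(1) by (auto simp: walk_append)
    then show ?thesis using ends unfolding dart_head_def by simp
  qed
  have "u = v"
  proof (rule ccontr)
    assume "u \<noteq> v"
    then have "odd (vdeg ?S ends v)" using walk_vdeg[OF walk dist, of v] by simp
    moreover have "vdeg (?S \<union> (F - ?S)) ends v = vdeg ?S ends v + vdeg (F - ?S) ends v"
      by (rule vdeg_Un) (use S assms(2) in auto)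
    moreover have "?S \<union> (F - ?S) = F" using S(1) by blast
    ultimately have "vdeg (F - ?S) ends v \<noteq> 0" using even_deg[OF vV] by auto
    then obtain e where "e \<in> F - ?S" "of_bool (fst (ends e) = v) + of_bool (snd (ends e) = v) \<noteq> (0 :: int)"
      unfolding vdeg_def by (rule sum.not_neutral_contains_not_neutral)
    then have e: "e \<in> F" "e \<notin> ?S" "fst (ends e) = v \<or> snd (ends e) = v" by (auto split: if_splits)
    then obtain d w where "trail F ends u (ds @ [d]) w" using trail_extend[OF tr] by blast
    then show False using longest[OF uV] by fastforce
  qed
  have "?S = F"
  proof (rule ccontr)
    assume ne: "?S \<noteq> F"
    define X where "X = insert u (\<Union>e\<in>?S. {fst (ends e), snd (ends e)})"
    have XV: "X \<subseteq> V" unfolding X_def using uV ends S(1) by auto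
    have "\<exists>e\<in>F - ?S. fst (ends e) \<in> X \<or> snd (ends e) \<in> X"
    proof (cases "X = V")
      case True
      then show ?thesis using ne S(1) ends by blast
    next
      case False
      then have "crossing F ends X \<noteq> {}" using conn[OF XV] unfolding X_def by blast
      then obtain e where "e \<in> F" "(fst (ends e) \<in> X) \<noteq> (snd (ends e) \<in> X)"
        unfolding crossing_def by blast
      moreover from this have "e \<notin> ?S" unfolding X_def by blast
      ultimately show ?thesis by blast
    qed
    then obtain e x where e: "e \<in> F" "e \<notin> ?S" "x \<in> X" "fst (ends e) = x \<or> snd (ends e) = x" by blast
    have "\<exists>xs ys. ds = xs @ ys \<and> walk ends u xs x \<and> walk ends x ys u"
    proof (cases "x = u")
      case True
      then show ?thesis using walk \<open>u = v\<close> by (intro exI[of _ "[]"] exI[of _ ds]) simp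
    next
      case False
      then obtain d where "d \<in> set ds" "x = fst (ends (fst d)) \<or> x = snd (ends (fst d))"
        using e(3) unfolding X_def by auto
      then show ?thesis using walk_split[OF walk] \<open>u = v\<close> by blast
    qed
    then obtain xs ys where xy: "ds = xs @ ys" "walk ends u xs x" "walk ends x ys u" by blast
    have "walk ends x (ys @ xs) x" unfolding walk_append using xy(2,3) by blast
    moreover have "distinct (map fst (ys @ xs))" using dist unfolding xy(1) by auto
    moreover have "fst ` set (ys @ xs) \<subseteq> F" using S(1) unfolding xy(1) by auto
    ultimately have "trail F ends x (ys @ xs) x" unfolding trail_def by blast
    moreover have "e \<notin> fst ` set (ys @ xs)" using e(2) xy(1) by auto
    ultimately obtain d w where "trail F ends x ((ys @ xs) @ [d]) w"
      using trail_extend[of F ends x "ys @ xs" x e] e(1,4) by blast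
    moreover have "x \<in> V" using XV e(3) by blast
    ultimately have "length ((ys @ xs) @ [d]) \<le> length ds" using longest by blast
    then show False using xy(1) by simp
  qed
  then show ?thesis using walk dist uV \<open>u = v\<close> by blast
qed

text \<open>The boundary for the reference orientation with \<open>\<tau>1 e = 1\<close> and
  \<open>\<tau>2 e = - \<sigma> e\<close>; every other orientation is expressed by the signs of
  \<open>f\<close>.\<close>

definition signed_netflow ::
    "'e set \<Rightarrow> ('e \<Rightarrow> 'v \<times> 'v) \<Rightarrow> ('e \<Rightarrow> int) \<Rightarrow> ('e \<Rightarrow> int) \<Rightarrow> 'v \<Rightarrow> int" where
  "signed_netflow E ends \<sigma> f v =
    (\<Sum>e\<in>E. f e * of_bool (fst (ends e) = v) - \<sigma> e * f e * of_bool (snd (ends e) = v))"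

text \<open>Along a walk the value is passed on unchanged, up to the sign of the edges traversed.\<close>

lemma alternating_walk:
  assumes "walk ends u ds v" "distinct (map fst ds)" "\<And>e. e \<in> fst ` set ds \<Longrightarrow> \<sigma> e = 1 \<or> \<sigma> e = -1"
    and "c = 1 \<or> c = (-1 :: int)"
  shows "\<exists>h c'. (\<forall>e\<in>fst ` set ds. h e = 1 \<or> h e = -1) \<and> (c' = 1 \<or> c' = -1) \<and>
    (\<forall>x. signed_netflow (fst ` set ds) ends \<sigma> h x = c * of_bool (x = u) - c' * of_bool (x = v))"
  using assms
proof (induction ds arbitrary: u c)
  case Nil
  then show ?case unfolding signed_netflow_def by (intro exI[of _ "\<lambda>_. 1"] exI[of _ c]) simp
next
  case (Cons d ds)
  define e where "e = fst d"
  have \<sigma>: "\<sigma> e = 1 \<or> \<sigma> e = -1" using Cons.prems(3)[of e] unfolding e_def by simp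
  have e: "e \<notin> fst ` set ds" using Cons.prems(2) unfolding e_def by simp
  have "\<sigma> e * c = 1 \<or> \<sigma> e * c = -1" using \<sigma> Cons.prems(4) by auto
  then obtain h c' where h: "\<forall>e\<in>fst ` set ds. h e = 1 \<or> h e = -1" "c' = 1 \<or> c' = -1"
    "\<And>x. signed_netflow (fst ` set ds) ends \<sigma> h x
      = \<sigma> e * c * of_bool (x = dart_head ends d) - c' * of_bool (x = v)"
    using Cons.IH[of "dart_head ends d" "\<sigma> e * c"] Cons.prems by auto
  \<comment> \<open>In both directions of traversal the edge contributes \<open>c\<close> at its
    tail and \<open>- \<sigma> e * c\<close> at its head, which the rest of the walk cancels by
    starting with \<open>\<sigma> e * c\<close>.\<close>
  define b where "b = (if snd d then c else - \<sigma> e * c)"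
  have square: "\<sigma> e * \<sigma> e = 1" using \<sigma> by auto
  have "dart_tail ends d = u" using Cons.prems(1) by simp
  then have dir: "fst (ends e) = u \<and> snd (ends e) = dart_head ends d \<and> b = c \<or>
      snd (ends e) = u \<and> fst (ends e) = dart_head ends d \<and> b = - \<sigma> e * c"
    unfolding b_def dart_tail_def dart_head_def e_def by (cases "snd d") simp_all
  have "signed_netflow (fst ` set (d # ds)) ends \<sigma> (h(e := b)) x
      = c * of_bool (x = u) - c' * of_bool (x = v)" for x
  proof -
    have "signed_netflow (fst ` set (d # ds)) ends \<sigma> (h(e := b)) x
        = b * of_bool (fst (ends e) = x) - \<sigma> e * b * of_bool (snd (ends e) = x)
          + signed_netflow (fst ` set ds) ends \<sigma> (h(e := b)) x"
      unfolding signed_netflow_def list.set image_insert e_def[symmetric]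
      by (subst sum.insert) (use e in auto)
    also have "signed_netflow (fst ` set ds) ends \<sigma> (h(e := b)) x = signed_netflow (fst ` set ds) ends \<sigma> h x"
      unfolding signed_netflow_def by (rule sum.cong) (use e in auto)
    also have "b * of_bool (fst (ends e) = x) - \<sigma> e * b * of_bool (snd (ends e) = x)
        = c * of_bool (x = u) - \<sigma> e * c * of_bool (x = dart_head ends d)"
      using dir by (elim disjE conjE) (simp_all add: eq_commute[of x] square flip: mult.assoc)
    finally show ?thesis unfolding h(3) by linarith
  qed
  moreover have "\<forall>e'\<in>fst ` set (d # ds). (h(e := b)) e' = 1 \<or> (h(e := b)) e' = -1"
    using h(1) \<sigma> Cons.prems(4) unfolding b_def e_def by auto
  ultimately show ?case using h(2) by blast
qed

section \<open>Signed graphs\<close>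

lemma sum_signed_netflow:
  assumes "finite X"
  shows "(\<Sum>v\<in>X. signed_netflow E ends \<sigma> f v) =
    (\<Sum>e\<in>E. f e * of_bool (fst (ends e) \<in> X) - \<sigma> e * f e * of_bool (snd (ends e) \<in> X))"
proof -
  have "(\<Sum>v\<in>X. signed_netflow E ends \<sigma> f v)
      = (\<Sum>e\<in>E. \<Sum>v\<in>X. f e * of_bool (fst (ends e) = v) - \<sigma> e * f e * of_bool (snd (ends e) = v))"
    unfolding signed_netflow_def by (rule sum.swap)
  also have "\<dots> = (\<Sum>e\<in>E. f e * of_bool (fst (ends e) \<in> X) - \<sigma> e * f e * of_bool (snd (ends e) \<in> X))"
    using assms by (simp only: sum_subtractf sum_distrib_left[symmetric] eq_commute[of "fst _"]
        eq_commute[of "snd _"] sum_of_bool_eq)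
  finally show ?thesis .
qed

lemma signed_netflow_Un: "finite A \<Longrightarrow> finite B \<Longrightarrow> A \<inter> B = {} \<Longrightarrow>
    signed_netflow (A \<union> B) ends \<sigma> f v = signed_netflow A ends \<sigma> f v + signed_netflow B ends \<sigma> f v"
  unfolding signed_netflow_def by (rule sum.union_disjoint)

lemma signed_netflow_cong: "(\<And>e. e \<in> E \<Longrightarrow> f e = g e) \<Longrightarrow>
    signed_netflow E ends \<sigma> f v = signed_netflow E ends \<sigma> g v"
  unfolding signed_netflow_def by (intro sum.cong) simp_all

lemma signed_netflow_positive:
  assumes "\<And>e. e \<in> E \<Longrightarrow> \<sigma> e = 1"
  shows "signed_netflow E ends \<sigma> f v = netflow E ends f v"
  unfolding signed_netflow_def netflow_def
  by (rule sum.cong) (use assms in \<open>simp_all add: right_diff_distrib\<close>)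

text \<open>In the flow with values k and k+1 without demands, no cut is crossed by fewer than two edges
  in either direction.\<close>

lemma two_spanning_connected:
  assumes "k > 0" "finite V" "finite E" "V \<noteq> {}"
    and ends: "\<And>e. e \<in> E \<Longrightarrow> fst (ends e) \<in> V \<and> snd (ends e) \<in> V"
    and cuts: "\<And>X. X \<subseteq> V \<Longrightarrow> X \<noteq> {} \<Longrightarrow> X \<noteq> V \<Longrightarrow> 6 * k \<le> card (crossing E ends X)"
  shows "\<exists>T\<subseteq>E. \<forall>X. X \<subseteq> V \<and> X \<noteq> {} \<and> X \<noteq> V \<longrightarrow> crossing T ends X \<noteq> {} \<and> crossing (E - T) ends X \<noteq> {}"
proof -
  obtain f where f: "\<forall>e\<in>E. \<bar>f e\<bar> = int k \<or> \<bar>f e\<bar> = int k + 1" "\<forall>v\<in>V. netflow E ends f v = 0"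
    using exact_flow[OF assms(1-3) ends cuts, of "\<lambda>_. 0"] by auto
  define ends' where "ends' e = (if f e > 0 then ends e else (snd (ends e), fst (ends e)))" for e
  have crossing: "crossing A ends' X = crossing A ends X" for A X
    unfolding crossing_def by (intro Collect_cong) (auto simp: ends'_def)
  obtain r where r: "r \<in> V" using assms(4) by blast
  have two: "2 \<le> din E ends' X" if X: "X \<subseteq> V - {r}" "X \<noteq> {}" for X
  proof -
    have XV: "X \<subseteq> V" "X \<noteq> V" using X r by auto
    have fin: "finite X" using XV(1) assms(2) finite_subset by blast
    let ?out = "\<lambda>e. of_bool (fst (ends' e) \<in> X \<and> snd (ends' e) \<notin> X) :: int"
    let ?in = "\<lambda>e. of_bool (snd (ends' e) \<in> X \<and> fst (ends' e) \<notin> X) :: int"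
    have "(\<Sum>e\<in>E. f e * (of_bool (fst (ends e) \<in> X) - of_bool (snd (ends e) \<in> X))) = 0"
      using sum_netflow[OF fin, of E ends f] f(2) XV(1) by (auto simp: subset_iff)
    moreover have "f e * (of_bool (fst (ends e) \<in> X) - of_bool (snd (ends e) \<in> X))
        = \<bar>f e\<bar> * ?out e - \<bar>f e\<bar> * ?in e" for e
      by (auto simp: ends'_def)
    ultimately have eq: "(\<Sum>e\<in>E. \<bar>f e\<bar> * ?out e) = (\<Sum>e\<in>E. \<bar>f e\<bar> * ?in e)"
      by (simp only: sum_subtractf)
    have "int k * dout E ends' X \<le> (\<Sum>e\<in>E. \<bar>f e\<bar> * ?out e)"
      unfolding dout_def sum_distrib_left by (intro sum_mono mult_right_mono) (use f(1) in force)+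
    moreover have "(\<Sum>e\<in>E. \<bar>f e\<bar> * ?in e) \<le> (int k + 1) * din E ends' X"
      unfolding din_def sum_distrib_left by (intro sum_mono mult_right_mono) (use f(1) in force)+
    ultimately have le: "int k * dout E ends' X \<le> (int k + 1) * din E ends' X" using eq by linarith
    have sum6: "6 * int k \<le> dout E ends' X + din E ends' X"
      using cuts[OF XV(1) X(2) XV(2)] card_crossing[OF assms(3), of ends' X] unfolding crossing by linarith
    show ?thesis
    proof (rule ccontr)
      assume "\<not> ?thesis"
      \<comment> \<open>At least \<open>6k - 1\<close> edges would leave \<open>X\<close>, hence at
        least 5, with value at least \<open>k\<close> each, against an inflow of at most
        \<open>k + 1\<close>.\<close>
      then have "din E ends' X \<le> 1" "5 \<le> dout E ends' X" using sum6 assms(1) by linarith+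
      then have *: "(int k + 1) * din E ends' X \<le> (int k + 1) * 1" "int k * 5 \<le> int k * dout E ends' X"
        by (intro mult_left_mono; simp)+
      have "int k * 5 \<le> (int k + 1) * 1" by (rule order_trans[OF *(2) order_trans[OF le *(1)]])
      then show False using assms(1) by simp
    qed
  qed
  have "\<exists>T\<subseteq>E. \<forall>X. X \<subseteq> V - {r} \<and> X \<noteq> {} \<longrightarrow> 0 < din T ends' X \<and> 0 < din (E - T) ends' X"
    by (rule two_branchings[OF assms(2,3) r _ two]) (use ends in \<open>auto simp: ends'_def\<close>)
  then obtain T where T: "T \<subseteq> E"
    "\<forall>X. X \<subseteq> V - {r} \<and> X \<noteq> {} \<longrightarrow> 0 < din T ends' X \<and> 0 < din (E - T) ends' X" by blast
  have fin: "finite T" "finite (E - T)" using finite_subset[OF T(1) assms(3)] assms(3) by simp_all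
  have nonempty: "crossing A ends X \<noteq> {}" if A: "finite A" "0 < din A ends' X" for A X
  proof -
    obtain e where "e \<in> A" "snd (ends' e) \<in> X \<and> fst (ends' e) \<notin> X"
      using A(2) unfolding din_pos_iff[OF A(1)] by blast
    then have "e \<in> crossing A ends' X" unfolding crossing_def by blast
    then show ?thesis unfolding crossing by blast
  qed
  have compl: "crossing A ends (V - X) = crossing A ends X" if "A \<subseteq> E" for A X
    unfolding crossing_def by (intro Collect_cong conj_cong refl) (use ends that in auto)
  have "crossing T ends X \<noteq> {} \<and> crossing (E - T) ends X \<noteq> {}"
    if X: "X \<subseteq> V" "X \<noteq> {}" "X \<noteq> V" for X
  proof (cases "r \<in> X")
    case False
    then have "X \<subseteq> V - {r}" using X(1) by blast
    then show ?thesis using T(2) X(2) nonempty[OF fin(1)] nonempty[OF fin(2)] by simp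
  next
    case True
    then have "V - X \<subseteq> V - {r}" "V - X \<noteq> {}" using X by auto
    then have "crossing T ends (V - X) \<noteq> {} \<and> crossing (E - T) ends (V - X) \<noteq> {}"
      using T(2) nonempty[OF fin(1)] nonempty[OF fin(2)] by simp
    then show ?thesis using compl[OF T(1), of X] compl[of "E - T" X] by simp
  qed
  then show ?thesis using T(1) by blast
qed

text \<open>Values 1 and -1 along an Euler trail of N and J, where J contains a spanning connected
  subgraph and corrects the parities of the degrees.\<close>

lemma balanced_signing:
  assumes "k > 0" "finite V" "finite E" "V \<noteq> {}"
    and ends: "\<And>e. e \<in> E \<Longrightarrow> fst (ends e) \<in> V \<and> snd (ends e) \<in> V"
    and sign: "\<And>e. e \<in> E \<Longrightarrow> \<sigma> e = 1 \<or> \<sigma> e = -1"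
    and cuts: "\<And>X. X \<subseteq> V \<Longrightarrow> X \<noteq> {} \<Longrightarrow> X \<noteq> V \<Longrightarrow> 6 * k \<le> card (crossing {e\<in>E. \<sigma> e = 1} ends X)"
  shows "\<exists>J h u c. J \<subseteq> {e\<in>E. \<sigma> e = 1} \<and>
    (\<forall>e\<in>{e\<in>E. \<sigma> e = -1} \<union> J. h e = 1 \<or> h e = (-1 :: int)) \<and>
    u \<in> V \<and> (c = 0 \<or> c = 2 \<or> c = (-2 :: int)) \<and>
    (\<forall>v. signed_netflow ({e\<in>E. \<sigma> e = -1} \<union> J) ends \<sigma> h v = c * of_bool (v = u))"
proof -
  define P N where PN: "P = {e\<in>E. \<sigma> e = 1}" "N = {e\<in>E. \<sigma> e = -1}"
  have fin: "finite P" "finite N" unfolding PN using assms(3) by auto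
  have endsP: "\<And>e. e \<in> P \<Longrightarrow> fst (ends e) \<in> V \<and> snd (ends e) \<in> V" using ends unfolding PN by blast
  obtain T where T: "T \<subseteq> P" "\<forall>X. X \<subseteq> V \<and> X \<noteq> {} \<and> X \<noteq> V \<longrightarrow>
      crossing T ends X \<noteq> {} \<and> crossing (P - T) ends X \<noteq> {}"
    using two_spanning_connected[OF assms(1,2) fin(1) assms(4) endsP cuts[folded PN]] by blast
  have finT: "finite T" using T(1) fin(1) finite_subset by blast
  have "even (sum (vdeg (N \<union> T) ends) V)"
    by (rule even_sum_vdeg[OF assms(2)]) (use ends T(1) PN in blast)
  moreover have "crossing (P - T) ends X \<noteq> {}" if "X \<subseteq> V" "X \<noteq> {}" "X \<noteq> V" for X
    using T(2) that by simp
  ultimately have "\<exists>K\<subseteq>P - T. \<forall>v\<in>V. even (vdeg K ends v - vdeg (N \<union> T) ends v)"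
    by (intro parity_join[OF assms(2)]) (use fin(1) endsP in auto)
  then obtain K where K: "K \<subseteq> P - T" "\<forall>v\<in>V. even (vdeg K ends v - vdeg (N \<union> T) ends v)"
    by blast
  have finK: "finite K" using K(1) fin(1) finite_subset by blast
  define J where "J = T \<union> K"
  let ?F = "N \<union> J"
  have J: "J \<subseteq> P" unfolding J_def using T(1) K(1) by blast
  have FE: "?F \<subseteq> E" using J unfolding PN by blast
  have finF: "finite ?F" using FE assms(3) finite_subset by blast
  have F_eq: "?F = (N \<union> T) \<union> K" "(N \<union> T) \<inter> K = {}" using K(1) unfolding J_def PN by auto
  have even_F: "even (vdeg ?F ends v)" if "v \<in> V" for v
  proof -
    have "vdeg ?F ends v = vdeg (N \<union> T) ends v + vdeg K ends v"
      unfolding F_eq(1) by (rule vdeg_Un) (use fin finT finK F_eq(2) in auto)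
    then show ?thesis using K(2) that by auto
  qed
  have conn_F: "crossing ?F ends X \<noteq> {}" if "X \<subseteq> V" "X \<noteq> {}" "X \<noteq> V" for X
  proof -
    have "crossing T ends X \<subseteq> crossing ?F ends X" unfolding crossing_def J_def by blast
    then show ?thesis using T(2) that by auto
  qed
  have ends_F: "\<And>e. e \<in> ?F \<Longrightarrow> fst (ends e) \<in> V \<and> snd (ends e) \<in> V" using ends FE by blast
  obtain u ds where ds: "u \<in> V" "walk ends u ds u" "distinct (map fst ds)" "fst ` set ds = ?F"
    using euler_trail[OF assms(2) finF assms(4) ends_F conn_F even_F] by blast
  have signF: "\<And>e. e \<in> fst ` set ds \<Longrightarrow> \<sigma> e = 1 \<or> \<sigma> e = -1" using ds(4) FE sign by blast
  have "\<exists>h c'. (\<forall>e\<in>?F. h e = 1 \<or> h e = -1) \<and> (c' = 1 \<or> c' = -1) \<and>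
      (\<forall>x. signed_netflow ?F ends \<sigma> h x = 1 * of_bool (x = u) - c' * of_bool (x = u))"
    by (rule alternating_walk[OF ds(2,3) signF, unfolded ds(4)]) simp_all
  then obtain h c' where h: "\<forall>e\<in>?F. h e = 1 \<or> h e = -1" "c' = 1 \<or> c' = -1"
    "\<forall>x. signed_netflow ?F ends \<sigma> h x = 1 * of_bool (x = u) - c' * of_bool (x = u)"
    by (elim exE conjE)
  \<comment> \<open>The signs at the start and at the end of the closed trail may disagree; the
    defect, 0 or 2, sits at the vertex \<open>u\<close> where it starts.\<close>
  have "\<forall>v. signed_netflow ?F ends \<sigma> h v = (1 - c') * of_bool (v = u)"
    unfolding left_diff_distrib by (rule h(3))
  moreover have "1 - c' = 0 \<or> 1 - c' = 2 \<or> 1 - c' = -2" using h(2) by auto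
  ultimately show ?thesis
    unfolding PN[symmetric] using J h(1) ds(1)
    by (intro exI[of _ J] exI[of _ h] exI[of _ u] exI[of _ "1 - c'"] conjI)
qed

text \<open>For \<open>H\<close> of modulus 1 the number of edges is odd, hence at least
  \<open>2k + 1\<close>, and just under half of them, at least \<open>k\<close>, carry
  \<open>- H\<close>. Raising \<open>k\<close> of these from \<open>k\<close> to
  \<open>k + 1\<close> in modulus takes the sum from \<open>k * H\<close> to 0.\<close>

lemma exists_negative_values:
  assumes "finite N" and h: "\<And>e. e \<in> N \<Longrightarrow> h e = 1 \<or> h e = (-1 :: int)"
    and H: "sum h N = H" "H = 0 \<or> H = 1 \<or> H = -1" and N: "even (card N) \<or> 2 * k + 1 \<le> card N"
  shows "\<exists>S\<subseteq>N. (\<forall>e\<in>S. h e = - H) \<and> int (card S) = int k * \<bar>H\<bar>"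
proof (cases "H = 0")
  case True
  then show ?thesis by (intro exI[of _ "{}"]) simp
next
  case False
  define B where "B = {e\<in>N. h e = - H}"
  have "B \<subseteq> N" unfolding B_def by blast
  then have finB: "finite B" using assms(1) finite_subset by blast
  have HH: "H * H = 1" using H(2) False by auto
  have "h e = H * (1 - 2 * of_bool (e \<in> B))" if "e \<in> N" for e
    using h[OF that] that H(2) False unfolding B_def by auto
  then have "sum h N = (\<Sum>e\<in>N. H * (1 - 2 * of_bool (e \<in> B)))" by (intro sum.cong) auto
  also have "\<dots> = H * (int (card N) - 2 * (\<Sum>e\<in>N. of_bool (e \<in> B)))"
    by (simp add: sum_distrib_left[symmetric] sum_subtractf)
  also have "(\<Sum>e\<in>N. of_bool (e \<in> B)) = int (card B)"
    using assms(1) \<open>B \<subseteq> N\<close> by (simp add: of_bool_def sum.If_cases Int_absorb1)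
  finally have "H = H * (int (card N) - 2 * int (card B))" using H(1) by simp
  then have "int (card N) - 2 * int (card B) = 1"
    using False by (metis mult_cancel_left mult.right_neutral)
  then have "k \<le> card B" using N by presburger
  then obtain S where "S \<subseteq> B" "card S = k" using obtain_subset_with_card_n by metis
  moreover have "\<bar>H\<bar> = 1" using H(2) False by auto
  ultimately show ?thesis using \<open>B \<subseteq> N\<close> unfolding B_def by (intro exI[of _ S]) auto
qed

theorem signed_exact_flow:
  assumes "k > 0" "finite V" "finite E"
    and ends: "\<And>e. e \<in> E \<Longrightarrow> fst (ends e) \<in> V \<and> snd (ends e) \<in> V"
    and sign: "\<And>e. e \<in> E \<Longrightarrow> \<sigma> e = 1 \<or> \<sigma> e = -1"
    and cuts: "\<And>X. X \<subseteq> V \<Longrightarrow> X \<noteq> {} \<Longrightarrow> X \<noteq> V \<Longrightarrow> 6 * k \<le> card (crossing {e\<in>E. \<sigma> e = 1} ends X)"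
    and unbalanced: "even (card {e\<in>E. \<sigma> e = -1}) \<or> 2 * k + 1 \<le> card {e\<in>E. \<sigma> e = -1}"
  shows "\<exists>f. (\<forall>e\<in>E. \<bar>f e\<bar> = int k \<or> \<bar>f e\<bar> = int k + 1) \<and> (\<forall>v\<in>V. signed_netflow E ends \<sigma> f v = 0)"
proof (cases "V = {}")
  case True
  then have "E = {}" using ends by blast
  then show ?thesis using True by simp
next
  case False
  define P N where PN: "P = {e\<in>E. \<sigma> e = 1}" "N = {e\<in>E. \<sigma> e = -1}"
  have fin: "finite P" "finite N" unfolding PN using assms(3) by auto
  have endsP: "\<And>e. e \<in> P \<Longrightarrow> fst (ends e) \<in> V \<and> snd (ends e) \<in> V"
    and endsN: "\<And>e. e \<in> N \<Longrightarrow> fst (ends e) \<in> V \<and> snd (ends e) \<in> V" using ends unfolding PN by blast+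
  have "\<exists>J h u c. J \<subseteq> P \<and> (\<forall>e\<in>N \<union> J. h e = 1 \<or> h e = (-1 :: int)) \<and>
    u \<in> V \<and> (c = 0 \<or> c = 2 \<or> c = (-2 :: int)) \<and>
    (\<forall>v. signed_netflow (N \<union> J) ends \<sigma> h v = c * of_bool (v = u))"
    unfolding PN by (rule balanced_signing[OF assms(1-3) False ends sign cuts])
  then obtain J h u c where "J \<subseteq> P" "\<forall>e\<in>N \<union> J. h e = 1 \<or> h e = (-1 :: int)" "u \<in> V"
    "c = 0 \<or> c = 2 \<or> c = (-2 :: int)"
    "\<forall>v. signed_netflow (N \<union> J) ends \<sigma> h v = c * of_bool (v = u)"
    by (elim exE conjE)
  note J = this(1) and h = bspec[OF this(2)] and u = this(3) and c = this(4) and net = spec[OF this(5)]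
  have finJ: "finite J" using J fin(1) finite_subset by blast
  have net_N: "signed_netflow N ends \<sigma> h v = c * of_bool (v = u) - signed_netflow J ends \<sigma> h v" for v
    using net[of v] signed_netflow_Un[OF fin(2) finJ, of ends \<sigma> h v] J unfolding PN by fastforce
  define H where "H = sum h N"
  have "2 * H = c"
  proof -
    have "(\<Sum>v\<in>V. signed_netflow N ends \<sigma> h v) = 2 * H"
      unfolding sum_signed_netflow[OF assms(2)] H_def sum_distrib_left
      by (rule sum.cong) (use endsN PN in auto)
    moreover have "(\<Sum>v\<in>V. signed_netflow J ends \<sigma> h v) = 0"
      unfolding sum_signed_netflow[OF assms(2)]
      by (rule sum.neutral) (use endsP J PN in auto)
    moreover have "(\<Sum>v\<in>V. c * of_bool (v = u)) = c"
      using sum_of_bool_eq[OF assms(2), of u] u by (simp flip: sum_distrib_left)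
    ultimately show ?thesis using net_N by (simp add: sum_subtractf)
  qed
  then have H: "H = 0 \<or> H = 1 \<or> H = -1" using c by auto
  obtain S where S: "S \<subseteq> N" "\<forall>e\<in>S. h e = - H" "int (card S) = int k * \<bar>H\<bar>"
    using exists_negative_values[OF fin(2) _ H_def[symmetric] H, of k] h unbalanced unfolding PN by blast
  define g where "g e = int k * h e + of_bool (e \<in> S) * h e" for e
  define b where "b v = - signed_netflow N ends \<sigma> g v" for v
  \<comment> \<open>By \<open>net_N\<close>, the part \<open>k * h\<close> of \<open>g\<close> has,
    up to sign, the boundary of \<open>k * h\<close> on \<open>J\<close> and a defect at
    \<open>u\<close>. The rest is \<open>H\<close> times the difference of two numbers between 0 and
    \<open>2k\<close>: the defect, if \<open>u\<close> is in \<open>X\<close>, and the number of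
    ends in \<open>X\<close> of raised edges. This is the error term \<open>2k\<close> granted by
    \<open>exact_flow\<close>.\<close>
  have sum_b: "sum b X = int k * (\<Sum>v\<in>X. signed_netflow J ends \<sigma> h v)
      - H * (2 * int k * of_bool (u \<in> X) - (\<Sum>e\<in>S. of_bool (fst (ends e) \<in> X) + of_bool (snd (ends e) \<in> X)))"
    if "X \<subseteq> V" for X
  proof -
    have finX: "finite X" using that assms(2) finite_subset by blast
    have "signed_netflow N ends \<sigma> g v = int k * signed_netflow N ends \<sigma> h v
        + signed_netflow N ends \<sigma> (\<lambda>e. of_bool (e \<in> S) * h e) v" for v
      unfolding signed_netflow_def g_def sum_distrib_left sum.distrib[symmetric]
      by (rule sum.cong) (auto simp: algebra_simps)
    then have "sum b X = - (int k * (\<Sum>v\<in>X. signed_netflow N ends \<sigma> h v)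
        + (\<Sum>v\<in>X. signed_netflow N ends \<sigma> (\<lambda>e. of_bool (e \<in> S) * h e) v))"
      unfolding b_def by (simp add: sum_negf sum.distrib sum_distrib_left sum_subtractf)
    moreover have "(\<Sum>v\<in>X. signed_netflow N ends \<sigma> (\<lambda>e. of_bool (e \<in> S) * h e) v)
        = - H * (\<Sum>e\<in>S. of_bool (fst (ends e) \<in> X) + of_bool (snd (ends e) \<in> X))"
      unfolding sum_signed_netflow[OF finX] sum_distrib_left
      by (rule sum.mono_neutral_cong_right[OF fin(2) S(1)]) (use S PN in \<open>auto simp: of_bool_def\<close>)
    moreover have "(\<Sum>v\<in>X. signed_netflow N ends \<sigma> h v)
        = 2 * H * of_bool (u \<in> X) - (\<Sum>v\<in>X. signed_netflow J ends \<sigma> h v)"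
      unfolding net_N sum_subtractf sum_distrib_left[symmetric] sum_of_bool_eq[OF finX] \<open>2 * H = c\<close> ..
    ultimately show ?thesis by (simp add: algebra_simps)
  qed
  have total: "sum b V = 0"
  proof -
    have "(\<Sum>v\<in>V. signed_netflow J ends \<sigma> h v) = 0"
      unfolding sum_signed_netflow[OF assms(2)]
      by (rule sum.neutral) (use endsP J PN in auto)
    moreover have "(\<Sum>e\<in>S. of_bool (fst (ends e) \<in> V) + of_bool (snd (ends e) \<in> V)) = (\<Sum>e\<in>S. 2 :: int)"
      by (rule sum.cong) (use endsN S(1) in auto)
    moreover have "H * \<bar>H\<bar> = H" using H by auto
    ultimately show ?thesis using sum_b[OF subset_refl] S(3) u by (auto simp: algebra_simps)
  qed
  have demand: "\<bar>sum b X\<bar> \<le> int k * int (card (crossing P ends X)) + 2 * int k" if X: "X \<subseteq> V" for X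
  proof -
    have finX: "finite X" using X assms(2) finite_subset by blast
    define t where "t = (\<Sum>v\<in>X. signed_netflow J ends \<sigma> h v)"
    define q where "q = (\<Sum>e\<in>S. of_bool (fst (ends e) \<in> X) + of_bool (snd (ends e) \<in> X) :: int)"
    have "\<bar>t\<bar> \<le> (\<Sum>e\<in>J. of_bool ((fst (ends e) \<in> X) \<noteq> (snd (ends e) \<in> X)))"
      unfolding t_def sum_signed_netflow[OF finX]
      by (rule order_trans[OF sum_abs]) (rule sum_mono, use h J PN in force)
    also have "\<dots> \<le> (\<Sum>e\<in>P. of_bool ((fst (ends e) \<in> X) \<noteq> (snd (ends e) \<in> X)))"
      by (rule sum_mono2[OF fin(1) J]) simp
    also have "\<dots> = int (card (crossing P ends X))"
      unfolding crossing_def using fin(1) by (simp add: of_bool_def sum.If_cases Int_def)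
    finally have "int k * \<bar>t\<bar> \<le> int k * int (card (crossing P ends X))" by (rule mult_left_mono) simp
    then have t: "\<bar>int k * t\<bar> \<le> int k * int (card (crossing P ends X))" by (simp add: abs_mult)
    have "0 \<le> q" unfolding q_def by (simp add: sum_nonneg)
    have "q \<le> (\<Sum>e\<in>S. 2)" unfolding q_def by (rule sum_mono) simp
    then have "q \<le> 2 * (int k * \<bar>H\<bar>)" using S(3) by simp
    then have "\<bar>H * (2 * int k * of_bool (u \<in> X) - q)\<bar> \<le> 2 * int k"
      using H \<open>0 \<le> q\<close> by (auto simp: of_bool_def)
    then show ?thesis using t sum_b[OF X] unfolding t_def[symmetric] q_def[symmetric] by linarith
  qed
  obtain f where f: "\<forall>e\<in>P. \<bar>f e\<bar> = int k \<or> \<bar>f e\<bar> = int k + 1" "\<forall>v\<in>V. netflow P ends f v = b v"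
    using exact_flow[OF assms(1,2) fin(1) endsP cuts[folded PN] total demand] by blast
  define F where "F e = (if e \<in> N then g e else f e)" for e
  have PN_disj: "P \<inter> N = {}" and E: "E = P \<union> N" using sign unfolding PN by auto
  have "signed_netflow E ends \<sigma> F v = 0" if "v \<in> V" for v
  proof -
    have "signed_netflow E ends \<sigma> F v = signed_netflow P ends \<sigma> F v + signed_netflow N ends \<sigma> F v"
      unfolding E by (rule signed_netflow_Un[OF fin PN_disj])
    also have "signed_netflow P ends \<sigma> F v = signed_netflow P ends \<sigma> f v"
      by (rule signed_netflow_cong) (use PN_disj F_def in auto)
    also have "\<dots> = b v" using f(2) that PN by (subst signed_netflow_positive) auto
    also have "signed_netflow N ends \<sigma> F v = signed_netflow N ends \<sigma> g v"
      by (rule signed_netflow_cong) (simp add: F_def)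
    finally show ?thesis unfolding b_def by simp
  qed
  moreover have "\<bar>g e\<bar> = int k \<or> \<bar>g e\<bar> = int k + 1" if "e \<in> N" for e
    using h[of e] that unfolding g_def by (auto simp: of_bool_def)
  then have "\<forall>e\<in>E. \<bar>F e\<bar> = int k \<or> \<bar>F e\<bar> = int k + 1"
    using f(1) E unfolding F_def by auto
  ultimately show ?thesis by blast
qed

section \<open>Switching and the circular flow number\<close>

lemma equivalent_sig_switch_set:
  assumes "finite X" "X \<subseteq> V"
  shows "equivalent_sig V ends \<sigma> (\<lambda>e. if (fst (ends e) \<in> X) \<noteq> (snd (ends e) \<in> X) then - \<sigma> e else \<sigma> e)"
  using assms
proof (induction X)
  case empty
  then show ?case unfolding equivalent_sig_def by simp
next
  case (insert v X)
  let ?s = "\<lambda>X e. if (fst (ends e) \<in> X) \<noteq> (snd (ends e) \<in> X) then - \<sigma> e else \<sigma> e"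
  have "?s (insert v X) = switch_at ends v (?s X)"
    unfolding switch_at_def using insert.hyps(2) by (intro ext) auto
  then have "switch_step V ends (?s X) (?s (insert v X))"
    unfolding switch_step_def using insert.prems by blast
  then show ?case
    using insert.IH insert.prems unfolding equivalent_sig_def by (auto intro: rtranclp.rtrancl_into_rtrancl)
qed

lemma equivalent_sig_trans:
  "equivalent_sig V ends \<sigma> \<sigma>' \<Longrightarrow> equivalent_sig V ends \<sigma>' \<sigma>'' \<Longrightarrow> equivalent_sig V ends \<sigma> \<sigma>''"
  unfolding equivalent_sig_def by (rule rtranclp_trans)

lemma equivalent_sig_abs:
  assumes "equivalent_sig V ends \<sigma> \<sigma>'" shows "\<bar>\<sigma>' e\<bar> = \<bar>\<sigma> e\<bar>"
  using assms unfolding equivalent_sig_def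
  by (induction rule: rtranclp_induct) (auto simp: switch_step_def switch_at_def)

text \<open>Negating all half-edge signs at \<open>v\<close> undoes the switching and changes the
  boundary only by a sign at \<open>v\<close>.\<close>

lemma circular_flow_switch_at:
  assumes "circular_flow V E ends (switch_at ends v \<sigma>) r"
  shows "circular_flow V E ends \<sigma> r"
proof -
  obtain \<tau>1 \<tau>2 f where flow: "is_flow V E ends (switch_at ends v \<sigma>) \<tau>1 \<tau>2 f"
    "\<forall>e\<in>E. 1 \<le> \<bar>f e\<bar> \<and> \<bar>f e\<bar> \<le> r - 1"
    using assms unfolding circular_flow_def by blast
  define \<tau>1' where "\<tau>1' e = (if fst (ends e) = v then - \<tau>1 e else \<tau>1 e)" for e
  define \<tau>2' where "\<tau>2' e = (if snd (ends e) = v then - \<tau>2 e else \<tau>2 e)" for e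
  have "orientation E \<sigma> \<tau>1' \<tau>2'"
    using flow(1) unfolding is_flow_def orientation_def switch_at_def \<tau>1'_def \<tau>2'_def by auto
  moreover have "boundary E ends \<tau>1' \<tau>2' f x = (if x = v then - 1 else 1) * boundary E ends \<tau>1 \<tau>2 f x" for x
    unfolding boundary_def sum_distrib_left \<tau>1'_def \<tau>2'_def by (rule sum.cong) auto
  ultimately have "is_flow V E ends \<sigma> \<tau>1' \<tau>2' f"
    using flow(1) unfolding is_flow_def by simp
  then show ?thesis using flow(2) unfolding circular_flow_def by blast
qed

lemma circular_flow_equivalent:
  assumes "equivalent_sig V ends \<sigma> \<sigma>'" "circular_flow V E ends \<sigma>' r"
  shows "circular_flow V E ends \<sigma> r"
  using assms unfolding equivalent_sig_def
  by (induction rule: rtranclp_induct) (auto simp: switch_step_def intro: circular_flow_switch_at)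

text \<open>In an equivalent signature with fewest negative edges, at least half of the edges of every
  cut are positive.\<close>

lemma minimal_signature:
  assumes "signed_graph V E ends \<sigma>" "edge_connected V E ends (12 * k - 1)" "k > 0"
  obtains \<sigma>' where "equivalent_sig V ends \<sigma> \<sigma>'" "\<And>e. e \<in> E \<Longrightarrow> \<sigma>' e = 1 \<or> \<sigma>' e = -1"
    "\<And>X. X \<subseteq> V \<Longrightarrow> X \<noteq> {} \<Longrightarrow> X \<noteq> V \<Longrightarrow> 6 * k \<le> card (crossing {e\<in>E. \<sigma>' e = 1} ends X)"
proof -
  have fin: "finite V" "finite E" using assms(1) unfolding signed_graph_def by auto
  let ?N = "\<lambda>s. {e\<in>E. s e = -1}"
  obtain s where s: "equivalent_sig V ends \<sigma> s"
    "\<And>s'. equivalent_sig V ends \<sigma> s' \<Longrightarrow> card (?N s) \<le> card (?N s')"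
    using ex_has_least_nat[of "equivalent_sig V ends \<sigma>" \<sigma> "\<lambda>s. card (?N s)"]
    unfolding equivalent_sig_def by blast
  have sign: "s e = 1 \<or> s e = -1" if "e \<in> E" for e
    using equivalent_sig_abs[OF s(1), of e] assms(1) that unfolding signed_graph_def by force
  show ?thesis
  proof (rule that[OF s(1) sign])
    fix X assume X: "X \<subseteq> V" "X \<noteq> {}" "X \<noteq> V"
    let ?C = "crossing E ends X" and ?P = "{e\<in>E. s e = 1}"
    let ?s = "\<lambda>e. if (fst (ends e) \<in> X) \<noteq> (snd (ends e) \<in> X) then - s e else s e"
    have "12 * k - 1 \<le> card ?C"
      using assms(2) X unfolding edge_connected_def crossing_def by simp
    moreover have "?C = crossing ?P ends X \<union> crossing (?N s) ends X"
      "crossing ?P ends X \<inter> crossing (?N s) ends X = {}"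
      unfolding crossing_def using sign by auto
    moreover have fin_cross: "finite (crossing ?P ends X)" "finite (crossing (?N s) ends X)"
      unfolding crossing_def using fin(2) by auto
    ultimately have sum: "12 * k - 1 \<le> card (crossing ?P ends X) + card (crossing (?N s) ends X)"
      by (simp add: card_Un_disjoint)
    have "equivalent_sig V ends \<sigma> ?s"
      using equivalent_sig_trans[OF s(1) equivalent_sig_switch_set] X(1) fin(1) finite_subset by blast
    then have "card (?N s) \<le> card (?N ?s)" by (rule s(2))
    moreover have "?N s = crossing (?N s) ends X \<union> (?N s - crossing (?N s) ends X)"
      unfolding crossing_def by auto
    then have "card (?N s) = card (crossing (?N s) ends X) + card (?N s - crossing (?N s) ends X)"
      using fin(2) fin_cross by (metis (no_types, lifting) Diff_disjoint card_Un_disjoint finite_Diff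
          finite_Un finite_subset mem_Collect_eq subsetI)
    moreover have "?N ?s = crossing ?P ends X \<union> (?N s - crossing (?N s) ends X)"
      unfolding crossing_def using sign by (auto split: if_splits)
    then have "card (?N ?s) \<le> card (crossing ?P ends X) + card (?N s - crossing (?N s) ends X)"
      by (metis card_Un_le)
    ultimately have "card (crossing (?N s) ends X) \<le> card (crossing ?P ends X)" by linarith
    \<comment> \<open>Here \<open>12k - 1\<close> is halved and rounded up.\<close>
    then show "6 * k \<le> card (crossing ?P ends X)" using sum assms(3) by linarith
  qed
qed

text \<open>Division by \<open>k\<close> turns the moduli \<open>k\<close> and \<open>k + 1\<close>
  into the extreme values 1 and \<open>1 + 1/k\<close> allowed for
  \<open>r = 2 + 1/k\<close>.\<close>

lemma circular_flow_of_signed_netflow: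
  assumes "k > 0" "\<And>e. e \<in> E \<Longrightarrow> \<bar>f e\<bar> = int k \<or> \<bar>f e\<bar> = int k + 1"
    and "\<And>v. v \<in> V \<Longrightarrow> signed_netflow E ends \<sigma> f v = 0"
  shows "circular_flow V E ends \<sigma> (2 + 1 / real k)"
  unfolding circular_flow_def
proof (intro exI conjI ballI)
  let ?f = "\<lambda>e. real_of_int (f e) / real k"
  show "is_flow V E ends \<sigma> (\<lambda>_. 1) (\<lambda>e. - \<sigma> e) ?f"
    unfolding is_flow_def
  proof (intro conjI ballI)
    show "orientation E \<sigma> (\<lambda>_. 1) (\<lambda>e. - \<sigma> e)" unfolding orientation_def by simp
    fix v assume "v \<in> V"
    have "boundary E ends (\<lambda>_. 1) (\<lambda>e. - \<sigma> e) ?f v = real_of_int (signed_netflow E ends \<sigma> f v) / real k"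
      unfolding boundary_def signed_netflow_def of_int_sum sum_divide_distrib
      by (rule sum.cong) (auto simp: diff_divide_distrib add_divide_distrib)
    then show "boundary E ends (\<lambda>_. 1) (\<lambda>e. - \<sigma> e) ?f v = 0" using assms(3)[OF \<open>v \<in> V\<close>] by simp
  qed
  fix e assume "e \<in> E"
  have "\<bar>?f e\<bar> = real_of_int \<bar>f e\<bar> / real k" by simp
  moreover have "real_of_int \<bar>f e\<bar> = real k \<or> real_of_int \<bar>f e\<bar> = real k + 1"
    using assms(2)[OF \<open>e \<in> E\<close>] by (elim disjE) (simp_all only: of_int_of_nat_eq of_int_add of_int_1 simp_thms)
  ultimately have "\<bar>?f e\<bar> = 1 \<or> \<bar>?f e\<bar> = 1 + 1 / real k"
    using assms(1) by (auto simp: add_divide_distrib simp del: of_int_abs)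
  then show "1 \<le> \<bar>?f e\<bar>" "\<bar>?f e\<bar> \<le> 2 + 1 / real k - 1" by auto
qed

theorem theorem1:
  fixes V :: "'v set" and E :: "'e set" and ends :: "'e \<Rightarrow> 'v \<times> 'v"
    and \<sigma> :: "'e \<Rightarrow> int" and k :: nat
  assumes "k > 0"
    and "signed_graph V E ends \<sigma>"
    and "edge_connected V E ends (12 * k - 1)"
    and "essentially_unbalanced V E ends \<sigma> (2 * k + 1)"
  shows "circular_flow_number V E ends \<sigma> \<le> ereal (2 + 1 / real k)"
proof -
  have fin: "finite V" "finite E" and ends: "\<And>e. e \<in> E \<Longrightarrow> fst (ends e) \<in> V \<and> snd (ends e) \<in> V"
    using assms(2) unfolding signed_graph_def by auto
  obtain s where s: "equivalent_sig V ends \<sigma> s" "\<And>e. e \<in> E \<Longrightarrow> s e = 1 \<or> s e = -1"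
    "\<And>X. X \<subseteq> V \<Longrightarrow> X \<noteq> {} \<Longrightarrow> X \<noteq> V \<Longrightarrow> 6 * k \<le> card (crossing {e\<in>E. s e = 1} ends X)"
    using minimal_signature[OF assms(2,3,1)] by blast
  have "even (card {e\<in>E. s e = -1}) \<or> 2 * k + 1 \<le> card {e\<in>E. s e = -1}"
    using assms(4) s(1) unfolding essentially_unbalanced_def by blast
  from signed_exact_flow[OF assms(1) fin ends s(2,3) this]
  obtain f where "\<forall>e\<in>E. \<bar>f e\<bar> = int k \<or> \<bar>f e\<bar> = int k + 1" "\<forall>v\<in>V. signed_netflow E ends s f v = 0"
    by blast
  then have "circular_flow V E ends s (2 + 1 / real k)"
    by (intro circular_flow_of_signed_netflow[OF assms(1)]) blast+
  then have "circular_flow V E ends \<sigma> (2 + 1 / real k)"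
    by (rule circular_flow_equivalent[OF s(1)])
  then show ?thesis unfolding circular_flow_number_def by (intro Inf_lower imageI) simp
qed

end
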